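(* Let $m\ge 1$, let $\lambda\in\mathbb R$, and let $\Sigma^m\subset\mathbb R^{m+1}$ be a smooth, closed, connected, embedded hypersurface which is a $\lambda$-self-expander, i.e. with a smooth unit normal field $\nu$ it satisfies $$H+\tfrac12\langle x,\nu\rangle=\lambda\qquad\text{at every } x\in\Sigma .$$ Then $\Sigma$ is a round sphere centered at the origin.
   Context: Closed means compact without boundary. $\langle\cdot,\cdot\rangle$ is the Euclidean inner product and $x$ is the position vector. $H$ is the unnormalized mean curvature of $\Sigma$ with respect to $\nu$, with the sign convention $H=\sum_{i=1}^m\langle D_{e_i}\nu,e_i\rangle$ for a local orthonormal frame $\{e_i\}$ of $T\Sigma$, where $D$ is the flat connection (so the sphere of radius $R$ with outward normal has $H=m/R$). $\lambda$ is a constant. *)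

theory Defs
  imports "HOL-Analysis.Analysis"
begin

text \<open>
  \<open>C_k_on k f U\<close> is meant for open \<open>U\<close>: all iterated directional derivatives of \<open>f\<close> of order at
  most \<open>k\<close> exist on \<open>U\<close> (as total derivatives at each stage) and are continuous.
\<close>

primrec C_k_on ::
  "nat \<Rightarrow> ('a::real_normed_vector \<Rightarrow> 'b::real_normed_vector) \<Rightarrow> 'a set \<Rightarrow> bool" where
  "C_k_on 0 f U \<longleftrightarrow> continuous_on U f"
| "C_k_on (Suc k) f U \<longleftrightarrow>
     (\<forall>x\<in>U. f differentiable (at x)) \<and>
     (\<forall>v. C_k_on k (\<lambda>x. frechet_derivative f (at x) v) U)"

definition smooth_on :: "('a::real_normed_vector \<Rightarrow> 'b::real_normed_vector) \<Rightarrow> 'a set \<Rightarrow> bool" where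
  "smooth_on f U \<longleftrightarrow> (\<forall>k. C_k_on k f U)"

text \<open>
  An embedded submanifold of codimension one without boundary, by slice charts: locally a
  diffeomorphism between open sets of the ambient space flattens \<open>S\<close> to a linear hyperplane.
  The subset \<open>S\<close> carries the subspace topology, so this is embeddedness and not just immersion;
  closedness or compactness is not part of the definition.
\<close>

definition smooth_hypersurface :: "'a::euclidean_space set \<Rightarrow> bool" where
  "smooth_hypersurface S \<longleftrightarrow>
     (\<forall>p\<in>S. \<exists>U V \<phi> \<psi> (e::'a).
        open U \<and> p \<in> U \<and> open V \<and> e \<noteq> 0 \<and>
        homeomorphism U V \<phi> \<psi> \<and> smooth_on \<phi> U \<and> smooth_on \<psi> V \<and>
        \<phi> ` (U \<inter> S) = V \<inter> {y. e \<bullet> y = 0})"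

definition tangent_space :: "'a::euclidean_space set \<Rightarrow> 'a \<Rightarrow> 'a set" where
  "tangent_space S x =
     {v. \<exists>\<epsilon>>0. \<exists>\<gamma>::real \<Rightarrow> 'a. smooth_on \<gamma> {-\<epsilon><..<\<epsilon>} \<and> \<gamma> ` {-\<epsilon><..<\<epsilon>} \<subseteq> S \<and>
        \<gamma> 0 = x \<and> (\<gamma> has_vector_derivative v) (at 0)}"

text \<open>Smoothness of a map defined along a subset: local smooth extendability.\<close>

definition smooth_along ::
  "'a::euclidean_space set \<Rightarrow> ('a \<Rightarrow> 'b::real_normed_vector) \<Rightarrow> bool" where
  "smooth_along S f \<longleftrightarrow>
     (\<forall>p\<in>S. \<exists>U g. open U \<and> p \<in> U \<and> smooth_on g U \<and> (\<forall>x\<in>U \<inter> S. g x = f x))"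

definition smooth_unit_normal_field :: "'a::euclidean_space set \<Rightarrow> ('a \<Rightarrow> 'a) \<Rightarrow> bool" where
  "smooth_unit_normal_field S \<nu> \<longleftrightarrow>
     smooth_along S \<nu> \<and> (\<forall>x\<in>S. norm (\<nu> x) = 1 \<and> (\<forall>v\<in>tangent_space S x. \<nu> x \<bullet> v = 0))"

text \<open>
  The flat connection \<open>D\<^sub>v f\<close> for \<open>v\<close> tangent to \<open>S\<close>. A derivative of \<open>f\<close> within \<open>S\<close> is not unique
  as a linear map on the ambient space, but its values on tangent vectors are; see
  \<open>tangential_derivative_eq\<close> below.
\<close>

definition tangential_derivative ::
  "'a::euclidean_space set \<Rightarrow> ('a \<Rightarrow> 'b::real_normed_vector) \<Rightarrow> 'a \<Rightarrow> 'a \<Rightarrow> 'b" where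
  "tangential_derivative S f x v = frechet_derivative f (at x within S) v"

definition orthonormal_basis_of :: "'a::euclidean_space set \<Rightarrow> 'a set \<Rightarrow> bool" where
  "orthonormal_basis_of T B \<longleftrightarrow> pairwise orthogonal B \<and> (\<forall>b\<in>B. norm b = 1) \<and> span B = T"

text \<open>
  Unnormalized mean curvature, with the sign for which a sphere of radius \<open>R\<close> in dimension \<open>m + 1\<close>
  with outward normal has \<open>H = m / R\<close>. The value does not depend on the chosen basis; see
  \<open>mean_curvature_eq\<close> and \<open>exists_orthonormal_basis_of_tangent_space\<close> below.
\<close>

definition mean_curvature :: "'a::euclidean_space set \<Rightarrow> ('a \<Rightarrow> 'a) \<Rightarrow> 'a \<Rightarrow> real" where
  "mean_curvature S \<nu> x =
     (\<Sum>e \<in> (SOME B. orthonormal_basis_of (tangent_space S x) B). tangential_derivative S \<nu> x e \<bullet> e)"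


lemma C_k_on_affine_line:
  fixes f :: "'a::euclidean_space \<Rightarrow> 'b::real_normed_vector"
  assumes "C_k_on k f V" "open I" "\<And>t. t \<in> I \<Longrightarrow> a + t *\<^sub>R w \<in> V"
  shows "C_k_on k (\<lambda>t::real. f (a + t *\<^sub>R w)) I"
  using assms(1)
proof (induction k arbitrary: f)
  case 0
  then show ?case
    using assms(3) by (auto intro!: continuous_on_compose2[of V f] continuous_intros)
next
  case (Suc k)
  have D: "((\<lambda>t. f (a + t *\<^sub>R w)) has_derivative
             (\<lambda>s. frechet_derivative f (at (a + t *\<^sub>R w)) (s *\<^sub>R w))) (at t)" if "t \<in> I" for t
  proof -
    have "(f has_derivative frechet_derivative f (at (a + t *\<^sub>R w))) (at (a + t *\<^sub>R w))"
      using Suc.prems assms(3)[OF that] by (simp add: frechet_derivative_works)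
    moreover have "((\<lambda>t. a + t *\<^sub>R w) has_derivative (\<lambda>s. s *\<^sub>R w)) (at t)"
      by (auto intro!: derivative_eq_intros)
    ultimately show ?thesis
      using has_derivative_compose by blast
  qed
  have cong: "C_k_on j g I = C_k_on j h I" if "\<And>t. t \<in> I \<Longrightarrow> g t = h t"
    for j and g h :: "real \<Rightarrow> 'b"
    using that
  proof (induction j arbitrary: g h)
    case 0
    then show ?case by (simp cong: continuous_on_cong)
  next
    case (Suc j)
    have dd: "(g has_derivative d) (at t) = (h has_derivative d) (at t)" if "t \<in> I" for t d
      by (rule iffI; erule has_derivative_transform_within_open[OF _ \<open>open I\<close> that])
         (simp_all add: Suc.prems)
    have d1: "g differentiable (at t) \<longleftrightarrow> h differentiable (at t)" if "t \<in> I" for t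
      using dd[OF that] by (simp add: differentiable_def)
    have "frechet_derivative g (at t) v = frechet_derivative h (at t) v" if "t \<in> I" for t v
      using dd[OF that] by (simp add: frechet_derivative_def)
    then have "C_k_on j (\<lambda>t. frechet_derivative g (at t) v) I =
        C_k_on j (\<lambda>t. frechet_derivative h (at t) v) I" for v
      by (rule Suc.IH)
    with d1 show ?case by simp
  qed
  have "C_k_on k (\<lambda>t. frechet_derivative f (at (a + t *\<^sub>R w)) (s *\<^sub>R w)) I" for s :: real
    using Suc.IH[of "\<lambda>x. frechet_derivative f (at x) (s *\<^sub>R w)"] Suc.prems by simp
  moreover have "frechet_derivative (\<lambda>t. f (a + t *\<^sub>R w)) (at t) s =
      frechet_derivative f (at (a + t *\<^sub>R w)) (s *\<^sub>R w)" if "t \<in> I" for t s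
    using fun_cong[OF frechet_derivative_at[OF D[OF that]], of s] by (rule sym)
  then have "C_k_on k (\<lambda>t. frechet_derivative (\<lambda>t. f (a + t *\<^sub>R w)) (at t) s) I =
      C_k_on k (\<lambda>t. frechet_derivative f (at (a + t *\<^sub>R w)) (s *\<^sub>R w)) I" for s
    by (rule cong)
  moreover have "(\<lambda>t. f (a + t *\<^sub>R w)) differentiable (at t)" if "t \<in> I" for t
    using D[OF that] by (rule differentiableI)
  ultimately show ?case by simp
qed

lemma smooth_on_has_derivative:
  "\<lbrakk>smooth_on f U; x \<in> U\<rbrakk> \<Longrightarrow> (f has_derivative frechet_derivative f (at x)) (at x)"
  unfolding smooth_on_def by (drule spec[of _ "Suc 0"]) (simp add: frechet_derivative_works)

lemma tangential_derivative_unique: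
  fixes S :: "'a::euclidean_space set" and f :: "'a \<Rightarrow> 'b::real_normed_vector"
  assumes "(f has_derivative L) (at x within S)" "(f has_derivative M) (at x within S)"
    and "v \<in> tangent_space S x"
  shows "L v = M v"
proof -
  obtain \<epsilon> \<gamma> where g: "\<epsilon> > 0" "\<gamma> ` {-\<epsilon><..<\<epsilon>} \<subseteq> S" "\<gamma> 0 = x"
      "(\<gamma> has_vector_derivative v) (at 0)"
    using assms(3) by (auto simp: tangent_space_def)
  let ?I = "{-\<epsilon><..<\<epsilon>}"
  have at: "at 0 within ?I = at (0::real)"
    using g(1) by (intro at_within_open) auto
  have G: "(\<gamma> has_derivative (\<lambda>s. s *\<^sub>R v)) (at 0 within ?I)"
    using g(4) by (simp add: has_vector_derivative_def at)
  have "((\<lambda>t. f (\<gamma> t)) has_derivative (\<lambda>s. N (s *\<^sub>R v))) (at 0)"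
    if "(f has_derivative N) (at x within S)" for N
    using has_derivative_in_compose[OF G, of f N] has_derivative_subset[OF that g(2)] g(3) at by simp
  from fun_cong[OF has_derivative_unique[OF this[OF assms(1)] this[OF assms(2)]], of 1]
  show ?thesis by simp
qed

lemma tangential_derivative_eq:
  assumes "(f has_derivative L) (at x within S)" "v \<in> tangent_space S x"
  shows "tangential_derivative S f x v = L v"
proof -
  have "f differentiable (at x within S)"
    using assms(1) by (rule differentiableI)
  then have "(f has_derivative frechet_derivative f (at x within S)) (at x within S)"
    by (simp add: frechet_derivative_works)
  from tangential_derivative_unique[OF this assms] show ?thesis
    by (simp add: tangential_derivative_def)
qed

lemma smooth_along_has_derivative:
  assumes "smooth_along S f" "x \<in> S"
  shows "\<exists>L. (f has_derivative L) (at x within S)"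
proof -
  obtain U g where U: "open U" "x \<in> U" "smooth_on g U" "\<forall>x\<in>U \<inter> S. g x = f x"
    using assms by (auto simp: smooth_along_def)
  have "(g has_derivative frechet_derivative g (at x)) (at x within S)"
    using smooth_on_has_derivative[OF U(3,2)] has_derivative_at_withinI by blast
  moreover have "\<forall>\<^sub>F y in at x within S. g y = f y"
    using U(1,2,4) by (auto simp: eventually_at_topological)
  ultimately have "(f has_derivative frechet_derivative g (at x)) (at x within S)"
    using has_derivative_transform_eventually[of g _ x S f] U(2,4) assms(2) by blast
  then show ?thesis by (intro exI)
qed

lemma tangent_space_chart:
  fixes S U V :: "'a::euclidean_space set" and \<phi> \<psi> :: "'a \<Rightarrow> 'a"
  assumes U: "open U" "p \<in> U" "open V" and h: "homeomorphism U V \<phi> \<psi>"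
    and sm: "smooth_on \<phi> U" "smooth_on \<psi> V"
    and sl: "\<phi> ` (U \<inter> S) = V \<inter> {y. e \<bullet> y = 0}" and p: "p \<in> S"
  defines "A \<equiv> frechet_derivative \<psi> (at (\<phi> p))"
  shows "tangent_space S p = A ` {w. e \<bullet> w = 0}" "linear A" "inj A"
proof -
  define F where "F = frechet_derivative \<phi> (at p)"
  have q: "\<phi> p \<in> V" "e \<bullet> \<phi> p = 0" using U p sl by blast+
  have pq: "\<psi> (\<phi> p) = p" using h U(2) by (auto simp: homeomorphism_def)
  have dF: "(\<phi> has_derivative F) (at p)"
    unfolding F_def by (rule smooth_on_has_derivative[OF sm(1) U(2)])
  have dA: "(\<psi> has_derivative A) (at (\<phi> p))"
    unfolding A_def by (rule smooth_on_has_derivative[OF sm(2) q(1)])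
  show lin: "linear A" using dA has_derivative_linear by blast
  have "((\<lambda>x. \<psi> (\<phi> x)) has_derivative (\<lambda>v. A (F v))) (at p)"
    using has_derivative_compose[OF dF dA] .
  moreover have "((\<lambda>x. \<psi> (\<phi> x)) has_derivative (\<lambda>v. v)) (at p)"
    using has_derivative_transform_within_open[OF has_derivative_ident U(1,2), of "\<lambda>x. \<psi> (\<phi> x)"] h
    by (auto simp: homeomorphism_def)
  ultimately have "(\<lambda>v. A (F v)) = (\<lambda>v. v)" by (rule has_derivative_unique)
  then have AF: "A (F v) = v" for v by (rule fun_cong)
  have "((\<lambda>y. \<phi> (\<psi> y)) has_derivative (\<lambda>v. F (A v))) (at (\<phi> p))"
    using has_derivative_compose[OF dA] dF pq by simp
  moreover have "((\<lambda>y. \<phi> (\<psi> y)) has_derivative (\<lambda>v. v)) (at (\<phi> p))"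
    using has_derivative_transform_within_open[OF has_derivative_ident U(3) q(1), of "\<lambda>y. \<phi> (\<psi> y)"] h
    by (auto simp: homeomorphism_def)
  ultimately have "(\<lambda>v. F (A v)) = (\<lambda>v. v)" by (rule has_derivative_unique)
  then have FA: "F (A v) = v" for v by (rule fun_cong)
  show "inj A" by (metis FA injI)
  show "tangent_space S p = A ` {w. e \<bullet> w = 0}"
  proof (intro equalityI subsetI)
    fix v assume "v \<in> tangent_space S p"
    then obtain \<epsilon> \<gamma> where g: "\<epsilon> > 0" "\<gamma> ` {-\<epsilon><..<\<epsilon>} \<subseteq> S" "\<gamma> 0 = p"
        "(\<gamma> has_vector_derivative v) (at 0)"
      by (auto simp: tangent_space_def)
    have gd: "(\<gamma> has_derivative (\<lambda>s. s *\<^sub>R v)) (at 0)"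
      using g(4) by (simp add: has_vector_derivative_def)
    have "((\<lambda>t. \<phi> (\<gamma> t)) has_derivative (\<lambda>s. F (s *\<^sub>R v))) (at 0)"
      using has_derivative_compose[OF gd] dF g(3) by simp
    then have d1: "((\<lambda>t. e \<bullet> \<phi> (\<gamma> t)) has_derivative (\<lambda>s. e \<bullet> F (s *\<^sub>R v))) (at 0)"
      by (auto intro!: derivative_eq_intros)
    have "isCont \<gamma> 0" using gd has_derivative_continuous by blast
    then have "\<forall>\<^sub>F t in nhds 0. \<gamma> t \<in> U"
      using g(3) U(1,2) topological_tendstoD[of \<gamma> p "at 0" U]
      by (simp add: isCont_def eventually_nhds_conv_at)
    moreover have "\<forall>\<^sub>F t in nhds 0. t \<in> {-\<epsilon><..<\<epsilon>}"
      using g(1) by (intro eventually_nhds_in_open) auto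
    ultimately have ev: "\<forall>\<^sub>F t in nhds 0. e \<bullet> \<phi> (\<gamma> t) = 0"
    proof eventually_elim
      case (elim t)
      then have "\<phi> (\<gamma> t) \<in> V \<inter> {y. e \<bullet> y = 0}" using sl g(2) by blast
      then show ?case by simp
    qed
    have d0: "((\<lambda>t. e \<bullet> \<phi> (\<gamma> t)) has_derivative (\<lambda>s. 0)) (at 0)"
    proof -
      obtain W where W: "open W" "0 \<in> W" "\<forall>t\<in>W. e \<bullet> \<phi> (\<gamma> t) = 0"
        using ev by (auto simp: eventually_nhds)
      show ?thesis
        by (rule has_derivative_transform_within_open[OF has_derivative_const[of 0] W(1,2)])
           (use W(3) in auto)
    qed
    have "e \<bullet> F v = 0" using fun_cong[OF has_derivative_unique[OF d1 d0], of 1] by simp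
    then show "v \<in> A ` {w. e \<bullet> w = 0}" using AF by (metis (mono_tags) image_eqI mem_Collect_eq)
  next
    fix v assume "v \<in> A ` {w. e \<bullet> w = 0}"
    then obtain w where w: "v = A w" "e \<bullet> w = 0" by auto
    have "\<forall>\<^sub>F t::real in nhds 0. \<phi> p + t *\<^sub>R w \<in> V"
    proof -
      have "isCont (\<lambda>t::real. \<phi> p + t *\<^sub>R w) 0" by (intro continuous_intros)
      then have "((\<lambda>t::real. \<phi> p + t *\<^sub>R w) \<longlongrightarrow> \<phi> p) (at 0)" by (simp add: isCont_def)
      then show ?thesis
        using U(3) q(1) topological_tendstoD[of "\<lambda>t::real. \<phi> p + t *\<^sub>R w" "\<phi> p" "at 0" V]
        by (simp add: eventually_nhds_conv_at)
    qed
    then obtain \<epsilon> where e: "\<epsilon> > 0" "\<And>t. \<bar>t\<bar> < \<epsilon> \<Longrightarrow> \<phi> p + t *\<^sub>R w \<in> V"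
      by (auto simp: eventually_nhds_metric dist_real_def)
    let ?g = "\<lambda>t::real. \<psi> (\<phi> p + t *\<^sub>R w)"
    have "smooth_on ?g {-\<epsilon><..<\<epsilon>}"
      using sm(2) e C_k_on_affine_line[of _ \<psi> V "{-\<epsilon><..<\<epsilon>}" "\<phi> p" w]
      by (auto simp: smooth_on_def abs_less_iff)
    moreover have "?g t \<in> S" if "\<bar>t\<bar> < \<epsilon>" for t
    proof -
      have "\<phi> p + t *\<^sub>R w \<in> V \<inter> {y. e \<bullet> y = 0}"
        using e(2)[OF that] q(2) w(2) by (simp add: inner_right_distrib)
      then obtain s where "s \<in> U \<inter> S" "\<phi> p + t *\<^sub>R w = \<phi> s" using sl by blast
      then show ?thesis using h by (auto simp: homeomorphism_def)
    qed
    moreover have "(?g has_vector_derivative v) (at 0)"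
    proof -
      have "((\<lambda>t::real. \<phi> p + t *\<^sub>R w) has_derivative (\<lambda>s. s *\<^sub>R w)) (at 0)"
        by (auto intro!: derivative_eq_intros)
      from has_derivative_compose[OF this, of \<psi> A] dA
      have "(?g has_derivative (\<lambda>s. A (s *\<^sub>R w))) (at 0)" by simp
      then show ?thesis
        using w(1) lin by (simp add: has_vector_derivative_def linear_cmul)
    qed
    ultimately show "v \<in> tangent_space S p"
      using e(1) pq unfolding tangent_space_def
      by (intro CollectI exI[of _ \<epsilon>] conjI exI[of _ ?g]) auto
  qed
qed

lemma tangent_space_subspace_dim:
  fixes S :: "'a::euclidean_space set"
  assumes "smooth_hypersurface S" "p \<in> S"
  shows "subspace (tangent_space S p)" "dim (tangent_space S p) = DIM('a) - 1"
proof -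
  obtain U V \<phi> \<psi> and e :: 'a where c: "open U" "p \<in> U" "open V" "homeomorphism U V \<phi> \<psi>"
      "smooth_on \<phi> U" "smooth_on \<psi> V" "\<phi> ` (U \<inter> S) = V \<inter> {y. e \<bullet> y = 0}" and e: "e \<noteq> 0"
    using bspec[OF assms(1)[unfolded smooth_hypersurface_def] assms(2)] by blast
  note T = tangent_space_chart[OF c assms(2)]
  show "subspace (tangent_space S p)"
    unfolding T(1) by (rule linear_subspace_image[OF T(2) subspace_hyperplane])
  show "dim (tangent_space S p) = DIM('a) - 1"
    unfolding T(1) dim_image_eq[OF T(2) inj_on_subset[OF T(3) subset_UNIV]]
    by (rule dim_hyperplane[OF e])
qed

lemma exists_orthonormal_basis_of_tangent_space:
  fixes S :: "'a::euclidean_space set"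
  assumes "smooth_hypersurface S" "p \<in> S"
  shows "\<exists>B. orthonormal_basis_of (tangent_space S p) B \<and> card B = DIM('a) - 1"
  using orthonormal_basis_subspace[OF tangent_space_subspace_dim(1)[OF assms]]
    tangent_space_subspace_dim(2)[OF assms]
  unfolding orthonormal_basis_of_def by metis

lemma orthonormal_basis_trace_eq:
  fixes B C :: "'a::euclidean_space set"
  assumes B: "orthonormal_basis_of T B" and C: "orthonormal_basis_of T C" and L: "linear L"
  shows "(\<Sum>b\<in>B. L b \<bullet> b) = (\<Sum>c\<in>C. L c \<bullet> c)"
proof -
  have fin: "finite X" if "orthonormal_basis_of T X" for X
    using that pairwise_orthogonal_independent[of X] independent_imp_finite
    by (fastforce simp: orthonormal_basis_of_def)
  have expand: "(\<Sum>b\<in>X. (b \<bullet> v) *\<^sub>R b) = v" if X: "orthonormal_basis_of T X" and v: "v \<in> T" for X v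
  proof -
    have "v \<in> span X" using X v by (simp add: orthonormal_basis_of_def)
    then show ?thesis
    proof (induction rule: span_induct_alt)
      case base
      show ?case by simp
    next
      case (step c x y)
      have "b \<bullet> x = (if b = x then 1 else 0)" if "b \<in> X" for b
        using X that step.hyps
        by (auto simp: orthonormal_basis_of_def pairwise_def orthogonal_def dot_square_norm)
      then have "(\<Sum>b\<in>X. (b \<bullet> x) *\<^sub>R b) = (\<Sum>b\<in>X. if b = x then b else 0)"
        by (intro sum.cong) auto
      also have "\<dots> = x" using fin[OF X] step.hyps by simp
      finally have "(\<Sum>b\<in>X. (b \<bullet> x) *\<^sub>R b) = x" .
      then show ?case using step.IH
        by (simp add: inner_right_distrib scaleR_add_left sum.distrib
            flip: scaleR_scaleR scaleR_sum_right)
    qed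
  qed
  have sub: "B \<subseteq> T" "C \<subseteq> T"
    using B C span_superset unfolding orthonormal_basis_of_def by metis+
  have "(\<Sum>b\<in>B. L b \<bullet> b) = (\<Sum>b\<in>B. L (\<Sum>c\<in>C. (c \<bullet> b) *\<^sub>R c) \<bullet> b)"
    using expand[OF C] sub by (intro sum.cong) (auto simp: subset_eq)
  also have "\<dots> = (\<Sum>b\<in>B. \<Sum>c\<in>C. (c \<bullet> b) * (L c \<bullet> b))"
    by (simp add: linear_sum[OF L] linear_cmul[OF L] inner_sum_left)
  also have "\<dots> = (\<Sum>c\<in>C. \<Sum>b\<in>B. (c \<bullet> b) * (L c \<bullet> b))" by (rule sum.swap)
  also have "\<dots> = (\<Sum>c\<in>C. L c \<bullet> (\<Sum>b\<in>B. (b \<bullet> c) *\<^sub>R b))"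
    by (simp add: inner_sum_right inner_commute)
  also have "\<dots> = (\<Sum>c\<in>C. L c \<bullet> c)"
    using expand[OF B] sub by (intro sum.cong) (auto simp: subset_eq)
  finally show ?thesis .
qed

lemma mean_curvature_eq:
  assumes B: "orthonormal_basis_of (tangent_space S x) B" and "smooth_along S \<nu>" "x \<in> S"
  shows "mean_curvature S \<nu> x = (\<Sum>e\<in>B. tangential_derivative S \<nu> x e \<bullet> e)"
proof -
  obtain L where L: "(\<nu> has_derivative L) (at x within S)"
    using smooth_along_has_derivative assms(2,3) by metis
  have "(\<Sum>e\<in>X. tangential_derivative S \<nu> x e \<bullet> e) = (\<Sum>e\<in>X. L e \<bullet> e)"
    if X: "orthonormal_basis_of (tangent_space S x) X" for X
  proof (rule sum.cong)
    fix e assume "e \<in> X"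
    then have "e \<in> tangent_space S x"
      using X span_base unfolding orthonormal_basis_of_def by metis
    then show "tangential_derivative S \<nu> x e \<bullet> e = L e \<bullet> e"
      using tangential_derivative_eq[OF L] by metis
  qed simp
  moreover have "orthonormal_basis_of (tangent_space S x)
      (SOME B. orthonormal_basis_of (tangent_space S x) B)"
    using B by (rule someI)
  ultimately show ?thesis
    using B orthonormal_basis_trace_eq has_derivative_linear[OF L]
    unfolding mean_curvature_def by metis
qed

end

theory Submission
  imports Defs
begin

text \<open>
  A variant of Alexandrov's moving planes in which all directions are treated at once and only
  second-order conditions at a maximum are used. Let \<open>\<Omega>\<close> be the region enclosed by \<open>S\<close>, with
  outer normal \<open>n\<close>, and let \<open>T\<close> be the supremum of \<open>(|x|\<^sup>2 - |y|\<^sup>2) / (2 |x - y|)\<close>, the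
  signed distance from the origin to the perpendicular bisector of \<open>x\<close> and \<open>y\<close>, over \<open>x\<close> in the
  closure of \<open>\<Omega>\<close> and \<open>y\<close> outside \<open>\<Omega>\<close>. If \<open>T \<le> 0\<close>, then \<open>\<Omega>\<close> is a ball centred at the
  origin, so suppose \<open>T > 0\<close>.

  If \<open>T\<close> is attained at \<open>x \<noteq> y\<close>, then \<open>S\<close> and its reflection in the bisector touch at \<open>y\<close>, and
  the second variation gives \<open>H(y) \<le> H(x)\<close>; the equation gives the opposite strict inequality.
  Otherwise \<open>T = \<langle>p, e\<rangle>\<close> is attained in the limit \<open>x, y \<rightarrow> p\<close> with a unit tangent vector
  \<open>e\<close>. Then \<open>|x\<^sup>T|\<close> is maximal on \<open>S\<close> at \<open>p\<close>, so \<open>e\<close> is a principal direction of curvature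
  \<open>1 / \<langle>p, n\<rangle> > 0\<close>, and the second-order conditions add up, by the Codazzi equation, to
  \<open>D\<^sub>e H \<ge> 0\<close>, whereas the equation gives \<open>D\<^sub>e H = - T / (2 \<langle>p, n\<rangle>) < 0\<close>. This takes the
  place of the Hopf boundary lemma.
\<close>

subsection \<open>Smooth maps\<close>

text \<open>Two obstacles shape the proof. The supremum runs over pairs with
  \<open>x \<noteq> y\<close>, which do not form a compact set; recording the unit chord direction
  \<open>e\<close> as a third coordinate turns the quotient into
  \<open>e \<bullet> (x + y) / 2\<close>, which is continuous up to the diagonal, and transversality
  forces a limiting \<open>e\<close> to be tangent. On the diagonal, maximality of |x^T| alone gives
  the wanted inequality in directions orthogonal to \<open>e\<close>, but in the direction
  \<open>e\<close> it falls short by the positive term (T / <p, n>)^2; there the two-point bound is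
  used again, for \<open>\<gamma> s\<close> and \<open>\<gamma> (- s)\<close> on a curve with
  velocity \<open>e\<close>, expanded to third order. The equation enters only through differences
  and derivatives, which removes the constant, and it survives a reversal of the normal with the
  constant negated; so the normal may be taken to be outer. The enclosed region has itself to be
  constructed: it is one side of a level set of a continuous angle, the argument of a nonvanishing
  complex function built from the signed distance to \<open>S\<close>.\<close>

lemma frechet_derivative_cong_open:
  assumes "open U" "x \<in> U" "\<And>y. y \<in> U \<Longrightarrow> f y = g y"
  shows "f differentiable (at x) \<longleftrightarrow> g differentiable (at x)"
    and "frechet_derivative f (at x) = frechet_derivative g (at x)"
proof -
  have "(f has_derivative D) (at x) = (g has_derivative D) (at x)" for D
    by (rule iffI; erule has_derivative_transform_within_open[OF _ assms(1,2)]) (simp_all add: assms(3))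
  then show "f differentiable (at x) \<longleftrightarrow> g differentiable (at x)"
    and "frechet_derivative f (at x) = frechet_derivative g (at x)"
    by (simp_all add: differentiable_def frechet_derivative_def)
qed

lemma C_k_on_cong:
  assumes "open U" "\<And>x. x \<in> U \<Longrightarrow> f x = g x"
  shows "C_k_on k f U = C_k_on k g U"
  using assms(2)
proof (induction k arbitrary: f g)
  case 0
  then show ?case by (simp cong: continuous_on_cong)
next
  case (Suc k)
  have "C_k_on k (\<lambda>x. frechet_derivative f (at x) v) U = C_k_on k (\<lambda>x. frechet_derivative g (at x) v) U" for v
    by (rule Suc.IH) (use frechet_derivative_cong_open(2)[OF assms(1), of _ f g] Suc.prems in simp)
  moreover have "\<forall>x\<in>U. f differentiable (at x) \<longleftrightarrow> g differentiable (at x)"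
    using frechet_derivative_cong_open(1)[OF assms(1)] Suc.prems by metis
  ultimately show ?case by simp
qed

lemma C_k_on_bounded_linear:
  assumes L: "bounded_linear L" and "open U" and "C_k_on k f U"
  shows "C_k_on k (\<lambda>x. L (f x)) U"
  using assms(3)
proof (induction k arbitrary: f)
  case 0
  then show ?case
    using bounded_linear.continuous_on[OF L] by simp
next
  case (Suc k)
  have D: "((\<lambda>x. L (f x)) has_derivative (\<lambda>v. L (frechet_derivative f (at x) v))) (at x)" if "x \<in> U" for x
    using bounded_linear.has_derivative[OF L] Suc.prems that frechet_derivative_works
    by (metis C_k_on.simps(2))
  have "frechet_derivative (\<lambda>x. L (f x)) (at x) v = L (frechet_derivative f (at x) v)" if "x \<in> U" for x v
    using frechet_derivative_at[OF D[OF that]] by metis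
  then have "C_k_on k (\<lambda>x. frechet_derivative (\<lambda>x. L (f x)) (at x) v) U" for v
    using Suc by (subst C_k_on_cong[OF assms(2)]) auto
  then show ?case using D by (auto intro: differentiableI)
qed

lemma smooth_on_bounded_linear:
  "\<lbrakk>bounded_linear L; open U; smooth_on f U\<rbrakk> \<Longrightarrow> smooth_on (\<lambda>x. L (f x)) U"
  using C_k_on_bounded_linear unfolding smooth_on_def by blast

lemma smooth_on_subset:
  assumes "smooth_on f U" "V \<subseteq> U" shows "smooth_on f V"
proof -
  have "C_k_on k f V" if "C_k_on k f U" for k and f :: "'a \<Rightarrow> 'b"
    using that
  proof (induction k arbitrary: f)
    case 0
    then show ?case using continuous_on_subset assms(2) by auto
  next
    case (Suc k)
    then show ?case using assms(2) by auto
  qed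
  with assms(1) show ?thesis by (simp add: smooth_on_def)
qed

lemma smooth_on_frechet_derivative:
  "smooth_on f U \<Longrightarrow> smooth_on (\<lambda>x. frechet_derivative f (at x) v) U"
  unfolding smooth_on_def by (metis C_k_on.simps(2))

lemma smooth_on_continuous_on: "smooth_on f U \<Longrightarrow> continuous_on U f"
  unfolding smooth_on_def by (metis C_k_on.simps(1))

abbreviation D1 :: "('a::real_normed_vector \<Rightarrow> 'b::real_normed_vector) \<Rightarrow> 'a \<Rightarrow> 'a \<Rightarrow> 'b"
  where "D1 f x v \<equiv> frechet_derivative f (at x) v"

abbreviation D2 :: "('a::real_normed_vector \<Rightarrow> 'b::real_normed_vector) \<Rightarrow> 'a \<Rightarrow> 'a \<Rightarrow> 'a \<Rightarrow> 'b"
  where "D2 f x v w \<equiv> frechet_derivative (\<lambda>y. frechet_derivative f (at y) v) (at x) w"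

lemma smooth_on_derivatives:
  assumes "smooth_on f U" "x \<in> U"
  shows "(f has_derivative D1 f x) (at x)"
    and "((\<lambda>y. D1 f y v) has_derivative D2 f x v) (at x)"
  by (rule smooth_on_has_derivative[OF assms],
      rule smooth_on_has_derivative[OF smooth_on_frechet_derivative[OF assms(1)] assms(2)])

lemma smooth_on_linear_D1:
  assumes "smooth_on f U" "x \<in> U" shows "linear (D1 f x)"
  using smooth_on_derivatives(1)[OF assms] has_derivative_linear by blast

lemma has_vector_derivative_compose:
  assumes "(f has_derivative f') (at (\<gamma> t))" "(\<gamma> has_vector_derivative v) (at t)"
  shows "((\<lambda>t. f (\<gamma> t)) has_vector_derivative f' v) (at t)"
proof -
  have "((\<lambda>t. f (\<gamma> t)) has_derivative (\<lambda>s. f' (s *\<^sub>R v))) (at t)"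
    using has_derivative_compose[OF assms(2)[unfolded has_vector_derivative_def] assms(1)] .
  then show ?thesis
    using linear_cmul[OF has_derivative_linear[OF assms(1)]]
    by (simp add: has_vector_derivative_def)
qed

lemma D1_basis_expansion:
  fixes x w :: "'a::euclidean_space"
  assumes "smooth_on f U" "x \<in> U"
  shows "D1 f x w = (\<Sum>b\<in>Basis. (w \<bullet> b) *\<^sub>R D1 f x b)"
proof -
  have "D1 f x (\<Sum>b\<in>Basis. (w \<bullet> b) *\<^sub>R b) = (\<Sum>b\<in>Basis. (w \<bullet> b) *\<^sub>R D1 f x b)"
    using smooth_on_linear_D1[OF assms] by (simp add: linear_sum linear_cmul)
  then show ?thesis by (simp add: euclidean_representation)
qed

text \<open>Linearity in the outer direction \<open>w\<close> comes with the derivative. For the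
  inner direction \<open>v\<close>, \<open>D1 f y v\<close> is first expanded over
  \<open>Basis\<close> at all nearby \<open>y\<close> and then differentiated termwise.\<close>

lemma D2_linear:
  fixes x w :: "'a::euclidean_space"
  assumes "smooth_on f U" "open U" "x \<in> U"
  shows "linear (\<lambda>v. D2 f x v w)"
proof -
  have "D2 f x v w = (\<Sum>b\<in>Basis. (v \<bullet> b) *\<^sub>R D2 f x b w)" for v
  proof -
    have "((\<lambda>y. \<Sum>b\<in>Basis. (v \<bullet> b) *\<^sub>R D1 f y b) has_derivative
        (\<lambda>w. \<Sum>b\<in>Basis. (v \<bullet> b) *\<^sub>R D2 f x b w)) (at x)"
      by (intro has_derivative_sum has_derivative_scaleR_right smooth_on_derivatives(2)[OF assms(1,3)])
    then have "((\<lambda>y. D1 f y v) has_derivative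
        (\<lambda>w. \<Sum>b\<in>Basis. (v \<bullet> b) *\<^sub>R D2 f x b w)) (at x)"
      by (rule has_derivative_transform_within_open[OF _ assms(2,3)])
        (metis D1_basis_expansion[OF assms(1)])
    from has_derivative_unique[OF this smooth_on_derivatives(2)[OF assms(1,3)]]
    show ?thesis by metis
  qed
  then have eq: "(\<lambda>v. D2 f x v w) = (\<lambda>v. \<Sum>b\<in>Basis. (v \<bullet> b) *\<^sub>R D2 f x b w)"
    by (rule ext)
  have "linear (\<lambda>v. \<Sum>b\<in>Basis. (v \<bullet> b) *\<^sub>R c b)" for c :: "'a \<Rightarrow> 'b"
    by (intro linearI)
      (simp_all add: inner_add_left scaleR_add_left sum.distrib scaleR_sum_right)
  then show "linear (\<lambda>v. D2 f x v w)"
    by (rule ssubst[OF eq, of linear])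
qed

text \<open>Product rule with base point and direction both moving. The expansion over
  \<open>Basis\<close> reduces it to scalar coefficients times functions of the base point
  alone.\<close>

lemma has_vector_derivative_D1:
  fixes \<gamma> :: "real \<Rightarrow> 'a::euclidean_space"
  assumes "smooth_on f U" "open U" "\<gamma> t \<in> U"
    and \<gamma>: "(\<gamma> has_vector_derivative v) (at t)" and w: "(w has_vector_derivative w') (at t)"
  shows "((\<lambda>s. D1 f (\<gamma> s) (w s)) has_vector_derivative D2 f (\<gamma> t) (w t) v + D1 f (\<gamma> t) w') (at t)"
proof -
  have "(\<gamma> \<longlongrightarrow> \<gamma> t) (at t)"
    using has_vector_derivative_continuous[OF \<gamma>] by (simp add: continuous_within)
  then have "\<forall>\<^sub>F s in nhds t. \<gamma> s \<in> U"
    using topological_tendstoD[of \<gamma> "\<gamma> t" "at t" U] assms(2,3) by (simp add: eventually_nhds_conv_at)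
  then obtain W where W: "open W" "t \<in> W" "\<And>s. s \<in> W \<Longrightarrow> \<gamma> s \<in> U"
    by (auto simp: eventually_nhds)
  have 1: "((\<lambda>s. (w s \<bullet> b) *\<^sub>R D1 f (\<gamma> s) b) has_vector_derivative
      (w t \<bullet> b) *\<^sub>R D2 f (\<gamma> t) b v + (w' \<bullet> b) *\<^sub>R D1 f (\<gamma> t) b) (at t)" for b
  proof -
    have "((\<lambda>s. w s \<bullet> b) has_vector_derivative (w' \<bullet> b)) (at t)"
      using bounded_linear.has_vector_derivative[OF bounded_linear_inner_left w] .
    then have "((\<lambda>s. w s \<bullet> b) has_real_derivative (w' \<bullet> b)) (at t)"
      by (simp add: has_real_derivative_iff_has_vector_derivative)
    from has_vector_derivative_scaleR[OF this
        has_vector_derivative_compose[of "\<lambda>x. D1 f x b" _ \<gamma> t, OF smooth_on_derivatives(2)[OF assms(1,3)] \<gamma>]]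
    show ?thesis .
  qed
  have "((\<lambda>s. \<Sum>b\<in>Basis. (w s \<bullet> b) *\<^sub>R D1 f (\<gamma> s) b) has_vector_derivative
      (\<Sum>b\<in>Basis. (w t \<bullet> b) *\<^sub>R D2 f (\<gamma> t) b v + (w' \<bullet> b) *\<^sub>R D1 f (\<gamma> t) b)) (at t)"
    using 1 by (intro has_vector_derivative_sum) auto
  also have "(\<Sum>b\<in>Basis. (w t \<bullet> b) *\<^sub>R D2 f (\<gamma> t) b v + (w' \<bullet> b) *\<^sub>R D1 f (\<gamma> t) b)
     = D2 f (\<gamma> t) (w t) v + D1 f (\<gamma> t) w'"
  proof -
    have "D2 f (\<gamma> t) (\<Sum>b\<in>Basis. (w t \<bullet> b) *\<^sub>R b) v = (\<Sum>b\<in>Basis. (w t \<bullet> b) *\<^sub>R D2 f (\<gamma> t) b v)"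
      by (simp add: linear_sum[OF D2_linear[OF assms(1-3)]] linear_cmul[OF D2_linear[OF assms(1-3)]])
    then show ?thesis
      using D1_basis_expansion[OF assms(1,3), of w'] by (simp add: euclidean_representation sum.distrib)
  qed
  finally show ?thesis
    by (rule has_vector_derivative_transform_within_open[OF _ W(1,2)])
      (metis D1_basis_expansion[OF assms(1)] W(3))
qed

section \<open>Symmetry of second derivatives\<close>

lemma second_difference_mvt:
  fixes f :: "'a::euclidean_space \<Rightarrow> 'b::euclidean_space"
  assumes f: "smooth_on f (ball x r)" and s: "s > 0" "s * (norm v + norm w) < r"
  shows "\<exists>y. dist x y \<le> s * (norm v + norm w) \<and>
     (f (x + s *\<^sub>R v + s *\<^sub>R w) - f (x + s *\<^sub>R v) - f (x + s *\<^sub>R w) + f x) \<bullet> b = s\<^sup>2 * (D2 f y v w \<bullet> b)"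
proof -
  have near: "dist x (x + \<sigma> *\<^sub>R v + \<tau> *\<^sub>R w) \<le> s * (norm v + norm w)"
    if "0 \<le> \<sigma>" "\<sigma> \<le> s" "0 \<le> \<tau>" "\<tau> \<le> s" for \<sigma> \<tau>
  proof -
    have "norm (\<sigma> *\<^sub>R v + \<tau> *\<^sub>R w) \<le> \<sigma> * norm v + \<tau> * norm w"
      using that by (intro order_trans[OF norm_triangle_ineq]) simp
    also have "\<dots> \<le> s * norm v + s * norm w"
      using that by (intro add_mono mult_right_mono) auto
    moreover have "dist x (x + \<sigma> *\<^sub>R v + \<tau> *\<^sub>R w) = norm (\<sigma> *\<^sub>R v + \<tau> *\<^sub>R w)"
      by (metis add.assoc add_diff_cancel_left' dist_commute dist_norm)
    ultimately show ?thesis by (simp add: distrib_left)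
  qed
  have mem: "x + \<sigma> *\<^sub>R v + \<tau> *\<^sub>R w \<in> ball x r"
    if "0 \<le> \<sigma>" "\<sigma> \<le> s" "0 \<le> \<tau>" "\<tau> \<le> s" for \<sigma> \<tau>
    using near[OF that] s(2) by simp
  have inner_deriv: "((\<lambda>t. g (\<gamma> t) \<bullet> b) has_real_derivative (D1 g (\<gamma> t) u \<bullet> b)) (at t)"
    if "smooth_on g (ball x r)" "\<gamma> t \<in> ball x r" "(\<gamma> has_vector_derivative u) (at t)"
    for g :: "'a \<Rightarrow> 'b" and \<gamma> t u
    using bounded_linear.has_vector_derivative[OF bounded_linear_inner_left
        has_vector_derivative_compose[OF smooth_on_derivatives(1)[OF that(1,2)] that(3)], of b]
    by (simp add: has_real_derivative_iff_has_vector_derivative)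
  \<comment> \<open>Two mean value steps, first along \<open>v\<close> for the difference of two
    parallel edges, then along \<open>w\<close>. The theorem is scalar, hence the pairing with
    \<open>b\<close>, on which the resulting point depends.\<close>
  define G where "G = (\<lambda>\<sigma>. f (x + \<sigma> *\<^sub>R v + s *\<^sub>R w) \<bullet> b - f (x + \<sigma> *\<^sub>R v + 0 *\<^sub>R w) \<bullet> b)"
  have line: "((\<lambda>\<sigma>. x + \<sigma> *\<^sub>R v + c) has_vector_derivative v) (at \<sigma>)" for \<sigma> c
    by (auto intro!: derivative_eq_intros)
  have "\<exists>\<sigma>>0. \<sigma> < s \<and> G s - G 0 = (s - 0) * (D1 f (x + \<sigma> *\<^sub>R v + s *\<^sub>R w) v \<bullet> b - D1 f (x + \<sigma> *\<^sub>R v + 0 *\<^sub>R w) v \<bullet> b)"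
    unfolding G_def using s(1)
    by (intro MVT2 DERIV_diff inner_deriv[OF f] mem line) auto
  then obtain \<sigma> where \<sigma>: "0 < \<sigma>" "\<sigma> < s"
      "G s - G 0 = s * (D1 f (x + \<sigma> *\<^sub>R v + s *\<^sub>R w) v \<bullet> b - D1 f (x + \<sigma> *\<^sub>R v + 0 *\<^sub>R w) v \<bullet> b)"
    by auto
  have line2: "((\<lambda>\<tau>. x + \<sigma> *\<^sub>R v + \<tau> *\<^sub>R w) has_vector_derivative w) (at \<tau>)" for \<tau>
    by (auto intro!: derivative_eq_intros)
  have "\<exists>\<tau>>0. \<tau> < s \<and> D1 f (x + \<sigma> *\<^sub>R v + s *\<^sub>R w) v \<bullet> b - D1 f (x + \<sigma> *\<^sub>R v + 0 *\<^sub>R w) v \<bullet> b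
      = (s - 0) * (D2 f (x + \<sigma> *\<^sub>R v + \<tau> *\<^sub>R w) v w \<bullet> b)"
    using s(1) \<sigma>(1,2)
    by (intro MVT2 inner_deriv[of "\<lambda>y. D1 f y v" "\<lambda>\<tau>. x + \<sigma> *\<^sub>R v + \<tau> *\<^sub>R w"] smooth_on_frechet_derivative f mem line2) auto
  then obtain \<tau> where \<tau>: "0 < \<tau>" "\<tau> < s"
      "D1 f (x + \<sigma> *\<^sub>R v + s *\<^sub>R w) v \<bullet> b - D1 f (x + \<sigma> *\<^sub>R v + 0 *\<^sub>R w) v \<bullet> b
      = s * (D2 f (x + \<sigma> *\<^sub>R v + \<tau> *\<^sub>R w) v w \<bullet> b)"
    by auto
  have "(f (x + s *\<^sub>R v + s *\<^sub>R w) - f (x + s *\<^sub>R v) - f (x + s *\<^sub>R w) + f x) \<bullet> b = G s - G 0"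
    by (simp add: G_def inner_diff_left inner_add_left)
  also have "\<dots> = s\<^sup>2 * (D2 f (x + \<sigma> *\<^sub>R v + \<tau> *\<^sub>R w) v w \<bullet> b)"
    by (simp only: \<sigma>(3) \<tau>(3)) (simp add: power2_eq_square)
  finally show ?thesis
    using near[of \<sigma> \<tau>] \<sigma>(1,2) \<tau>(1,2) by (intro exI[of _ "x + \<sigma> *\<^sub>R v + \<tau> *\<^sub>R w"] conjI) auto
qed

text \<open>The second difference is symmetric in \<open>v\<close> and \<open>w\<close>; in either
  order it is \<open>s^2\<close> times a mixed derivative at a nearby point, and the mixed
  derivatives are continuous. One inequality with slack \<open>e\<close> suffices because
  \<open>v\<close> and \<open>w\<close> can be swapped.\<close>

lemma D2_symmetric:
  fixes f :: "'a::euclidean_space \<Rightarrow> 'b::euclidean_space"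
  assumes f: "smooth_on f U" and U: "open U" "x \<in> U"
  shows "D2 f x v w = D2 f x w v"
proof -
  have key: "D2 f x v w \<bullet> b \<le> D2 f x w v \<bullet> b + e" if "e > 0" for v w b and e :: real
  proof -
    obtain r where r: "r > 0" "ball x r \<subseteq> U" using U openE by blast
    have fr: "smooth_on f (ball x r)" using smooth_on_subset[OF f r(2)] .
    have cont: "isCont (\<lambda>y. D2 f y v w \<bullet> b) x" for v w
      using smooth_on_continuous_on[OF smooth_on_frechet_derivative[OF smooth_on_frechet_derivative[OF f]]] U
      by (intro continuous_intros) (simp add: continuous_on_eq_continuous_at)
    have near: "\<exists>d>0. \<forall>y. dist x y < d \<longrightarrow> \<bar>D2 f y v w \<bullet> b - D2 f x v w \<bullet> b\<bar> < e / 2" for v w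
      using cont[of v w, unfolded continuous_at_eps_delta, rule_format, of "e/2"] that
      by (simp add: dist_real_def dist_commute)
    obtain d where d: "d > 0" "\<And>y. dist x y < d \<Longrightarrow> \<bar>D2 f y v w \<bullet> b - D2 f x v w \<bullet> b\<bar> < e / 2"
      using near by blast
    obtain d' where d': "d' > 0" "\<And>y. dist x y < d' \<Longrightarrow> \<bar>D2 f y w v \<bullet> b - D2 f x w v \<bullet> b\<bar> < e / 2"
      using near by blast
    define m where "m = min r (min d d')"
    \<comment> \<open>The factor 2 keeps the parallelogram strictly within radius \<open>m\<close>;
      the summand 1 covers \<open>v = w = 0\<close>.\<close>
    define s where "s = m / (2 * (norm v + norm w + 1))"
    have m: "m > 0" "m \<le> r" "m \<le> d" "m \<le> d'" using r d d' by (auto simp: m_def)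
    have s: "s > 0" using m(1) by (simp add: s_def add_nonneg_pos)
    have "s * (norm v + norm w) \<le> s * (norm v + norm w + 1)" using s by simp
    also have "\<dots> = m / 2"
    proof -
      have "norm v + norm w + 1 > 0" by (simp add: add_nonneg_pos)
      then show ?thesis by (simp add: s_def field_simps)
    qed
    also have "\<dots> < m" using m(1) by simp
    finally have sm: "s * (norm v + norm w) < m" .
    obtain y where y: "dist x y \<le> s * (norm v + norm w)"
        "(f (x + s *\<^sub>R v + s *\<^sub>R w) - f (x + s *\<^sub>R v) - f (x + s *\<^sub>R w) + f x) \<bullet> b = s\<^sup>2 * (D2 f y v w \<bullet> b)"
      using second_difference_mvt[OF fr s, of v w b] sm m(2) by auto
    obtain z where z: "dist x z \<le> s * (norm w + norm v)"
        "(f (x + s *\<^sub>R w + s *\<^sub>R v) - f (x + s *\<^sub>R w) - f (x + s *\<^sub>R v) + f x) \<bullet> b = s\<^sup>2 * (D2 f z w v \<bullet> b)"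
      using second_difference_mvt[OF fr s, of w v b] sm m(2) by (auto simp: add.commute)
    have "f (x + s *\<^sub>R v + s *\<^sub>R w) - f (x + s *\<^sub>R v) - f (x + s *\<^sub>R w) + f x
        = f (x + s *\<^sub>R w + s *\<^sub>R v) - f (x + s *\<^sub>R w) - f (x + s *\<^sub>R v) + f x"
      by (simp add: algebra_simps)
    then have "s\<^sup>2 * (D2 f y v w \<bullet> b) = s\<^sup>2 * (D2 f z w v \<bullet> b)" using y(2) z(2) by metis
    then have "D2 f y v w \<bullet> b = D2 f z w v \<bullet> b" using s by simp
    moreover have "\<bar>D2 f y v w \<bullet> b - D2 f x v w \<bullet> b\<bar> < e / 2" using d(2) y(1) sm m(3) by simp
    moreover have "\<bar>D2 f z w v \<bullet> b - D2 f x w v \<bullet> b\<bar> < e / 2" using d'(2) z(1) sm m(4) by (simp add: add.commute)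
    ultimately show ?thesis by linarith
  qed
  have "D2 f x v w \<bullet> b = D2 f x w v \<bullet> b" for b
    by (rule antisym; rule field_le_epsilon; rule key)
  then show ?thesis by (rule euclidean_eqI)
qed

section \<open>Maxima and Taylor remainders in one variable\<close>

lemma second_derivative_test:
  fixes f f1 :: "real \<Rightarrow> real"
  assumes "\<epsilon> > 0" and d: "\<And>t. \<bar>t\<bar> < \<epsilon> \<Longrightarrow> (f has_real_derivative f1 t) (at t)"
    and d2: "(f1 has_real_derivative c) (at 0)" and max: "\<And>t. \<bar>t\<bar> < \<epsilon> \<Longrightarrow> f t \<le> f 0"
  shows "f1 0 = 0" "c \<le> 0"
proof -
  show z: "f1 0 = 0"
    using DERIV_local_max[OF d[of 0] assms(1)] max assms(1) by simp
  show "c \<le> 0"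
  proof (rule ccontr)
    assume "\<not> c \<le> 0"
    \<comment> \<open>A positive \<open>c\<close> makes \<open>f1\<close> positive just to the right
      of 0, and the mean value theorem then gives \<open>f h > f 0\<close>.\<close>
    then obtain \<delta> where \<delta>: "\<delta> > 0" "\<And>h. h > 0 \<Longrightarrow> h < \<delta> \<Longrightarrow> f1 0 < f1 (0 + h)"
      using DERIV_pos_inc_right[OF d2] by auto
    define h where "h = min \<delta> \<epsilon> / 2"
    have h: "h > 0" "h < \<delta>" "h < \<epsilon>" using \<delta>(1) assms(1) by (auto simp: h_def)
    obtain y where "y > 0" "y < h" "f h - f 0 = (h - 0) * f1 y"
      using MVT2[of 0 h f f1] d h by auto
    moreover from this have "h * f1 y > 0" using \<delta>(2)[of y] z h by (intro mult_pos_pos) auto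
    ultimately show False using max[of h] h by simp
  qed
qed

text \<open>Integrates an asymptotic \<open>f' ~ c t^k\<close> to
  \<open>f ~ c t^(k+1) / (k+1)\<close>. Two applications turn differentiability of a second
  derivative at 0 alone into a third-order Taylor expansion.\<close>

lemma tendsto_power_quotient_integrate:
  fixes f f' :: "real \<Rightarrow> 'b::real_inner"
  assumes "\<epsilon> > 0" and d: "\<And>t. \<bar>t\<bar> < \<epsilon> \<Longrightarrow> (f has_vector_derivative f' t) (at t)" and "f 0 = 0"
    and lim: "((\<lambda>t. f' t /\<^sub>R t ^ k) \<longlongrightarrow> c) (at 0)"
  shows "((\<lambda>t. f t /\<^sub>R t ^ Suc k) \<longlongrightarrow> c /\<^sub>R real (Suc k)) (at 0)"
proof (rule LIM_I)
  fix e :: real assume e: "e > 0"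
  obtain d0 where d0: "d0 > 0" "\<And>t. t \<noteq> 0 \<Longrightarrow> \<bar>t\<bar> < d0 \<Longrightarrow> norm (f' t /\<^sub>R t ^ k - c) < e / 2"
    using LIM_D[OF lim, of "e/2"] e by auto
  have f'0: "norm (f' t - t ^ k *\<^sub>R c) \<le> e / 2 * \<bar>t\<bar> ^ k" if "t \<noteq> 0" "\<bar>t\<bar> < d0" for t
  proof -
    have "f' t - t ^ k *\<^sub>R c = t ^ k *\<^sub>R (f' t /\<^sub>R t ^ k - c)"
      using that(1) by (simp add: scaleR_diff_right)
    then have "norm (f' t - t ^ k *\<^sub>R c) = \<bar>t\<bar> ^ k * norm (f' t /\<^sub>R t ^ k - c)"
      by (simp add: power_abs)
    also have "\<dots> \<le> \<bar>t\<bar> ^ k * (e / 2)" using d0(2)[OF that] by (intro mult_left_mono) auto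
    finally show ?thesis by (simp add: mult.commute)
  qed
  \<comment> \<open>Removing the expected leading term leaves a derivative of size at most
    \<open>e / 2 * \<bar>t\<bar> ^ k\<close>, to which the mean value inequality applies.\<close>
  define g where "g = (\<lambda>t. f t - (t ^ Suc k / real (Suc k)) *\<^sub>R c)"
  have gd: "(g has_vector_derivative (f' t - t ^ k *\<^sub>R c)) (at t)" if "\<bar>t\<bar> < \<epsilon>" for t
  proof -
    have "((\<lambda>t. t ^ Suc k / real (Suc k)) has_real_derivative t ^ k) (at t)"
      using DERIV_cdivide[OF DERIV_pow[of "Suc k" t], of "real (Suc k)"] by (simp del: of_nat_Suc)
    from has_vector_derivative_diff[OF d[OF that] has_vector_derivative_scaleR[OF this has_vector_derivative_const[of c]]]
    show ?thesis by (simp add: g_def)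
  qed
  define r where "r = min \<epsilon> d0"
  have r: "r > 0" using assms(1) d0 by (simp add: r_def)
  have "norm (f t /\<^sub>R t ^ Suc k - c /\<^sub>R real (Suc k)) < e" if t: "t \<noteq> 0" "\<bar>t\<bar> < r" for t
  proof -
    have "norm (g t - g 0) \<le> (e / 2 * \<bar>t\<bar> ^ k) * \<bar>t - 0\<bar>"
    proof -
      have D: "(g has_derivative (\<lambda>h. h *\<^sub>R (f' z - z ^ k *\<^sub>R c))) (at z)" if "\<bar>z\<bar> \<le> \<bar>t\<bar>" for z
        using gd[of z] that t(2) by (simp add: r_def has_vector_derivative_def)
      define lo hi where "lo = min t 0" and "hi = max t 0"
      have lh: "lo < hi" using t(1) by (auto simp: lo_def hi_def)
      have zt: "\<bar>z\<bar> \<le> \<bar>t\<bar>" if "z \<in> {lo..hi}" for z using that by (auto simp: lo_def hi_def)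
      have "continuous_on {lo..hi} g"
        using D zt has_derivative_continuous by (metis continuous_at_imp_continuous_on)
      then obtain z where z: "z \<in> {lo<..<hi}" "norm (g hi - g lo) \<le> norm ((hi - lo) *\<^sub>R (f' z - z ^ k *\<^sub>R c))"
        using mvt_general[OF lh, of g "\<lambda>z h. h *\<^sub>R (f' z - z ^ k *\<^sub>R c)"] D zt by auto
      have "norm (f' z - z ^ k *\<^sub>R c) \<le> e / 2 * \<bar>z\<bar> ^ k"
        using z(1) t zt[of z] by (intro f'0) (auto simp: r_def lo_def hi_def split: if_splits)
      also have "\<dots> \<le> e / 2 * \<bar>t\<bar> ^ k" using zt[of z] z(1) e by (intro mult_left_mono power_mono) auto
      finally have "(hi - lo) * norm (f' z - z ^ k *\<^sub>R c) \<le> (hi - lo) * (e / 2 * \<bar>t\<bar> ^ k)"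
        using lh by (intro mult_left_mono) auto
      moreover have "hi - lo = \<bar>t\<bar>" by (auto simp: lo_def hi_def)
      ultimately have "norm (g hi - g lo) \<le> \<bar>t\<bar> * (e / 2 * \<bar>t\<bar> ^ k)"
        using z(2) lh by simp
      moreover have "norm (g t - g 0) = norm (g hi - g lo)"
        by (auto simp: lo_def hi_def min_def max_def norm_minus_commute)
      ultimately show ?thesis by (simp add: mult.commute)
    qed
    then have "norm (g t) \<le> e / 2 * \<bar>t\<bar> ^ Suc k"
      using assms(3) by (simp add: g_def mult_ac)
    moreover have "g t /\<^sub>R t ^ Suc k = f t /\<^sub>R t ^ Suc k - c /\<^sub>R real (Suc k)"
      using t(1) by (simp add: g_def scaleR_diff_right divide_simps)
    then have "norm (f t /\<^sub>R t ^ Suc k - c /\<^sub>R real (Suc k)) = norm (g t) / \<bar>t\<bar> ^ Suc k"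
      by (metis divide_inverse_commute norm_scaleR power_abs abs_inverse)
    ultimately have "norm (f t /\<^sub>R t ^ Suc k - c /\<^sub>R real (Suc k)) \<le> e / 2"
      using t(1) by (simp add: pos_divide_le_eq del: power_Suc)
    then show ?thesis using e by linarith
  qed
  then show "\<exists>s>0. \<forall>x. x \<noteq> 0 \<and> norm (x - 0) < s \<longrightarrow> norm (f x /\<^sub>R x ^ Suc k - c /\<^sub>R real (Suc k)) < e"
    using r by (intro exI[of _ r]) auto
qed

subsection \<open>Hypersurfaces with a unit normal\<close>

lemma has_real_derivative_inner:
  fixes f g :: "real \<Rightarrow> 'a::real_inner"
  assumes "(f has_vector_derivative f') (at t)" "(g has_vector_derivative g') (at t)"
  shows "((\<lambda>t. f t \<bullet> g t) has_real_derivative f t \<bullet> g' + f' \<bullet> g t) (at t)"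
  using bounded_bilinear.has_vector_derivative[OF bounded_bilinear_inner assms]
  by (simp add: has_real_derivative_iff_has_vector_derivative)

lemma derivative_locally_const:
  fixes f :: "real \<Rightarrow> real"
  assumes "(f has_real_derivative d) (at 0)" "\<epsilon> > 0" "\<And>t. \<bar>t\<bar> < \<epsilon> \<Longrightarrow> f t = c"
  shows "d = 0"
proof -
  have "(f has_real_derivative 0) (at 0)"
    by (rule has_field_derivative_transform_within_open[OF DERIV_const[of c], where S = "{-\<epsilon><..<\<epsilon>}"])
      (use assms in auto)
  then show ?thesis using DERIV_unique assms(1) by blast
qed

text \<open>Three derivatives are recorded: the first two carry the shape operator and the second
  variations, the third is needed for chords of the curve. \<open>U\<close> is usually the domain of
  an extension of the normal.\<close>

definition curve_in ::
  "'a::euclidean_space set \<Rightarrow> 'a set \<Rightarrow> real \<Rightarrow> (real \<Rightarrow> 'a) \<Rightarrow> (real \<Rightarrow> 'a) \<Rightarrow> (real \<Rightarrow> 'a) \<Rightarrow> (real \<Rightarrow> 'a) \<Rightarrow> bool"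
  where "curve_in S U \<epsilon> \<gamma> \<gamma>1 \<gamma>2 \<gamma>3 \<longleftrightarrow> \<epsilon> > 0 \<and> (\<forall>t. \<bar>t\<bar> < \<epsilon> \<longrightarrow>
    \<gamma> t \<in> S \<and> \<gamma> t \<in> U \<and> \<gamma>1 t \<in> tangent_space S (\<gamma> t) \<and>
    (\<gamma> has_vector_derivative \<gamma>1 t) (at t) \<and> (\<gamma>1 has_vector_derivative \<gamma>2 t) (at t) \<and>
    (\<gamma>2 has_vector_derivative \<gamma>3 t) (at t))"

lemma curve_inD:
  assumes "curve_in S U \<epsilon> \<gamma> \<gamma>1 \<gamma>2 \<gamma>3"
  shows "\<epsilon> > 0" "\<And>t. \<bar>t\<bar> < \<epsilon> \<Longrightarrow> \<gamma> t \<in> S" "\<And>t. \<bar>t\<bar> < \<epsilon> \<Longrightarrow> \<gamma> t \<in> U"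
    "\<And>t. \<bar>t\<bar> < \<epsilon> \<Longrightarrow> \<gamma>1 t \<in> tangent_space S (\<gamma> t)"
    "\<And>t. \<bar>t\<bar> < \<epsilon> \<Longrightarrow> (\<gamma> has_vector_derivative \<gamma>1 t) (at t)"
    "\<And>t. \<bar>t\<bar> < \<epsilon> \<Longrightarrow> (\<gamma>1 has_vector_derivative \<gamma>2 t) (at t)"
    "\<And>t. \<bar>t\<bar> < \<epsilon> \<Longrightarrow> (\<gamma>2 has_vector_derivative \<gamma>3 t) (at t)"
  using assms by (simp_all add: curve_in_def)

lemma tangent_curve:
  assumes v: "v \<in> tangent_space S p" and "open U" "p \<in> U"
  shows "\<exists>\<epsilon> \<gamma> \<gamma>1 \<gamma>2 \<gamma>3. curve_in S U \<epsilon> \<gamma> \<gamma>1 \<gamma>2 \<gamma>3 \<and> \<gamma> 0 = p \<and> \<gamma>1 0 = v"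
proof -
  obtain \<epsilon>0 \<gamma> where g: "\<epsilon>0 > 0" "smooth_on \<gamma> {-\<epsilon>0<..<\<epsilon>0}" "\<gamma> ` {-\<epsilon>0<..<\<epsilon>0} \<subseteq> S" "\<gamma> 0 = p"
      "(\<gamma> has_vector_derivative v) (at 0)"
    using v by (auto simp: tangent_space_def)
  have "(\<gamma> \<longlongrightarrow> \<gamma> 0) (at 0)"
    using has_vector_derivative_continuous[OF g(5)] by (simp add: continuous_within)
  then have "\<forall>\<^sub>F s in nhds 0. \<gamma> s \<in> U"
    using topological_tendstoD[of \<gamma> "\<gamma> 0" "at 0" U] assms(2,3) g(4) by (simp add: eventually_nhds_conv_at)
  then obtain d where d: "d > 0" "\<And>s. \<bar>s\<bar> < d \<Longrightarrow> \<gamma> s \<in> U"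
    by (auto simp: eventually_nhds_metric dist_real_def)
  define \<epsilon> where "\<epsilon> = min \<epsilon>0 d"
  have \<epsilon>: "\<epsilon> > 0" using g(1) d(1) by (simp add: \<epsilon>_def)
  define \<gamma>1 where "\<gamma>1 = (\<lambda>t. D1 \<gamma> t 1)"
  define \<gamma>2 where "\<gamma>2 = (\<lambda>t. D1 \<gamma>1 t 1)"
  define \<gamma>3 where "\<gamma>3 = (\<lambda>t. D1 \<gamma>2 t 1)"
  have sm: "smooth_on \<gamma>1 {-\<epsilon>0<..<\<epsilon>0}" "smooth_on \<gamma>2 {-\<epsilon>0<..<\<epsilon>0}"
    unfolding \<gamma>1_def \<gamma>2_def by (intro smooth_on_frechet_derivative g(2))+
  have D: "(f has_vector_derivative D1 f t 1) (at t)" if "smooth_on f {-\<epsilon>0<..<\<epsilon>0}" "\<bar>t\<bar> < \<epsilon>" for f :: "real \<Rightarrow> 'a" and t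
  proof -
    have "(f has_derivative D1 f t) (at t)"
      using smooth_on_derivatives(1)[OF that(1)] that(2) by (auto simp: \<epsilon>_def abs_less_iff)
    then show ?thesis
      using has_vector_derivative_compose[of f "D1 f t" "\<lambda>t. t" t 1] by simp
  qed
  \<comment> \<open>Every velocity is tangent, because the curve restarted at time \<open>t\<close>,
    on the shorter interval of radius \<open>r\<close>, is again a witness.\<close>
  have tan: "\<gamma>1 t \<in> tangent_space S (\<gamma> t)" if t: "\<bar>t\<bar> < \<epsilon>" for t
  proof -
    define r where "r = \<epsilon>0 - \<bar>t\<bar>"
    have r: "r > 0" using t by (simp add: r_def \<epsilon>_def)
    have in0: "t + s * 1 \<in> {-\<epsilon>0<..<\<epsilon>0}" if "s \<in> {-r<..<r}" for s
      using that by (auto simp: r_def abs_if split: if_splits)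
    have "smooth_on (\<lambda>s. \<gamma> (t + s * 1)) {-r<..<r}"
      using C_k_on_affine_line[of _ \<gamma> "{-\<epsilon>0<..<\<epsilon>0}" "{-r<..<r}" t 1] g(2) in0
      by (simp add: smooth_on_def)
    moreover have "((\<lambda>s. \<gamma> (t + s * 1)) has_vector_derivative \<gamma>1 t) (at 0)"
    proof -
      have "((\<lambda>s. t + s * 1) has_real_derivative 1) (at 0)"
        by (auto intro!: derivative_eq_intros)
      from vector_diff_chain_at[OF this[unfolded has_real_derivative_iff_has_vector_derivative], of \<gamma> "\<gamma>1 t"]
      show ?thesis using D[OF g(2) t] by (simp add: \<gamma>1_def o_def)
    qed
    ultimately show ?thesis
      unfolding tangent_space_def using r in0 g(3)
      by (intro CollectI exI[of _ r] conjI exI[of _ "\<lambda>s. \<gamma> (t + s * 1)"]) auto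
  qed
  have "\<gamma>1 0 = v"
    using vector_derivative_unique_at[OF D[OF g(2)] g(5)] \<epsilon> by (simp add: \<gamma>1_def)
  moreover have "curve_in S U \<epsilon> \<gamma> \<gamma>1 \<gamma>2 \<gamma>3"
    unfolding curve_in_def
  proof (intro conjI allI impI)
    fix t assume t: "\<bar>t\<bar> < \<epsilon>"
    show "\<gamma> t \<in> S" using g(3) t by (auto simp: \<epsilon>_def abs_less_iff)
    show "\<gamma> t \<in> U" using d(2) t by (simp add: \<epsilon>_def)
    show "(\<gamma> has_vector_derivative \<gamma>1 t) (at t)" using D[OF g(2) t] by (simp add: \<gamma>1_def)
    show "(\<gamma>1 has_vector_derivative \<gamma>2 t) (at t)" using D[OF sm(1) t] by (simp add: \<gamma>2_def)
    show "(\<gamma>2 has_vector_derivative \<gamma>3 t) (at t)" using D[OF sm(2) t] by (simp add: \<gamma>3_def)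
  qed (use \<epsilon> tan in auto)
  ultimately show ?thesis using g(4) by blast
qed

locale oriented_hypersurface =
  fixes S :: "'a::euclidean_space set" and n :: "'a \<Rightarrow> 'a"
  assumes hypersurface: "smooth_hypersurface S" and unit_normal: "smooth_unit_normal_field S n"
begin

lemma norm_normal: "x \<in> S \<Longrightarrow> norm (n x) = 1"
  using unit_normal by (simp add: smooth_unit_normal_field_def)

lemma normal_inner_self: "x \<in> S \<Longrightarrow> n x \<bullet> n x = 1"
  by (simp add: dot_square_norm norm_normal)

lemma tangent_space_eq: 
  assumes "x \<in> S" shows "tangent_space S x = {v. n x \<bullet> v = 0}"
proof (rule subspace_dim_equal)
  show "tangent_space S x \<subseteq> {v. n x \<bullet> v = 0}"
    using unit_normal assms by (auto simp: smooth_unit_normal_field_def)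
  have "n x \<noteq> 0" using norm_normal[OF assms] by auto
  then show "dim {v. n x \<bullet> v = 0} \<le> dim (tangent_space S x)"
    using tangent_space_subspace_dim(2)[OF hypersurface assms] dim_hyperplane[OF \<open>n x \<noteq> 0\<close>] by simp
qed (use tangent_space_subspace_dim(1)[OF hypersurface assms] subspace_hyperplane in auto)

lemma tangent_iff: "x \<in> S \<Longrightarrow> v \<in> tangent_space S x \<longleftrightarrow> n x \<bullet> v = 0"
  by (simp add: tangent_space_eq)

lemma normal_extension:
  assumes "p \<in> S"
  obtains U N where "open U" "p \<in> U" "smooth_on N U" "\<And>x. x \<in> S \<Longrightarrow> x \<in> U \<Longrightarrow> N x = n x"
  using unit_normal assms unfolding smooth_unit_normal_field_def smooth_along_def by (metis IntI)

end

text \<open>\<open>n\<close> is known only on \<open>S\<close>, so ambient derivatives are taken of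
  a local smooth extension \<open>N\<close>. Only the values of \<open>D1 N\<close> on tangent
  vectors are intrinsic; terms with \<open>D1 N x (n x)\<close> depend on the extension and have to
  cancel later.\<close>

locale extended_normal = oriented_hypersurface S n
  for S :: "'a::euclidean_space set" and n +
  fixes U and N :: "'a \<Rightarrow> 'a"
  assumes open_U: "open U" and smooth_N: "smooth_on N U"
    and N_eq: "\<And>x. \<lbrakk>x \<in> S; x \<in> U\<rbrakk> \<Longrightarrow> N x = n x"
begin

lemma tangential_derivative_N:
  assumes "x \<in> S" "x \<in> U" "v \<in> tangent_space S x"
  shows "tangential_derivative S n x v = D1 N x v"
proof (rule tangential_derivative_eq[OF _ assms(3)])
  have "(N has_derivative D1 N x) (at x within S)"
    using smooth_on_derivatives(1)[OF smooth_N assms(2)] has_derivative_at_withinI by blast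
  moreover have "\<forall>\<^sub>F y in at x within S. N y = n y"
    using open_U assms(2) N_eq by (auto simp: eventually_at_topological)
  ultimately show "(n has_derivative D1 N x) (at x within S)"
    using has_derivative_transform_eventually[of N _ x S n] N_eq[OF assms(1,2)] assms(1) by blast
qed

section \<open>Mean curvature as a trace\<close>

lemma mean_curvature_basis:
  assumes "x \<in> S" "x \<in> U" and B: "orthonormal_basis_of (tangent_space S x) B"
  shows "mean_curvature S n x = (\<Sum>b\<in>B. D1 N x b \<bullet> b)"
proof -
  have "b \<in> tangent_space S x" if "b \<in> B" for b
    using B that span_base unfolding orthonormal_basis_of_def by metis
  moreover have "smooth_along S n" using unit_normal by (simp add: smooth_unit_normal_field_def)
  ultimately show ?thesis
    using mean_curvature_eq[OF B _ assms(1)] tangential_derivative_N[OF assms(1,2)]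
    by (metis (no_types, lifting) sum.cong)
qed

lemma tangent_plus_normal_trace:
  assumes "x \<in> S" and B: "orthonormal_basis_of (tangent_space S x) B" and L: "linear L"
  shows "(\<Sum>b\<in>Basis. L b \<bullet> b) = (\<Sum>b\<in>B. L b \<bullet> b) + L (n x) \<bullet> n x"
proof -
  have BT: "n x \<bullet> b = 0" if "b \<in> B" for b
    using B that span_base tangent_iff[OF assms(1)] unfolding orthonormal_basis_of_def by metis
  have nB: "n x \<notin> B" using BT normal_inner_self[OF assms(1)] by force
  have fin: "finite B"
    using B pairwise_orthogonal_independent[of B] independent_imp_finite
    by (fastforce simp: orthonormal_basis_of_def)
  have "v \<in> span (insert (n x) B)" for v
  proof -
    have "v - (n x \<bullet> v) *\<^sub>R n x \<in> span B"
      using B normal_inner_self[OF assms(1)] tangent_iff[OF assms(1)]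
      by (simp add: orthonormal_basis_of_def inner_diff_right)
    then show ?thesis by (auto simp: span_insert)
  qed
  then have "orthonormal_basis_of UNIV (insert (n x) B)"
    using B BT norm_normal[OF assms(1)]
    by (auto simp: orthonormal_basis_of_def pairwise_insert orthogonal_def inner_commute)
  moreover have "orthonormal_basis_of UNIV (Basis :: 'a set)"
    by (auto simp: orthonormal_basis_of_def pairwise_def orthogonal_def inner_not_same_Basis)
  ultimately have "(\<Sum>b\<in>Basis. L b \<bullet> b) = (\<Sum>b\<in>insert (n x) B. L b \<bullet> b)"
    using L by (intro orthonormal_basis_trace_eq)
  then show ?thesis using fin nB by (simp add: add.commute)
qed

text \<open>Orthonormal tangent frames would have to move with \<open>x\<close>. The ambient trace
  over the fixed \<open>Basis\<close>, corrected by the normal entry, needs no frame and can be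
  differentiated along a curve.\<close>

lemma mean_curvature_trace:
  assumes "x \<in> S" "x \<in> U"
  shows "mean_curvature S n x = (\<Sum>b\<in>Basis. D1 N x b \<bullet> b) - D1 N x (N x) \<bullet> N x"
proof -
  obtain B where B: "orthonormal_basis_of (tangent_space S x) B"
    using exists_orthonormal_basis_of_tangent_space[OF hypersurface assms(1)] by blast
  show ?thesis
    using tangent_plus_normal_trace[OF assms(1) B smooth_on_linear_D1[OF smooth_N assms(2)]]
      mean_curvature_basis[OF assms B] N_eq[OF assms] by simp
qed

lemma normal_curve_derivative:
  assumes C: "curve_in S U \<epsilon> \<gamma> \<gamma>1 \<gamma>2 \<gamma>3" and "\<bar>t\<bar> < \<epsilon>"
  shows "((\<lambda>t. N (\<gamma> t)) has_vector_derivative D1 N (\<gamma> t) (\<gamma>1 t)) (at t)"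
  by (rule has_vector_derivative_compose[OF
        smooth_on_derivatives(1)[OF smooth_N curve_inD(3)[OF assms]] curve_inD(5)[OF assms]])

text \<open>Differentiate \<open>N \<bullet> N = 1\<close> along a curve with velocity
  \<open>v\<close>.\<close>

lemma shape_operator_tangent:
  assumes "x \<in> S" "x \<in> U" and v: "v \<in> tangent_space S x"
  shows "n x \<bullet> D1 N x v = 0"
proof -
  obtain \<epsilon> \<gamma> \<gamma>1 \<gamma>2 \<gamma>3 where C: "curve_in S U \<epsilon> \<gamma> \<gamma>1 \<gamma>2 \<gamma>3" and c: "\<gamma> 0 = x" "\<gamma>1 0 = v"
    using tangent_curve[OF v open_U assms(2)] by blast
  note cD = curve_inD[OF C]
  have d: "((\<lambda>t. N (\<gamma> t)) has_vector_derivative D1 N x v) (at 0)"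
    using normal_curve_derivative[OF C, of 0] cD(1) c by simp
  have "N (\<gamma> 0) \<bullet> D1 N x v + D1 N x v \<bullet> N (\<gamma> 0) = 0"
    by (rule derivative_locally_const[OF has_real_derivative_inner[OF d d] cD(1), of 1])
      (use cD(2,3) N_eq normal_inner_self in auto)
  then show ?thesis using c N_eq[OF assms(1,2)] by (simp add: inner_commute)
qed

text \<open>Differentiate \<open>N \<bullet> \<gamma>1 = 0\<close> at 0. This trades the shape
  operator for the normal acceleration of a curve.\<close>

lemma shape_operator_curve:
  assumes C: "curve_in S U \<epsilon> \<gamma> \<gamma>1 \<gamma>2 \<gamma>3"
  shows "D1 N (\<gamma> 0) (\<gamma>1 0) \<bullet> \<gamma>1 0 = - (n (\<gamma> 0) \<bullet> \<gamma>2 0)"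
proof -
  note cD = curve_inD[OF C]
  have "N (\<gamma> 0) \<bullet> \<gamma>2 0 + D1 N (\<gamma> 0) (\<gamma>1 0) \<bullet> \<gamma>1 0 = 0"
    by (rule derivative_locally_const[OF has_real_derivative_inner[OF normal_curve_derivative[OF C] cD(6)] cD(1), of 0])
      (use cD N_eq tangent_iff in auto)
  then show ?thesis using N_eq cD(1-3) by (simp add: add_eq_0_iff)
qed

text \<open>In a chart the vectors \<open>D1 \<psi> y a'\<close> are tangent along the image of the
  hyperplane. Differentiating their orthogonality to \<open>N\<close> in direction \<open>a\<close>
  expresses the shape operator through \<open>n x \<bullet> D2 \<psi> q a' a\<close>, which is
  symmetric in \<open>a\<close> and \<open>a'\<close>.\<close>

lemma shape_operator_symmetric:
  assumes x: "x \<in> S" "x \<in> U" and v: "v \<in> tangent_space S x" and w: "w \<in> tangent_space S x"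
  shows "D1 N x v \<bullet> w = v \<bullet> D1 N x w"
proof -
  obtain W V \<phi> \<psi> and e :: 'a where c: "open W" "x \<in> W" "open V" "homeomorphism W V \<phi> \<psi>"
      "smooth_on \<phi> W" "smooth_on \<psi> V" "\<phi> ` (W \<inter> S) = V \<inter> {y. e \<bullet> y = 0}" and e: "e \<noteq> 0"
    using bspec[OF hypersurface[unfolded smooth_hypersurface_def] x(1)] by blast
  define q where "q = \<phi> x"
  have q: "q \<in> V" "e \<bullet> q = 0" "\<psi> q = x"
    using c x by (auto simp: q_def homeomorphism_def)
  have T: "tangent_space S (\<psi> y) = D1 \<psi> y ` {w. e \<bullet> w = 0}" and S: "\<psi> y \<in> S"
    if "y \<in> V" "e \<bullet> y = 0" for y
  proof -
    have "y \<in> \<phi> ` (W \<inter> S)" using that by (simp add: c(7))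
    then obtain z where z: "z \<in> W" "z \<in> S" "y = \<phi> z" by auto
    then have "\<psi> y = z" using c(4) by (auto simp: homeomorphism_def)
    then show "\<psi> y \<in> S" "tangent_space S (\<psi> y) = D1 \<psi> y ` {w. e \<bullet> w = 0}"
      using tangent_space_chart(1)[OF c(1) z(1) c(3-7) z(2)] z by auto
  qed
  have key: "D1 N x (D1 \<psi> q a) \<bullet> D1 \<psi> q a' = - (n x \<bullet> D2 \<psi> q a' a)"
    if a: "e \<bullet> a = 0" "e \<bullet> a' = 0" for a a'
  proof -
    let ?l = "\<lambda>t::real. q + t *\<^sub>R a"
    have l: "(?l has_vector_derivative a) (at t)" for t
      by (auto intro!: derivative_eq_intros)
    have open': "open (V \<inter> \<psi> -` U)"
      using open_U c(3,4) by (intro continuous_open_preimage) (auto simp: homeomorphism_def)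
    have "(?l \<longlongrightarrow> q) (at 0)" by (rule tendsto_eq_intros | simp)+
    then have "\<forall>\<^sub>F t in nhds 0. ?l t \<in> V \<inter> \<psi> -` U"
      using topological_tendstoD[of ?l q "at 0", OF _ open'] q x by (simp add: eventually_nhds_conv_at)
    then obtain \<epsilon> where \<epsilon>: "\<epsilon> > 0" "\<And>t. \<bar>t\<bar> < \<epsilon> \<Longrightarrow> ?l t \<in> V" "\<And>t. \<bar>t\<bar> < \<epsilon> \<Longrightarrow> \<psi> (?l t) \<in> U"
      by (auto simp: eventually_nhds_metric dist_real_def)
    have ql: "q = ?l 0" by simp
    have d1: "((\<lambda>t. \<psi> (?l t)) has_vector_derivative D1 \<psi> q a) (at 0)"
      by (rule has_vector_derivative_compose[OF _ l]) (use smooth_on_derivatives(1)[OF c(6) q(1)] in simp)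
    have d2: "((\<lambda>t. D1 \<psi> (?l t) a') has_vector_derivative D2 \<psi> q a' a) (at 0)"
      by (rule has_vector_derivative_compose[OF _ l, of "\<lambda>y. D1 \<psi> y a'"])
        (use smooth_on_derivatives(2)[OF c(6) q(1)] in simp)
    have d3: "((\<lambda>t. N (\<psi> (?l t))) has_vector_derivative D1 N x (D1 \<psi> q a)) (at 0)"
      by (rule has_vector_derivative_compose[OF _ d1]) (use smooth_on_derivatives(1)[OF smooth_N x(2)] q(3) in simp)
    have hyp: "e \<bullet> ?l t = 0" for t using q(2) a(1) by (simp add: inner_add_right)
    have "N (\<psi> (?l 0)) \<bullet> D2 \<psi> q a' a + D1 N x (D1 \<psi> q a) \<bullet> D1 \<psi> (?l 0) a' = 0"
    proof (rule derivative_locally_const[OF has_real_derivative_inner[OF d3 d2] \<epsilon>(1), of 0])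
      fix t :: real assume t: "\<bar>t\<bar> < \<epsilon>"
      have "D1 \<psi> (?l t) a' \<in> tangent_space S (\<psi> (?l t))"
        using T[OF \<epsilon>(2)[OF t] hyp] a(2) by blast
      then show "N (\<psi> (?l t)) \<bullet> D1 \<psi> (?l t) a' = 0"
        using tangent_iff S[OF \<epsilon>(2)[OF t] hyp] N_eq \<epsilon>(3)[OF t] by simp
    qed
    then show ?thesis using q(3) N_eq[OF x] by (simp add: add_eq_0_iff)
  qed
  obtain a a' where a: "v = D1 \<psi> q a" "w = D1 \<psi> q a'" "e \<bullet> a = 0" "e \<bullet> a' = 0"
    using v w T[OF q(1,2)] q(3) by auto
  show ?thesis
    using key[OF a(3,4)] key[OF a(4,3)] D2_symmetric[OF c(6,3) q(1), of a a'] a(1,2)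
    by (simp add: inner_commute)
qed

end

subsection \<open>The two-point bound: contact on the diagonal\<close>

lemma orthonormal_basis_insert:
  assumes "norm e = 1" "norm \<nu> = 1" "\<nu> \<bullet> e = 0"
    and B: "orthonormal_basis_of ({v. \<nu> \<bullet> v = 0} \<inter> {v. e \<bullet> v = 0}) B"
  shows "orthonormal_basis_of {v. \<nu> \<bullet> v = 0} (insert e B)"
proof -
  have BT: "\<nu> \<bullet> b = 0" "e \<bullet> b = 0" if "b \<in> B" for b
    using B that span_base unfolding orthonormal_basis_of_def by blast+
  have "span (insert e B) = {v. \<nu> \<bullet> v = 0}"
  proof
    show "span (insert e B) \<subseteq> {v. \<nu> \<bullet> v = 0}"
      using BT(1) assms(3) by (intro span_minimal subspace_hyperplane) auto
    show "{v. \<nu> \<bullet> v = 0} \<subseteq> span (insert e B)"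
    proof
      fix v assume "v \<in> {v. \<nu> \<bullet> v = 0}"
      then have "v - (e \<bullet> v) *\<^sub>R e \<in> span B"
        using B assms(1,3) by (simp add: orthonormal_basis_of_def inner_diff_right dot_square_norm)
      then show "v \<in> span (insert e B)" by (auto simp: span_insert)
    qed
  qed
  then show ?thesis
    using B BT assms(1)
    by (auto simp: orthonormal_basis_of_def pairwise_insert orthogonal_def inner_commute)
qed

text \<open>The two sides differ by \<open>(1 - norm x)^2 / 2\<close>, so a norm is replaced by a
  polynomial without loss to first order near unit vectors.\<close>

lemma norm_le_half_square_add_one: "norm (x :: 'a::real_inner) \<le> (1 + x \<bullet> x) / 2"
  using sum_squares_bound[of "norm x" 1] by (simp add: dot_square_norm power2_eq_square field_simps)

text \<open>\<open>\<Omega>\<close> is the enclosed region and \<open>n\<close> its outer normal.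
  Here \<open>T\<close> is any positive upper bound of the two-point quotient; attainment is added
  in the two contact locales.\<close>

locale two_point_bound = oriented_hypersurface S n
  for S :: "'a::euclidean_space set" and n +
  fixes \<Omega> :: "'a set" and T lam :: real
  assumes disjoint: "S \<inter> \<Omega> = {}" and open_\<Omega>: "open \<Omega>" and closed_\<Omega>S: "closed (\<Omega> \<union> S)"
    and inward: "\<And>p v. \<lbrakk>p \<in> S; n p \<bullet> v < 0\<rbrakk> \<Longrightarrow> \<exists>\<epsilon>>0. \<forall>s. 0 < s \<and> s < \<epsilon> \<longrightarrow> p + s *\<^sub>R v \<in> \<Omega>"
    and outward: "\<And>p v. \<lbrakk>p \<in> S; n p \<bullet> v > 0\<rbrakk> \<Longrightarrow> \<exists>\<epsilon>>0. \<forall>s. 0 < s \<and> s < \<epsilon> \<longrightarrow> p + s *\<^sub>R v \<notin> \<Omega>"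
    and T_pos: "T > 0"
    and bound: "\<And>x y. \<lbrakk>x \<in> \<Omega> \<union> S; y \<notin> \<Omega>\<rbrakk> \<Longrightarrow> x \<bullet> x - y \<bullet> y \<le> 2 * T * norm (x - y)"
    and expander: "\<And>x. x \<in> S \<Longrightarrow> mean_curvature S n x + 1 / 2 * (x \<bullet> n x) = lam"
begin

text \<open>Apply \<open>bound\<close> to \<open>q + s *\<^sub>R u\<close> in
  \<open>\<Omega>\<close> and \<open>q\<close> itself, divide by \<open>s\<close> and drop the
  square. This covers strictly inward \<open>u\<close>; tangent ones are reached by tilting slightly
  inward.\<close>

lemma inner_inward_le:
  assumes "q \<in> S" "n q \<bullet> u \<le> 0"
  shows "q \<bullet> u \<le> T * norm u"
proof -
  have strict: "q \<bullet> u \<le> T * norm u" if u: "n q \<bullet> u < 0" for u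
  proof -
    obtain \<epsilon> where \<epsilon>: "\<epsilon> > 0" "\<And>s. 0 < s \<Longrightarrow> s < \<epsilon> \<Longrightarrow> q + s *\<^sub>R u \<in> \<Omega>"
      using inward[OF assms(1) u] by blast
    define s where "s = \<epsilon> / 2"
    have s: "s > 0" "q + s *\<^sub>R u \<in> \<Omega>" using \<epsilon> by (auto simp: s_def)
    have "(q + s *\<^sub>R u) \<bullet> (q + s *\<^sub>R u) - q \<bullet> q \<le> 2 * T * norm (s *\<^sub>R u)"
      using bound[of "q + s *\<^sub>R u" q] s(2) assms(1) disjoint by auto
    then have "s * (2 * (q \<bullet> u) + s * (u \<bullet> u)) \<le> s * (2 * T * norm u)"
      using s(1) by (simp add: algebra_simps inner_commute)
    then have "2 * (q \<bullet> u) + s * (u \<bullet> u) \<le> 2 * T * norm u" using s(1) by simp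
    moreover have "s * (u \<bullet> u) \<ge> 0" using s(1) by simp
    ultimately show ?thesis by linarith
  qed
  show ?thesis
  proof (rule ccontr)
    define d K where "d = q \<bullet> u - T * norm u" and "K = \<bar>q \<bullet> n q\<bar> + T"
    assume "\<not> q \<bullet> u \<le> T * norm u"
    then have d: "d > 0" by (simp add: d_def)
    have K: "K > 0" using T_pos by (simp add: K_def add_nonneg_pos)
    \<comment> \<open>Tilting by \<open>\<epsilon>\<close> costs at most
      \<open>\<epsilon> * K\<close>, which this choice makes half of the excess
      \<open>d\<close>.\<close>
    define \<epsilon> where "\<epsilon> = d / (2 * K)"
    have \<epsilon>: "\<epsilon> > 0" using d K by (simp add: \<epsilon>_def)
    have "q \<bullet> (u - \<epsilon> *\<^sub>R n q) \<le> T * norm (u - \<epsilon> *\<^sub>R n q)"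
      using assms(2) \<epsilon> normal_inner_self[OF assms(1)] by (intro strict) (simp add: inner_diff_right)
    also have "\<dots> \<le> T * (norm u + \<epsilon>)"
      using T_pos \<epsilon> norm_triangle_ineq4[of u "\<epsilon> *\<^sub>R n q"] norm_normal[OF assms(1)]
      by (intro mult_left_mono) auto
    finally have "d \<le> \<epsilon> * (q \<bullet> n q + T)" by (simp add: d_def inner_diff_right algebra_simps)
    also have "\<dots> \<le> \<epsilon> * K" using \<epsilon> by (intro mult_left_mono) (auto simp: K_def)
    also have "\<dots> = d / 2" using K by (simp add: \<epsilon>_def)
    finally show False using d by simp
  qed
qed

text \<open>This is \<open>inner_inward_le\<close> for the tangential part \<open>u\<close> of
  \<open>q\<close>, where \<open>q \<bullet> u\<close> is the square of
  \<open>norm u\<close>.\<close>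

lemma tangential_position_le:
  assumes "q \<in> S" shows "q \<bullet> q - (q \<bullet> n q)\<^sup>2 \<le> T\<^sup>2"
proof -
  define u where "u = q - (q \<bullet> n q) *\<^sub>R n q"
  have nu: "n q \<bullet> u = 0" using normal_inner_self[OF assms] by (simp add: u_def inner_diff_right inner_commute)
  have qu: "q \<bullet> u = q \<bullet> q - (q \<bullet> n q)\<^sup>2" by (simp add: u_def inner_diff_right power2_eq_square)
  have "u \<bullet> u = q \<bullet> u" using nu by (simp add: u_def inner_diff_left)
  then have uu: "q \<bullet> u = norm u * norm u" by (simp add: dot_square_norm power2_eq_square)
  have "norm u * norm u \<le> T * norm u" using inner_inward_le[OF assms, of u] nu uu by simp
  then have "norm u \<le> T" using T_pos by (cases "norm u = 0") (auto simp: mult_le_cancel_right)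
  then have "norm u * norm u \<le> T * T" using T_pos by (intro mult_mono) auto
  then show ?thesis using uu qu by (simp add: power2_eq_square)
qed

end

section \<open>First- and second-order conditions at a contact point on the diagonal\<close>

locale diagonal_contact = two_point_bound S n \<Omega> T lam + extended_normal S n U N
  for S :: "'a::euclidean_space set" and n \<Omega> T lam U N +
  fixes p e :: 'a
  assumes p: "p \<in> S" "p \<in> U" and norm_e: "norm e = 1" and tangent_e: "n p \<bullet> e = 0"
    and p_e: "p \<bullet> e = T"
begin

text \<open>The support function of \<open>S\<close> at \<open>p\<close>; its reciprocal will be the
  principal curvature along \<open>e\<close>.\<close>

definition "b = p \<bullet> n p"

abbreviation "L \<equiv> D1 N p"

lemma e_e: "e \<bullet> e = 1" using norm_e by (simp add: dot_square_norm)

lemma n_n: "n p \<bullet> n p = 1" using normal_inner_self p by blast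

lemma T_iff: "v \<in> tangent_space S p \<longleftrightarrow> n p \<bullet> v = 0"
  using tangent_iff p by blast

lemma L_tangent: "n p \<bullet> v = 0 \<Longrightarrow> n p \<bullet> L v = 0"
  using shape_operator_tangent p T_iff by blast

lemma L_symmetric: "\<lbrakk>n p \<bullet> v = 0; n p \<bullet> w = 0\<rbrakk> \<Longrightarrow> L v \<bullet> w = v \<bullet> L w"
  using shape_operator_symmetric p T_iff by blast

lemma linear_L: "linear L" using smooth_on_linear_D1 smooth_N p(2) by blast

text \<open>Equality case: the tangential part of \<open>p\<close> has length at most
  \<open>T\<close> and component \<open>T\<close> along the unit vector \<open>e\<close>.\<close>

lemma p_eq: "p = T *\<^sub>R e + b *\<^sub>R n p"
proof -
  define w where "w = p - b *\<^sub>R n p"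
  have we: "w \<bullet> e = T" using p_e tangent_e by (simp add: w_def inner_diff_left)
  have "w \<bullet> w = p \<bullet> p - b\<^sup>2"
    using n_n by (simp add: w_def b_def inner_diff_left inner_diff_right inner_commute power2_eq_square)
  then have ww: "w \<bullet> w \<le> T * T"
    using tangential_position_le[OF p(1)] by (simp add: b_def power2_eq_square)
  have "(w - T *\<^sub>R e) \<bullet> (w - T *\<^sub>R e) = w \<bullet> w - T * T"
    using we e_e by (simp add: inner_diff_left inner_diff_right inner_commute)
  then have "w = T *\<^sub>R e" using ww by (metis diff_le_0_iff_le eq_iff_diff_eq_0 inner_eq_zero_iff inner_ge_zero order_antisym)
  then show ?thesis by (simp add: w_def algebra_simps)
qed

text \<open>If \<open>b\<close> were negative, tilting \<open>e\<close> inward would increase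
  \<open>p \<bullet> u\<close> linearly, while \<open>norm u\<close> grows only
  quadratically.\<close>

lemma b_nonneg: "b \<ge> 0"
proof (rule ccontr)
  assume "\<not> b \<ge> 0"
  \<comment> \<open>The maximiser of gain minus cost,
    \<open>- \<epsilon> * b - T * \<epsilon>^2 / 2\<close>.\<close>
  define \<epsilon> where "\<epsilon> = - b / T"
  have \<epsilon>: "\<epsilon> > 0" using T_pos \<open>\<not> b \<ge> 0\<close> by (simp add: \<epsilon>_def divide_neg_pos)
  define u where "u = e - \<epsilon> *\<^sub>R n p"
  have nu: "n p \<bullet> u = - \<epsilon>" using tangent_e n_n by (simp add: u_def inner_diff_right)
  have uu: "u \<bullet> u = 1 + \<epsilon> * \<epsilon>"
    using tangent_e n_n e_e by (simp add: u_def inner_diff_right inner_diff_left inner_commute)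
  have "T - \<epsilon> * b = p \<bullet> u" using p_e by (simp add: u_def inner_diff_right b_def)
  also have "\<dots> \<le> T * norm u" using inner_inward_le[OF p(1)] nu \<epsilon> by simp
  also have "\<dots> \<le> T * ((1 + u \<bullet> u) / 2)"
    using T_pos norm_le_half_square_add_one by (intro mult_left_mono) auto
  finally have "- (\<epsilon> * b) \<le> T * (\<epsilon> * \<epsilon>) / 2" unfolding uu by (simp add: field_simps)
  also have "\<dots> = - (\<epsilon> * b) / 2" using T_pos by (simp add: \<epsilon>_def)
  finally have "\<epsilon> * b \<ge> 0" by simp
  then show False using \<epsilon> \<open>\<not> b \<ge> 0\<close> by (simp add: zero_le_mult_iff)
qed

text \<open>The second variation of \<open>|x\<^sup>T|\<^sup>2 = |x|\<^sup>2 - \<langle>x, n\<rangle>\<^sup>2\<close>, which is maximal at \<open>p\<close>.\<close>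

lemma tangential_position_variation:
  assumes C: "curve_in S U \<epsilon> \<gamma> \<gamma>1 \<gamma>2 \<gamma>3" and c: "\<gamma> 0 = p" "\<gamma>1 0 = v"
    and m': "m' = D2 N p v v + L (\<gamma>2 0)"
  shows "p \<bullet> v = b * (p \<bullet> L v)"
    and "p \<bullet> \<gamma>2 0 + v \<bullet> v \<le> b * (p \<bullet> m' + v \<bullet> L v) + (p \<bullet> L v)\<^sup>2"
    and "n p \<bullet> m' = - (L v \<bullet> L v)"
    and "n p \<bullet> \<gamma>3 0 = - 2 * (L v \<bullet> \<gamma>2 0) - m' \<bullet> v"
proof -
  note cD = curve_inD[OF C]
  define m where "m = (\<lambda>t. D1 N (\<gamma> t) (\<gamma>1 t))"
  have N0: "N p = n p" "N (\<gamma> 0) = n p" using N_eq p c by simp_all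
  have m0: "m 0 = L v" by (simp add: m_def c)
  have dN: "((\<lambda>t. N (\<gamma> t)) has_vector_derivative m t) (at t)" if "\<bar>t\<bar> < \<epsilon>" for t
    using normal_curve_derivative[OF C that] by (simp add: m_def)
  have dm: "(m has_vector_derivative m') (at 0)"
    using has_vector_derivative_D1[OF smooth_N open_U _ cD(5)[of 0] cD(6)[of 0]] cD(1) cD(3)[of 0] c
    by (simp add: m_def m')
  have tan: "N (\<gamma> t) \<bullet> \<gamma>1 t = 0" "N (\<gamma> t) \<bullet> m t = 0" if "\<bar>t\<bar> < \<epsilon>" for t
    using cD(2-4)[OF that] N_eq tangent_iff shape_operator_tangent by (auto simp: m_def)
  have "N (\<gamma> 0) \<bullet> m' + m 0 \<bullet> m 0 = 0"
    by (rule derivative_locally_const[OF has_real_derivative_inner[OF dN dm] cD(1), of 0])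
      (use cD(1) tan in auto)
  then show "n p \<bullet> m' = - (L v \<bullet> L v)" using N0 m0 by simp
  have d1: "((\<lambda>t. N (\<gamma> t) \<bullet> \<gamma>1 t) has_real_derivative N (\<gamma> t) \<bullet> \<gamma>2 t + m t \<bullet> \<gamma>1 t) (at t)" if "\<bar>t\<bar> < \<epsilon>" for t
    by (rule has_real_derivative_inner[OF dN[OF that] cD(6)[OF that]])
  have z: "N (\<gamma> t) \<bullet> \<gamma>2 t + m t \<bullet> \<gamma>1 t = 0" if t: "\<bar>t\<bar> < \<epsilon>" for t
  proof -
    have "((\<lambda>s. N (\<gamma> s) \<bullet> \<gamma>1 s) has_real_derivative 0) (at t)"
      by (rule has_field_derivative_transform_within_open[OF DERIV_const[of 0], where S = "{-\<epsilon><..<\<epsilon>}"])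
        (use t tan(1) in auto)
    then show ?thesis using DERIV_unique d1[OF t] by blast
  qed
  \<comment> \<open>\<open>N \<bullet> \<gamma>2 + m \<bullet> \<gamma>1\<close> vanishes on a whole
    interval, so it may be differentiated once more; this yields the normal part of
    \<open>\<gamma>3 0\<close>.\<close>
  have "(N (\<gamma> 0) \<bullet> \<gamma>3 0 + m 0 \<bullet> \<gamma>2 0) + (m 0 \<bullet> \<gamma>2 0 + m' \<bullet> \<gamma>1 0) = 0"
    by (rule derivative_locally_const[OF DERIV_add[OF has_real_derivative_inner[OF dN cD(7)]
            has_real_derivative_inner[OF dm cD(6)]] cD(1), of 0])
      (use cD(1) z in auto)
  then show "n p \<bullet> \<gamma>3 0 = - 2 * (L v \<bullet> \<gamma>2 0) - m' \<bullet> v" using N0 m0 c by simp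
  define f where "f = (\<lambda>t. \<gamma> t \<bullet> \<gamma> t - (\<gamma> t \<bullet> N (\<gamma> t))\<^sup>2)"
  define f1 where "f1 = (\<lambda>t. 2 * (\<gamma> t \<bullet> \<gamma>1 t) - 2 * ((\<gamma> t \<bullet> N (\<gamma> t)) * (\<gamma> t \<bullet> m t)))"
  have f1: "(f has_real_derivative f1 t) (at t)" if t: "\<bar>t\<bar> < \<epsilon>" for t
    unfolding f_def
    by (rule derivative_eq_intros has_real_derivative_inner cD(5)[OF t] dN[OF t] refl)+
      (use tan(1)[OF t] in \<open>simp add: f1_def inner_commute\<close>)
  have f2: "(f1 has_real_derivative 2 * (p \<bullet> \<gamma>2 0 + v \<bullet> v)
      - 2 * (b * (p \<bullet> m' + v \<bullet> L v) + (p \<bullet> L v + v \<bullet> n p) * (p \<bullet> L v))) (at 0)"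
    unfolding f1_def
    by (rule derivative_eq_intros has_real_derivative_inner cD(5,6)[of 0] dN[of 0] dm refl | simp add: cD(1))+
      (use N0 in \<open>simp add: c m0 b_def algebra_simps\<close>)
  have max: "f t \<le> f 0" if "\<bar>t\<bar> < \<epsilon>" for t
  proof -
    have "f t \<le> T\<^sup>2" using tangential_position_le[of "\<gamma> t"] cD(2,3)[OF that] N_eq by (simp add: f_def)
    moreover have "f 0 = T\<^sup>2"
    proof -
      have "p \<bullet> p = p \<bullet> (T *\<^sub>R e + b *\<^sub>R n p)" using p_eq by simp
      then show ?thesis using p_e by (simp add: f_def N0 c inner_add_right b_def power2_eq_square)
    qed
    ultimately show ?thesis by simp
  qed
  note test = second_derivative_test[OF cD(1) f1 f2 max]
  show "p \<bullet> v = b * (p \<bullet> L v)" using test(1) by (simp add: f1_def c m0 N0 b_def)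
  have "v \<bullet> n p = 0" using tan(1)[of 0] cD(1) N0 c by (simp add: inner_commute)
  then show "p \<bullet> \<gamma>2 0 + v \<bullet> v \<le> b * (p \<bullet> m' + v \<bullet> L v) + (p \<bullet> L v)\<^sup>2"
    using test(2) by (simp add: power2_eq_square)
qed

text \<open>Stationarity of |x^T|^2 read through \<open>p_eq\<close>: \<open>v\<close> and
  \<open>L v\<close> are tangent, so the normal part of \<open>p\<close> drops out and
  \<open>T\<close> cancels. With the symmetry of \<open>L\<close> it makes \<open>e\<close> an
  eigenvector.\<close>

lemma principal_direction:
  assumes "n p \<bullet> v = 0" shows "e \<bullet> v = b * (e \<bullet> L v)"
proof -
  obtain \<epsilon> \<gamma> \<gamma>1 \<gamma>2 \<gamma>3 where C: "curve_in S U \<epsilon> \<gamma> \<gamma>1 \<gamma>2 \<gamma>3" and c: "\<gamma> 0 = p" "\<gamma>1 0 = v"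
    using tangent_curve[OF _ open_U p(2)] assms T_iff by blast
  have eq: "p \<bullet> v = b * (p \<bullet> L v)" using tangential_position_variation(1)[OF C c refl] .
  have "p \<bullet> w = T * (e \<bullet> w)" if "n p \<bullet> w = 0" for w
    by (subst p_eq) (simp add: inner_add_left that)
  then show ?thesis using eq assms L_tangent[OF assms] T_pos by simp
qed

lemma b_pos: "b > 0"
  using principal_direction[OF tangent_e] b_nonneg e_e by (cases "b = 0") auto

text \<open>The difference \<open>w\<close> of the two sides is tangent and, by
  \<open>principal_direction\<close> and symmetry, orthogonal to itself.\<close>

lemma L_e: "L e = (1 / b) *\<^sub>R e"
proof -
  define w where "w = L e - (1 / b) *\<^sub>R e"
  have nw: "n p \<bullet> w = 0" using L_tangent[OF tangent_e] tangent_e by (simp add: w_def inner_diff_right)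
  have "w \<bullet> w = L e \<bullet> w - (1 / b) * (e \<bullet> w)" by (simp add: w_def inner_diff_left)
  also have "\<dots> = 0"
    using principal_direction[OF nw] L_symmetric[OF tangent_e nw] b_pos by simp
  finally show ?thesis by (simp add: w_def)
qed

text \<open>For \<open>v\<close> orthogonal to \<open>e\<close> the term
  \<open>(p \<bullet> L v)^2\<close> vanishes, and the remaining terms quadratic in \<open>v\<close>
  form the square of \<open>v - b *\<^sub>R L v\<close>, with the sign that allows dropping
  it.\<close>

lemma second_variation_transverse:
  assumes C: "curve_in S U \<epsilon> \<gamma> \<gamma>1 \<gamma>2 \<gamma>3" and c: "\<gamma> 0 = p" "\<gamma>1 0 = v"
    and v: "e \<bullet> v = 0" "norm v = 1"
  shows "e \<bullet> \<gamma>2 0 \<le> b * (e \<bullet> (D2 N p v v + L (\<gamma>2 0)))"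
proof -
  define m' where "m' = D2 N p v v + L (\<gamma>2 0)"
  note var = tangential_position_variation[OF C c m'_def]
  have nv: "n p \<bullet> v = 0" using curve_inD(1,4)[OF C] c T_iff by fastforce
  have pw: "p \<bullet> w = T * (e \<bullet> w) + b * (n p \<bullet> w)" for w
    by (subst p_eq) (simp add: inner_add_left)
  have pL: "p \<bullet> L v = 0"
    using pw L_tangent[OF nv] principal_direction[OF nv] v(1) b_pos by simp
  have ng: "n p \<bullet> \<gamma>2 0 = - (L v \<bullet> v)" using shape_operator_curve[OF C] c by simp
  have "0 \<le> (v - b *\<^sub>R L v) \<bullet> (v - b *\<^sub>R L v)" by simp
  also have "\<dots> = v \<bullet> v - 2 * b * (v \<bullet> L v) + b * b * (L v \<bullet> L v)"
    by (simp add: inner_diff_left inner_diff_right inner_commute algebra_simps)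
  finally have "0 \<le> v \<bullet> v - 2 * b * (v \<bullet> L v) + b * b * (L v \<bullet> L v)" .
  moreover have "T * (e \<bullet> \<gamma>2 0) - b * (v \<bullet> L v) + v \<bullet> v
      \<le> b * (T * (e \<bullet> m') - b * (L v \<bullet> L v) + v \<bullet> L v)"
    using var(2,3) pw[of "\<gamma>2 0"] pw[of m'] pL ng by (simp add: inner_commute)
  ultimately have "T * (e \<bullet> \<gamma>2 0) \<le> T * (b * (e \<bullet> m'))" by (simp add: algebra_simps)
  then show ?thesis using T_pos by (simp add: m'_def)
qed

text \<open>For \<open>v = e\<close> the second variation of |x^T|^2 leaves a surplus
  \<open>(T / b)^2\<close>, so chords are used. The two-point bound for \<open>\<gamma> s\<close>
  and \<open>\<gamma> (- s)\<close>, divided by the length scale \<open>s\<close>, is an equality at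
  0. Its \<open>s^2\<close> coefficient gives \<open>3 * (e \<bullet> \<gamma>2 0) + b * (n p
  \<bullet> \<gamma>3 0) \<le> 0\<close>, and the known normal part of \<open>\<gamma>3 0\<close>
  turns this into the claim.\<close>

lemma second_variation_chord:
  assumes C: "curve_in S U \<epsilon> \<gamma> \<gamma>1 \<gamma>2 \<gamma>3" and c: "\<gamma> 0 = p" "\<gamma>1 0 = e"
  shows "e \<bullet> \<gamma>2 0 \<le> b * (e \<bullet> (D2 N p e e + L (\<gamma>2 0)))"
proof -
  note cD = curve_inD[OF C]
  define m' where "m' = D2 N p e e + L (\<gamma>2 0)"
  note var = tangential_position_variation[OF C c m'_def]
  \<comment> \<open>\<open>r\<close> is the second-order Taylor remainder of the curve,
    \<open>r1\<close> and \<open>r2\<close> are its derivatives; integrating twice from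
    \<open>r2\<close> produces the cubic term.\<close>
  define r where "r = (\<lambda>t. \<gamma> t - p - t *\<^sub>R e - (t ^ 2 / 2) *\<^sub>R \<gamma>2 0)"
  define r1 where "r1 = (\<lambda>t. \<gamma>1 t - e - t *\<^sub>R \<gamma>2 0)"
  define r2 where "r2 = (\<lambda>t. \<gamma>2 t - \<gamma>2 0)"
  have dr: "(r has_vector_derivative r1 t) (at t)" if "\<bar>t\<bar> < \<epsilon>" for t
    unfolding r_def r1_def
    by (rule derivative_eq_intros cD(5)[OF that] refl | simp)+
  have dr1: "(r1 has_vector_derivative r2 t) (at t)" if "\<bar>t\<bar> < \<epsilon>" for t
    unfolding r1_def r2_def
    by (rule derivative_eq_intros cD(6)[OF that] refl | simp)+
  have "((\<lambda>t. norm (r2 t - t *\<^sub>R \<gamma>3 0) / \<bar>t\<bar>) \<longlongrightarrow> 0) (at 0)"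
    using cD(7)[of 0] cD(1) by (simp add: has_vector_derivative_def has_derivative_iff_norm r2_def)
  then have "((\<lambda>t. norm (r2 t /\<^sub>R t ^ 1 - \<gamma>3 0)) \<longlongrightarrow> 0) (at 0)"
  proof (rule Lim_transform_eventually)
    have "norm (r2 t - t *\<^sub>R \<gamma>3 0) / \<bar>t\<bar> = norm (r2 t /\<^sub>R t ^ 1 - \<gamma>3 0)" if "t \<noteq> 0" for t
    proof -
      have "r2 t /\<^sub>R t ^ 1 - \<gamma>3 0 = inverse t *\<^sub>R (r2 t - t *\<^sub>R \<gamma>3 0)"
        using that by (simp add: scaleR_diff_right)
      then show ?thesis by (simp add: divide_inverse_commute)
    qed
    then show "\<forall>\<^sub>F t in at 0. norm (r2 t - t *\<^sub>R \<gamma>3 0) / \<bar>t\<bar> = norm (r2 t /\<^sub>R t ^ 1 - \<gamma>3 0)"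
      by (simp add: eventually_at_filter)
  qed
  then have "((\<lambda>t. r2 t /\<^sub>R t ^ 1) \<longlongrightarrow> \<gamma>3 0) (at 0)"
    by (rule LIM_zero_cancel[OF tendsto_norm_zero_cancel])
  from tendsto_power_quotient_integrate[OF cD(1) dr1 _ this]
  have "((\<lambda>t. r1 t /\<^sub>R t ^ 2) \<longlongrightarrow> \<gamma>3 0 /\<^sub>R 2) (at 0)"
    by (simp add: r1_def c numeral_2_eq_2)
  from tendsto_power_quotient_integrate[OF cD(1) dr _ this]
  have R: "((\<lambda>t. r t /\<^sub>R t ^ 3) \<longlongrightarrow> \<gamma>3 0 /\<^sub>R 6) (at 0)"
    by (simp add: r_def c numeral_3_eq_3)
  have "((\<lambda>t. r (- t) /\<^sub>R (- t) ^ 3) \<longlongrightarrow> \<gamma>3 0 /\<^sub>R 6) (at 0)"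
    by (rule LIM_compose_eventually[OF _ R, of uminus])
      (auto intro!: tendsto_eq_intros simp: eventually_at_filter)
  then have R': "((\<lambda>t. r (- t) /\<^sub>R t ^ 3) \<longlongrightarrow> - (\<gamma>3 0 /\<^sub>R 6)) (at 0)"
    using tendsto_minus by fastforce
  \<comment> \<open>Scaled odd and even parts of the expansion: the half-chord is \<open>s\<close>
    times \<open>e + s\<^sup>2 *\<^sub>R \<alpha> s\<close>, and the midpoint is
    \<open>p + s\<^sup>2 *\<^sub>R \<beta> s\<close>.\<close>
  define \<alpha> where "\<alpha> = (\<lambda>t. (1/2) *\<^sub>R (r t /\<^sub>R t ^ 3 - r (- t) /\<^sub>R t ^ 3))"
  define \<beta> where "\<beta> = (\<lambda>t. (1/2) *\<^sub>R (\<gamma>2 0 + t *\<^sub>R (r t /\<^sub>R t ^ 3 + r (- t) /\<^sub>R t ^ 3)))"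
  have l\<alpha>: "(\<alpha> \<longlongrightarrow> \<gamma>3 0 /\<^sub>R 6) (at 0)"
    unfolding \<alpha>_def by (rule tendsto_eq_intros R R' refl)+ (simp flip: scaleR_add_left)
  have l\<beta>: "(\<beta> \<longlongrightarrow> (1/2) *\<^sub>R \<gamma>2 0) (at 0)"
    unfolding \<beta>_def by (rule tendsto_eq_intros R R' refl)+ simp
  \<comment> \<open>\<open>s^2 * j s\<close> is the quantity that the bound makes nonpositive once
    the norm of the scaled chord \<open>o'\<close> is replaced by
    \<open>(1 + o' \<bullet> o') / 2\<close>.\<close>
  define j where "j = (\<lambda>s. e \<bullet> \<beta> s + \<alpha> s \<bullet> p + s\<^sup>2 * (\<alpha> s \<bullet> \<beta> s) - T * (e \<bullet> \<alpha> s) - T / 2 * (s\<^sup>2 * (\<alpha> s \<bullet> \<alpha> s)))"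
  have lj: "(j \<longlongrightarrow> e \<bullet> ((1/2) *\<^sub>R \<gamma>2 0) + (\<gamma>3 0 /\<^sub>R 6) \<bullet> p - T * (e \<bullet> (\<gamma>3 0 /\<^sub>R 6))) (at 0)"
    unfolding j_def by (rule tendsto_eq_intros l\<alpha> l\<beta> refl)+ simp
  have "j s \<le> 0" if s: "0 < s" "s < \<epsilon>" for s
  proof -
    define o' where "o' = e + s\<^sup>2 *\<^sub>R \<alpha> s"
    define E where "E = p + s\<^sup>2 *\<^sub>R \<beta> s"
    have o': "\<gamma> s - \<gamma> (- s) = (2 * s) *\<^sub>R o'"
    proof -
      have "s * (s * (s * (inverse s * (inverse s * inverse s)))) = 1" using s(1) by (simp add: field_simps)
      then have "(2 * s) *\<^sub>R (s\<^sup>2 *\<^sub>R \<alpha> s) = r s - r (- s)"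
        using s(1) by (simp add: \<alpha>_def power2_eq_square power3_eq_cube flip: scaleR_diff_right)
      moreover have "(s * 2) *\<^sub>R e = s *\<^sub>R e + s *\<^sub>R e" by (simp only: mult_2_right scaleR_add_left)
      ultimately show ?thesis by (simp add: o'_def scaleR_add_right r_def algebra_simps)
    qed
    have E: "\<gamma> s + \<gamma> (- s) = 2 *\<^sub>R E"
    proof -
      have "s * s * (s * (inverse s * inverse s * inverse s)) = 1" using s(1) by (simp add: field_simps)
      then have "2 *\<^sub>R (s\<^sup>2 *\<^sub>R \<beta> s) = s\<^sup>2 *\<^sub>R \<gamma>2 0 + (r s + r (- s))"
        using s(1) by (simp add: \<beta>_def power2_eq_square power3_eq_cube scaleR_add_right)
      then show ?thesis by (simp add: E_def scaleR_add_right r_def algebra_simps scaleR_2 flip: scaleR_add_left)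
    qed
    have "(\<gamma> s - \<gamma> (- s)) \<bullet> (\<gamma> s + \<gamma> (- s)) = \<gamma> s \<bullet> \<gamma> s - \<gamma> (- s) \<bullet> \<gamma> (- s)"
      by (simp only: inner_diff_left inner_add_right) (simp add: inner_commute)
    also have "\<dots> \<le> 2 * T * norm (\<gamma> s - \<gamma> (- s))"
      using cD(2)[of s] cD(2)[of "-s"] s disjoint by (intro bound) auto
    finally have "(4 * s) * (o' \<bullet> E) \<le> (4 * s) * (T * norm o')"
      using s(1) by (simp add: o' E mult_ac)
    then have "o' \<bullet> E \<le> T * norm o'" using s(1) by simp
    also have "\<dots> \<le> T * ((1 + o' \<bullet> o') / 2)"
      using T_pos norm_le_half_square_add_one by (intro mult_left_mono) auto
    finally have "o' \<bullet> E - T * ((1 + o' \<bullet> o') / 2) \<le> 0" by simp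
    also have "o' \<bullet> E - T * ((1 + o' \<bullet> o') / 2) = s\<^sup>2 * j s"
      using p_e e_e
      by (simp add: o'_def E_def j_def inner_add_left inner_add_right inner_commute algebra_simps)
    finally show ?thesis using s(1) by (simp add: mult_le_0_iff)
  qed
  then have "\<forall>\<^sub>F s in at_right 0. j s \<le> 0"
    using cD(1) by (auto simp: eventually_at_right)
  moreover have "(j \<longlongrightarrow> e \<bullet> ((1/2) *\<^sub>R \<gamma>2 0) + (\<gamma>3 0 /\<^sub>R 6) \<bullet> p - T * (e \<bullet> (\<gamma>3 0 /\<^sub>R 6))) (at_right 0)"
    using lj filterlim_at_split by blast
  ultimately have lim: "e \<bullet> ((1/2) *\<^sub>R \<gamma>2 0) + (\<gamma>3 0 /\<^sub>R 6) \<bullet> p - T * (e \<bullet> (\<gamma>3 0 /\<^sub>R 6)) \<le> 0"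
    using tendsto_upperbound trivial_limit_at_right_real by blast
  have "\<gamma>3 0 \<bullet> p = T * (e \<bullet> \<gamma>3 0) + b * (n p \<bullet> \<gamma>3 0)"
    by (subst p_eq) (simp add: inner_add_right inner_commute)
  then have "3 * (e \<bullet> \<gamma>2 0) + b * (n p \<bullet> \<gamma>3 0) \<le> 0" using lim by (simp add: field_simps)
  moreover have "b * (L e \<bullet> \<gamma>2 0) = e \<bullet> \<gamma>2 0" using L_e b_pos by simp
  moreover have "b * (n p \<bullet> \<gamma>3 0) = - 2 * (b * (L e \<bullet> \<gamma>2 0)) - b * (e \<bullet> m')"
    unfolding var(4) by (simp add: algebra_simps inner_commute)
  ultimately have "e \<bullet> \<gamma>2 0 \<le> b * (e \<bullet> m')" by linarith
  then show ?thesis by (simp add: m'_def)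
qed

text \<open>The acceleration of the curve drops out: its tangential part by
  \<open>principal_direction\<close>, its normal part because it is
  \<open>- (L v \<bullet> v)\<close>. What remains is a covariant derivative of the second
  fundamental form; the term with \<open>L (n p)\<close> makes it independent of the extension
  \<open>N\<close>.\<close>

lemma hessian_normal_nonneg:
  assumes v: "v = e \<or> e \<bullet> v = 0" "norm v = 1" "n p \<bullet> v = 0"
  shows "e \<bullet> D2 N p v v \<ge> (L v \<bullet> v) * (e \<bullet> L (n p))"
proof -
  obtain \<epsilon> \<gamma> \<gamma>1 \<gamma>2 \<gamma>3 where C: "curve_in S U \<epsilon> \<gamma> \<gamma>1 \<gamma>2 \<gamma>3" and c: "\<gamma> 0 = p" "\<gamma>1 0 = v"
    using tangent_curve[OF _ open_U p(2)] v(3) T_iff by blast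
  have ineq: "e \<bullet> \<gamma>2 0 \<le> b * (e \<bullet> (D2 N p v v + L (\<gamma>2 0)))"
    using v second_variation_chord[OF C] second_variation_transverse[OF C c] c by auto
  define \<tau> where "\<tau> = \<gamma>2 0 - (n p \<bullet> \<gamma>2 0) *\<^sub>R n p"
  have ng: "n p \<bullet> \<gamma>2 0 = - (L v \<bullet> v)" using shape_operator_curve[OF C] c by simp
  have g: "\<gamma>2 0 = \<tau> - (L v \<bullet> v) *\<^sub>R n p" by (simp add: \<tau>_def ng)
  have "n p \<bullet> \<tau> = 0" using n_n by (simp add: \<tau>_def inner_diff_right)
  from principal_direction[OF this] have "e \<bullet> \<tau> = b * (e \<bullet> L \<tau>)" .
  moreover have "e \<bullet> \<gamma>2 0 = e \<bullet> \<tau>" using tangent_e by (simp add: g inner_diff_right inner_commute)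
  moreover have L\<gamma>: "L (\<gamma>2 0) = L \<tau> - (L v \<bullet> v) *\<^sub>R L (n p)"
    by (simp add: g linear_diff[OF linear_L] linear_cmul[OF linear_L])
  moreover have "e \<bullet> L (\<gamma>2 0) = e \<bullet> L \<tau> - (L v \<bullet> v) * (e \<bullet> L (n p))"
    by (simp add: L\<gamma> inner_diff_right)
  ultimately have "0 \<le> b * (e \<bullet> D2 N p v v - (L v \<bullet> v) * (e \<bullet> L (n p)))"
    using ineq by (simp only: inner_add_right) (simp add: algebra_simps)
  then show ?thesis using b_pos by (simp add: zero_le_mult_iff)
qed

text \<open>The Codazzi equation, from differentiating the symmetry of the shape operator.\<close>

lemma codazzi:
  assumes v: "n p \<bullet> v = 0"
  shows "e \<bullet> D2 N p v v - (L v \<bullet> v) * (e \<bullet> L (n p)) = D2 N p v e \<bullet> v - (L e \<bullet> v) * (L (n p) \<bullet> v)"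
proof -
  obtain \<epsilon> \<gamma> \<gamma>1 \<gamma>2 \<gamma>3 where C: "curve_in S U \<epsilon> \<gamma> \<gamma>1 \<gamma>2 \<gamma>3" and c: "\<gamma> 0 = p" "\<gamma>1 0 = v"
    using tangent_curve[OF _ open_U p(2)] v T_iff by blast
  note cD = curve_inD[OF C]
  have N0: "N p = n p" using N_eq p by simp
  have dN: "((\<lambda>t. N (\<gamma> t)) has_vector_derivative L v) (at 0)"
    using normal_curve_derivative[OF C, of 0] cD(1) c by simp
  \<comment> \<open>\<open>P w\<close> projects the constant vector \<open>w\<close> to the tangent
    spaces along the curve, so the shape operator is symmetric on such pairs at every time and the
    symmetry can be differentiated.\<close>
  define P where "P = (\<lambda>w t. w - (w \<bullet> N (\<gamma> t)) *\<^sub>R N (\<gamma> t))"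
  have dP: "(P w has_vector_derivative - ((w \<bullet> L v) *\<^sub>R n p)) (at 0)" and P0: "P w 0 = w" if "n p \<bullet> w = 0" for w
  proof -
    have "((\<lambda>t. w \<bullet> N (\<gamma> t)) has_real_derivative w \<bullet> L v) (at 0)"
      using has_real_derivative_inner[OF has_vector_derivative_const[of w] dN] by simp
    from has_vector_derivative_diff[OF has_vector_derivative_const[of w] has_vector_derivative_scaleR[OF this dN]]
    show "(P w has_vector_derivative - ((w \<bullet> L v) *\<^sub>R n p)) (at 0)"
      using that by (simp add: P_def c N0 inner_commute)
    show "P w 0 = w" using that by (simp add: P_def c N0 inner_commute)
  qed
  have dQ: "((\<lambda>t. D1 N (\<gamma> t) (P w t)) has_vector_derivative D2 N p w v - (w \<bullet> L v) *\<^sub>R L (n p)) (at 0)"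
    if "n p \<bullet> w = 0" for w
  proof -
    have "((\<lambda>t. D1 N (\<gamma> t) (P w t)) has_vector_derivative
        D2 N (\<gamma> 0) (P w 0) v + D1 N (\<gamma> 0) (- ((w \<bullet> L v) *\<^sub>R n p))) (at 0)"
      by (rule has_vector_derivative_D1[OF smooth_N open_U _ _ dP[OF that]])
        (use cD(1) cD(3,5)[of 0] c in auto)
    then show ?thesis
      by (simp add: P0[OF that] c linear_neg[OF linear_L] linear_cmul[OF linear_L])
  qed
  have "(D1 N (\<gamma> 0) (P v 0) \<bullet> - ((e \<bullet> L v) *\<^sub>R n p) + (D2 N p v v - (v \<bullet> L v) *\<^sub>R L (n p)) \<bullet> P e 0)
     - (D1 N (\<gamma> 0) (P e 0) \<bullet> - ((v \<bullet> L v) *\<^sub>R n p) + (D2 N p e v - (e \<bullet> L v) *\<^sub>R L (n p)) \<bullet> P v 0) = 0"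
  proof (rule derivative_locally_const[OF DERIV_diff[OF has_real_derivative_inner[OF dQ[OF v] dP[OF tangent_e]]
            has_real_derivative_inner[OF dQ[OF tangent_e] dP[OF v]]] cD(1), of 0])
    fix t assume t: "\<bar>t\<bar> < \<epsilon>"
    have "P w t \<in> tangent_space S (\<gamma> t)" for w
      using cD(2,3)[OF t] N_eq normal_inner_self tangent_iff
      by (simp add: P_def inner_diff_right inner_commute)
    then show "D1 N (\<gamma> t) (P v t) \<bullet> P e t - D1 N (\<gamma> t) (P e t) \<bullet> P v t = 0"
      using shape_operator_symmetric[OF cD(2)[OF t] cD(3)[OF t]] by (simp add: inner_commute)
  qed
  then show ?thesis
    using P0[OF v] P0[OF tangent_e] c L_tangent[OF v] L_tangent[OF tangent_e]
      D2_symmetric[OF smooth_N open_U p(2), of e v] L_symmetric[OF v tangent_e]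
    by (simp add: inner_commute inner_diff_left inner_diff_right)
qed

text \<open>The trace form of the equation is differentiated along a curve with velocity
  \<open>e\<close>. The term \<open>T / (2 * b)\<close> comes from half the position term:
  \<open>p \<bullet> L e = T / b\<close>, and \<open>e\<close> is orthogonal to
  \<open>n p\<close>.\<close>

lemma mean_curvature_derivative:
  "(\<Sum>a\<in>Basis. D2 N p a e \<bullet> a) - D2 N p (n p) e \<bullet> n p - L (n p) \<bullet> L e + T / (2 * b) = 0"
proof -
  obtain \<epsilon> \<gamma> \<gamma>1 \<gamma>2 \<gamma>3 where C: "curve_in S U \<epsilon> \<gamma> \<gamma>1 \<gamma>2 \<gamma>3" and c: "\<gamma> 0 = p" "\<gamma>1 0 = e"
    using tangent_curve[OF _ open_U p(2)] tangent_e T_iff by blast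
  note cD = curve_inD[OF C]
  have N0: "N p = n p" using N_eq p by simp
  have d\<gamma>: "(\<gamma> has_vector_derivative e) (at 0)" using cD(1,5) c by fastforce
  have dN: "((\<lambda>t. N (\<gamma> t)) has_vector_derivative L e) (at 0)"
    using normal_curve_derivative[OF C, of 0] cD(1) c by simp
  have dw: "((\<lambda>t. D1 N (\<gamma> t) (w t)) has_vector_derivative D2 N p (w 0) e + L w') (at 0)"
    if "(w has_vector_derivative w') (at 0)" for w w'
    using has_vector_derivative_D1[OF smooth_N open_U _ d\<gamma> that] c p(2) by simp
  define h where "h = (\<lambda>t. (\<Sum>a\<in>Basis. D1 N (\<gamma> t) a \<bullet> a) - D1 N (\<gamma> t) (N (\<gamma> t)) \<bullet> N (\<gamma> t)
      + 1 / 2 * (\<gamma> t \<bullet> N (\<gamma> t)))"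
  have da: "((\<lambda>t. D1 N (\<gamma> t) a \<bullet> a) has_real_derivative D2 N p a e \<bullet> a) (at 0)" for a
    using has_real_derivative_inner[OF dw[OF has_vector_derivative_const[of a]] has_vector_derivative_const[of a]]
    by (simp add: linear_0[OF linear_L])
  have "(h has_real_derivative (\<Sum>a\<in>Basis. D2 N p a e \<bullet> a)
      - (D1 N (\<gamma> 0) (N (\<gamma> 0)) \<bullet> L e + (D2 N p (N (\<gamma> 0)) e + L (L e)) \<bullet> N (\<gamma> 0))
      + 1 / 2 * (\<gamma> 0 \<bullet> L e + e \<bullet> N (\<gamma> 0))) (at 0)"
    unfolding h_def
    by (intro DERIV_add DERIV_diff DERIV_sum DERIV_cmult da has_real_derivative_inner dw dN d\<gamma>)
  then have "(\<Sum>a\<in>Basis. D2 N p a e \<bullet> a)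
      - (D1 N (\<gamma> 0) (N (\<gamma> 0)) \<bullet> L e + (D2 N p (N (\<gamma> 0)) e + L (L e)) \<bullet> N (\<gamma> 0))
      + 1 / 2 * (\<gamma> 0 \<bullet> L e + e \<bullet> N (\<gamma> 0)) = 0"
  proof (rule derivative_locally_const[OF _ cD(1), of _ _ lam])
    fix t assume "\<bar>t\<bar> < \<epsilon>"
    note t = cD(2,3)[OF this]
    show "h t = lam"
      using mean_curvature_trace[OF t] expander[OF t(1)] N_eq[OF t] by (simp add: h_def)
  qed
  moreover have "L (L e) \<bullet> n p = 0"
    using L_tangent[OF L_tangent[OF tangent_e]] by (simp add: inner_commute)
  moreover have "p \<bullet> L e = T / b" using p_e by (simp add: L_e)
  ultimately show ?thesis
    using tangent_e by (simp add: c N0 inner_add_left inner_add_right inner_commute)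
qed

lemma contradiction: False
proof -
  obtain B where B: "orthonormal_basis_of ({v. n p \<bullet> v = 0} \<inter> {v. e \<bullet> v = 0}) B"
    using orthonormal_basis_subspace[OF subspace_inter[OF subspace_hyperplane subspace_hyperplane]]
    unfolding orthonormal_basis_of_def by metis
  have BT: "n p \<bullet> v = 0" "e \<bullet> v = 0" "norm v = 1" if "v \<in> B" for v
    using B that span_base unfolding orthonormal_basis_of_def by blast+
  have fin: "finite B"
    using B pairwise_orthogonal_independent[of B] independent_imp_finite
    by (fastforce simp: orthonormal_basis_of_def)
  have eB: "e \<notin> B" using BT(2) e_e by force
  have ONB: "orthonormal_basis_of (tangent_space S p) (insert e B)"
    using orthonormal_basis_insert[OF norm_e norm_normal tangent_e B] p(1) tangent_space_eq by simp
  \<comment> \<open>By \<open>codazzi\<close> each summand is the nonnegative quantity of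
    \<open>hessian_normal_nonneg\<close>. The basis contains \<open>e\<close> because that lemma
    speaks of \<open>e\<close> and of directions orthogonal to it. The sum is the derivative of the
    mean curvature along \<open>e\<close>.\<close>
  have "0 \<le> (\<Sum>v\<in>insert e B. D2 N p v e \<bullet> v - (L e \<bullet> v) * (L (n p) \<bullet> v))"
  proof (rule sum_nonneg)
    fix v assume "v \<in> insert e B"
    then have "v = e \<or> e \<bullet> v = 0" "norm v = 1" "n p \<bullet> v = 0" using BT norm_e tangent_e by auto
    then show "0 \<le> D2 N p v e \<bullet> v - (L e \<bullet> v) * (L (n p) \<bullet> v)"
      using codazzi hessian_normal_nonneg by force
  qed
  also have "\<dots> = (\<Sum>v\<in>insert e B. D2 N p v e \<bullet> v) - (\<Sum>v\<in>insert e B. (L e \<bullet> v) * (L (n p) \<bullet> v))"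
    by (rule sum_subtractf)
  also have "(\<Sum>v\<in>insert e B. (L e \<bullet> v) * (L (n p) \<bullet> v)) = L (n p) \<bullet> L e"
    using fin eB BT(2) e_e by (simp add: L_e)
  also have "(\<Sum>v\<in>insert e B. D2 N p v e \<bullet> v) = (\<Sum>a\<in>Basis. D2 N p a e \<bullet> a) - D2 N p (n p) e \<bullet> n p"
    using tangent_plus_normal_trace[OF p(1) ONB D2_linear[OF smooth_N open_U p(2), of e]] by simp
  finally have "T / (2 * b) \<le> 0" using mean_curvature_derivative by linarith
  then show False using T_pos b_pos by (simp add: divide_le_0_iff)
qed

end

subsection \<open>The two-point bound: contact at distinct points\<close>

text \<open>If the part \<open>z\<close> of \<open>w\<close> orthogonal to \<open>\<nu>\<close> were
  nonzero, \<open>z\<close> tilted slightly into the half-space would still have a positive product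
  with \<open>w\<close>.\<close>

lemma outward_multiple:
  fixes \<nu> w :: "'a::real_inner"
  assumes \<nu>: "\<nu> \<bullet> \<nu> = 1" and neg: "\<And>u. \<nu> \<bullet> u < 0 \<Longrightarrow> w \<bullet> u \<le> 0"
  shows "w = (w \<bullet> \<nu>) *\<^sub>R \<nu>" "w \<bullet> \<nu> \<ge> 0"
proof -
  show "w \<bullet> \<nu> \<ge> 0" using neg[of "- \<nu>"] \<nu> by simp
  define z where "z = w - (w \<bullet> \<nu>) *\<^sub>R \<nu>"
  have nz: "\<nu> \<bullet> z = 0" using \<nu> by (simp add: z_def inner_diff_right inner_commute)
  have wz: "w \<bullet> z = z \<bullet> z" using nz by (simp add: z_def inner_diff_left inner_diff_right inner_commute)
  have "z \<bullet> z \<le> 0 + e" if "e > 0" for e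
  proof -
    define \<epsilon> where "\<epsilon> = e / (\<bar>w \<bullet> \<nu>\<bar> + 1)"
    have \<epsilon>: "\<epsilon> > 0" using that by (simp add: \<epsilon>_def add_nonneg_pos)
    have "w \<bullet> (z - \<epsilon> *\<^sub>R \<nu>) \<le> 0" using nz \<nu> \<epsilon> by (intro neg) (simp add: inner_diff_right)
    then have "z \<bullet> z \<le> \<epsilon> * (w \<bullet> \<nu>)" using wz by (simp add: inner_diff_right)
    also have "\<dots> \<le> \<epsilon> * (\<bar>w \<bullet> \<nu>\<bar> + 1)" using \<epsilon> by (intro mult_left_mono) auto
    also have "\<dots> = e"
    proof -
      have "\<bar>w \<bullet> \<nu>\<bar> + 1 \<noteq> 0" by linarith
      then show ?thesis by (simp add: \<epsilon>_def)
    qed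
    finally show ?thesis by simp
  qed
  then have "z \<bullet> z \<le> 0" by (rule field_le_epsilon)
  then have "z = 0" by (metis inner_eq_zero_iff inner_ge_zero order_antisym)
  then show "w = (w \<bullet> \<nu>) *\<^sub>R \<nu>" by (simp add: z_def)
qed

lemma segment_in_open:
  fixes x u :: "'a::real_normed_vector"
  assumes "open A" "x \<in> A"
  shows "\<exists>\<epsilon>>0. \<forall>s. 0 < s \<and> s < \<epsilon> \<longrightarrow> x + s *\<^sub>R u \<in> A"
proof -
  have "((\<lambda>s. x + s *\<^sub>R u) \<longlongrightarrow> x) (at 0)" by (rule tendsto_eq_intros | simp)+
  then have "\<forall>\<^sub>F s in at 0. x + s *\<^sub>R u \<in> A" using assms topological_tendstoD by blast
  then obtain d where "d > 0" "\<And>s. s \<noteq> 0 \<Longrightarrow> \<bar>s\<bar> < d \<Longrightarrow> x + s *\<^sub>R u \<in> A"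
    by (auto simp: eventually_at dist_real_def)
  then show ?thesis by (intro exI[of _ d]) auto
qed

lemma eventually_at_right_contradiction:
  fixes A B :: "real \<Rightarrow> bool"
  assumes "\<exists>\<epsilon>>0. \<forall>s. 0 < s \<and> s < \<epsilon> \<longrightarrow> A s" "\<exists>\<epsilon>>0. \<forall>s. 0 < s \<and> s < \<epsilon> \<longrightarrow> \<not> A s"
  shows False
proof -
  obtain a b where ab: "a > 0" "b > 0" "\<forall>s. 0 < s \<and> s < a \<longrightarrow> A s" "\<forall>s. 0 < s \<and> s < b \<longrightarrow> \<not> A s"
    using assms by blast
  have "0 < min a b / 2" "min a b / 2 < a" "min a b / 2 < b" using ab(1,2) by auto
  then show False using ab(3,4) by blast
qed

section \<open>Reflection in the bisector of a contact pair\<close>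

locale chord_contact = two_point_bound S n \<Omega> T lam
  for S :: "'a::euclidean_space set" and n \<Omega> T lam +
  fixes x y :: 'a
  assumes x: "x \<in> \<Omega> \<union> S" and y: "y \<notin> \<Omega>" and neq: "x \<noteq> y"
    and attained: "x \<bullet> x - y \<bullet> y = 2 * T * norm (x - y)"
begin

text \<open>The perpendicular bisector is the plane \<open>e \<bullet> z = T\<close>. Seen from its
  point \<open>T *\<^sub>R e\<close> nearest to the origin, \<open>x\<close> and \<open>y\<close>
  become \<open>w\<close> and \<open>w'\<close>, and the reflection in the bisector becomes the
  linear reflection \<open>P\<close>.\<close>

definition "d = norm (x - y)"
definition "e = (1 / d) *\<^sub>R (x - y)"
definition "w = x - T *\<^sub>R e"
definition "w' = y - T *\<^sub>R e"
definition "P v = v - (2 * (v \<bullet> e)) *\<^sub>R e"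

lemma d_pos: "d > 0" using neq by (simp add: d_def)

lemma x_y: "x - y = d *\<^sub>R e" using d_pos by (simp add: e_def)

lemma e_e: "e \<bullet> e = 1"
  using d_pos by (simp add: e_def d_def dot_square_norm power2_eq_square)

lemma e_x: "e \<bullet> x = T + d / 2" and e_y: "e \<bullet> y = T - d / 2"
proof -
  have "d * (e \<bullet> (x + y)) = (x - y) \<bullet> (x + y)" by (simp add: x_y)
  also have "\<dots> = x \<bullet> x - y \<bullet> y"
    by (simp only: inner_diff_left inner_add_right) (simp add: inner_commute)
  also have "\<dots> = d * (2 * T)" by (simp add: attained flip: d_def)
  finally have 1: "e \<bullet> x + e \<bullet> y = 2 * T" using d_pos by (simp add: inner_add_right)
  have "e \<bullet> (x - y) = d" by (simp add: x_y e_e)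
  then have 2: "e \<bullet> x - e \<bullet> y = d" by (simp add: inner_diff_right)
  show "e \<bullet> x = T + d / 2" "e \<bullet> y = T - d / 2" using 1 2 by linarith+
qed

lemma e_w: "e \<bullet> w = d / 2" and e_w': "e \<bullet> w' = - d / 2"
  using e_x e_y e_e by (simp_all add: w_def w'_def inner_diff_right)

lemma w'_eq: "w' = P w"
  using x_y e_w by (simp add: P_def w_def w'_def inner_commute algebra_simps)

lemma linear_P: "linear P"
  by (rule linearI) (simp_all add: P_def inner_add_left algebra_simps)

lemma P_inner: "P u \<bullet> v = u \<bullet> P v"
  by (simp add: P_def inner_diff_left inner_diff_right inner_commute)

lemma P_P: "P (P v) = v"
  by (simp add: P_def inner_diff_left e_e algebra_simps)

lemma P_isometry: "P u \<bullet> P v = u \<bullet> v"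
  by (simp add: P_inner P_P)

text \<open>The quadratic upper bound \<open>2 d |z| \<le> |z|\<^sup>2 + d\<^sup>2\<close> is sharp to first order at \<open>|z| = d\<close>.\<close>

lemma quadratic_bound:
  assumes "x' \<in> \<Omega> \<union> S" "y' \<notin> \<Omega>"
  shows "d * (x' \<bullet> x' - y' \<bullet> y') \<le> T * ((x' - y') \<bullet> (x' - y') + d * d)"
proof -
  have "d * (x' \<bullet> x' - y' \<bullet> y') \<le> d * (2 * T * norm (x' - y'))"
    using bound[OF assms] d_pos by simp
  also have "\<dots> = T * (2 * d * norm (x' - y'))" by simp
  also have "\<dots> \<le> T * ((x' - y') \<bullet> (x' - y') + d * d)"
    using sum_squares_bound[of d "norm (x' - y')"] T_pos
    by (intro mult_left_mono) (simp_all add: dot_square_norm power2_eq_square)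
  finally show ?thesis .
qed

lemma xx_yy: "x \<bullet> x - y \<bullet> y = 2 * T * d"
  using attained by (simp add: d_def)

text \<open>In the first point, the left side minus the right side of \<open>quadratic_bound\<close>
  has gradient \<open>2 * d\<close> times \<open>w\<close> at the contact pair, so a small step with
  \<open>w \<bullet> u > 0\<close> would break the bound.\<close>

lemma leaves_at_x:
  assumes u: "w \<bullet> u > 0"
  shows "\<exists>\<epsilon>>0. \<forall>s. 0 < s \<and> s < \<epsilon> \<longrightarrow> x + s *\<^sub>R u \<notin> \<Omega> \<union> S"
proof -
  have uu: "u \<bullet> u > 0" using u by auto
  \<comment> \<open>Half of the step length at which the quadratic term
    \<open>T * s^2 * (u \<bullet> u)\<close> could absorb the linear gain
    \<open>2 * d * s * (w \<bullet> u)\<close>.\<close>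
  define \<epsilon> where "\<epsilon> = d * (w \<bullet> u) / (T * (u \<bullet> u))"
  have "\<epsilon> > 0" using u uu d_pos T_pos by (simp add: \<epsilon>_def)
  moreover have "x + s *\<^sub>R u \<notin> \<Omega> \<union> S" if s: "0 < s" "s < \<epsilon>" for s
  proof
    assume "x + s *\<^sub>R u \<in> \<Omega> \<union> S"
    from quadratic_bound[OF this y]
    have h1: "d * ((x + s *\<^sub>R u) \<bullet> (x + s *\<^sub>R u) - y \<bullet> y)
        \<le> T * ((d *\<^sub>R e + s *\<^sub>R u) \<bullet> (d *\<^sub>R e + s *\<^sub>R u) + d * d)"
      by (simp flip: x_y add: algebra_simps)
    have h2: "(x + s *\<^sub>R u) \<bullet> (x + s *\<^sub>R u) - y \<bullet> y = 2 * T * d + 2 * s * (x \<bullet> u) + s * s * (u \<bullet> u)"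
      using xx_yy by (simp add: inner_add_left inner_add_right inner_commute algebra_simps)
    have h3: "(d *\<^sub>R e + s *\<^sub>R u) \<bullet> (d *\<^sub>R e + s *\<^sub>R u) = d * d + 2 * s * d * (e \<bullet> u) + s * s * (u \<bullet> u)"
      using e_e by (simp add: inner_add_left inner_add_right inner_commute algebra_simps)
    have "s * (2 * d * (w \<bullet> u) + d * s * (u \<bullet> u)) \<le> s * (T * s * (u \<bullet> u))"
      using h1[unfolded h2 h3] by (simp add: w_def inner_diff_left algebra_simps)
    then have "2 * d * (w \<bullet> u) + d * s * (u \<bullet> u) \<le> T * s * (u \<bullet> u)" using s(1) by simp
    moreover have "d * s * (u \<bullet> u) \<ge> 0" using d_pos s(1) by simp
    moreover have "s * (T * (u \<bullet> u)) < d * (w \<bullet> u)"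
      using s(2) T_pos uu by (simp add: \<epsilon>_def pos_less_divide_eq)
    moreover have "d * (w \<bullet> u) > 0" using u d_pos by simp
    ultimately show False by (simp add: mult_ac)
  qed
  ultimately show ?thesis by blast
qed

text \<open>In the second point the gradient is \<open>- 2 * d\<close> times \<open>w'\<close>, so a
  small step with \<open>w' \<bullet> u < 0\<close> that stayed outside \<open>\<Omega>\<close>
  would break the bound.\<close>

lemma enters_at_y:
  assumes u: "w' \<bullet> u < 0"
  shows "\<exists>\<epsilon>>0. \<forall>s. 0 < s \<and> s < \<epsilon> \<longrightarrow> y + s *\<^sub>R u \<in> \<Omega>"
proof -
  have uu: "u \<bullet> u > 0" using u by auto
  \<comment> \<open>In \<open>T + d\<close>, the \<open>T\<close> comes from the squared distance
    and the \<open>d\<close> from the square of the moving second point.\<close>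
  define \<epsilon> where "\<epsilon> = - d * (w' \<bullet> u) / ((T + d) * (u \<bullet> u))"
  have Td: "T + d > 0" using d_pos T_pos by simp
  have "\<epsilon> > 0" using u uu d_pos Td by (simp add: \<epsilon>_def mult_pos_neg divide_neg_pos)
  moreover have "y + s *\<^sub>R u \<in> \<Omega>" if s: "0 < s" "s < \<epsilon>" for s
  proof (rule ccontr)
    assume "y + s *\<^sub>R u \<notin> \<Omega>"
    from quadratic_bound[OF x this]
    have h1: "d * (x \<bullet> x - (y + s *\<^sub>R u) \<bullet> (y + s *\<^sub>R u))
        \<le> T * ((d *\<^sub>R e - s *\<^sub>R u) \<bullet> (d *\<^sub>R e - s *\<^sub>R u) + d * d)"
      by (simp flip: x_y add: algebra_simps)
    have h2: "x \<bullet> x - (y + s *\<^sub>R u) \<bullet> (y + s *\<^sub>R u) = 2 * T * d - 2 * s * (y \<bullet> u) - s * s * (u \<bullet> u)"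
      using xx_yy by (simp add: inner_add_left inner_add_right inner_commute algebra_simps)
    have h3: "(d *\<^sub>R e - s *\<^sub>R u) \<bullet> (d *\<^sub>R e - s *\<^sub>R u) = d * d - 2 * s * d * (e \<bullet> u) + s * s * (u \<bullet> u)"
      using e_e by (simp add: inner_diff_left inner_diff_right inner_commute algebra_simps)
    have "s * (- 2 * d * (w' \<bullet> u)) \<le> s * (s * ((T + d) * (u \<bullet> u)))"
      using h1[unfolded h2 h3] by (simp add: w'_def inner_diff_left algebra_simps)
    then have "- 2 * d * (w' \<bullet> u) \<le> s * ((T + d) * (u \<bullet> u))"
      using s(1) by (rule mult_left_le_imp_le)
    moreover have "s * ((T + d) * (u \<bullet> u)) < - d * (w' \<bullet> u)"
      using s(2) pos_less_divide_eq[of "(T + d) * (u \<bullet> u)" s] Td uu by (simp only: \<epsilon>_def mult_pos_pos)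
    moreover have "d * (w' \<bullet> u) < 0" using u d_pos by (simp add: mult_pos_neg)
    ultimately show False by simp
  qed
  ultimately show ?thesis by blast
qed

text \<open>Inside the open \<open>\<Omega>\<close>, \<open>x\<close> could move on along
  \<open>e\<close>, against \<open>leaves_at_x\<close>. Likewise, in the open exterior
  \<open>y\<close> could move along \<open>e\<close>, against \<open>enters_at_y\<close>.\<close>

lemma x_S: "x \<in> S"
proof (rule ccontr)
  assume "x \<notin> S"
  then have "x \<in> \<Omega>" using x by blast
  have "w \<bullet> e > 0" using e_w d_pos by (simp add: inner_commute)
  from leaves_at_x[OF this] segment_in_open[OF open_\<Omega> \<open>x \<in> \<Omega>\<close>, of e]
  show False using eventually_at_right_contradiction[of "\<lambda>s. x + s *\<^sub>R e \<in> \<Omega>"] by blast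
qed

lemma y_S: "y \<in> S"
proof (rule ccontr)
  assume "y \<notin> S"
  then have "y \<in> - (\<Omega> \<union> S)" using y by blast
  have "w' \<bullet> e < 0" using e_w' d_pos by (simp add: inner_commute)
  from enters_at_y[OF this] segment_in_open[OF open_Compl[OF closed_\<Omega>S] \<open>y \<in> - (\<Omega> \<union> S)\<close>, of e]
  show False using eventually_at_right_contradiction[of "\<lambda>s. y + s *\<^sub>R e \<in> \<Omega>"] by blast
qed

text \<open>The common length of \<open>w\<close> and \<open>w'\<close>, and the factor relating
  both to the unit normals.\<close>

definition "\<rho> = w \<bullet> n x"

lemma w_normal: "w = \<rho> *\<^sub>R n x" and \<rho>_nonneg: "\<rho> \<ge> 0"
proof -
  have "w \<bullet> u \<le> 0" if "n x \<bullet> u < 0" for u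
  proof (rule ccontr)
    assume "\<not> w \<bullet> u \<le> 0"
    then show False
      using leaves_at_x[of u] inward[OF x_S that] eventually_at_right_contradiction[of "\<lambda>s. x + s *\<^sub>R u \<in> \<Omega>"]
      by (simp add: not_le) blast
  qed
  from outward_multiple[OF normal_inner_self[OF x_S] this]
  show "w = \<rho> *\<^sub>R n x" "\<rho> \<ge> 0" by (simp_all add: \<rho>_def)
qed

lemma \<rho>_pos: "\<rho> > 0"
  using w_normal \<rho>_nonneg e_w d_pos by (cases "\<rho> = 0") auto

text \<open>The multiplier at \<open>y\<close> is nonnegative, and its square is
  \<open>w' \<bullet> w' = w \<bullet> w\<close> because \<open>P\<close> is an isometry.\<close>

lemma w'_normal: "w' = \<rho> *\<^sub>R n y"
proof -
  have "w' \<bullet> u \<le> 0" if "n y \<bullet> u < 0" for u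
  proof (rule ccontr)
    assume "\<not> w' \<bullet> u \<le> 0"
    then have "w' \<bullet> (- u) < 0" by simp
    from enters_at_y[OF this] outward[OF y_S, of "- u"] that
    show False using eventually_at_right_contradiction[of "\<lambda>s. y + s *\<^sub>R (- u) \<in> \<Omega>"] by simp
  qed
  note ww = outward_multiple[OF normal_inner_self[OF y_S] this]
  have "(w' \<bullet> n y)\<^sup>2 = w' \<bullet> w'"
    using arg_cong[OF ww(1), of "\<lambda>z. w' \<bullet> z"] by (simp add: power2_eq_square)
  also have "\<dots> = w \<bullet> w" by (simp add: w'_eq P_isometry)
  also have "\<dots> = \<rho>\<^sup>2"
    by (subst (1 2) w_normal) (simp add: normal_inner_self[OF x_S] power2_eq_square)
  finally have "w' \<bullet> n y = \<rho>" using ww(2) \<rho>_nonneg by (simp add: power2_eq_iff_nonneg)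
  then show ?thesis using ww(1) by simp
qed

lemma n_y: "n y = P (n x)"
proof -
  have "\<rho> *\<^sub>R n y = \<rho> *\<^sub>R P (n x)"
    using w'_eq w_normal w'_normal linear_cmul[OF linear_P] by metis
  then show ?thesis using \<rho>_pos by simp
qed

text \<open>Moving the second point with the reflected velocity makes all terms in the velocities
  cancel, so that only the normal accelerations are compared.\<close>

lemma second_variation:
  assumes C: "curve_in S U \<epsilon> \<gamma> \<gamma>1 \<gamma>2 \<gamma>3" and c: "\<gamma> 0 = x" "\<gamma>1 0 = v"
    and C': "curve_in S V \<epsilon>' \<eta> \<eta>1 \<eta>2 \<eta>3" and c': "\<eta> 0 = y" "\<eta>1 0 = P v"
  shows "n x \<bullet> \<gamma>2 0 \<le> n y \<bullet> \<eta>2 0"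
proof -
  note cD = curve_inD[OF C] and cD' = curve_inD[OF C']
  define M where "M = (\<lambda>t. \<gamma> t \<bullet> \<gamma> t - \<eta> t \<bullet> \<eta> t)"
  define M1 where "M1 = (\<lambda>t. 2 * (\<gamma> t \<bullet> \<gamma>1 t) - 2 * (\<eta> t \<bullet> \<eta>1 t))"
  \<comment> \<open>Both sides of the bound are squared, to avoid differentiating a norm. Squaring
    preserves the bound where \<open>M > 0\<close>, which is why \<open>t\<close> is kept below
    \<open>r\<close>.\<close>
  define G where "G = (\<lambda>t. (M t)\<^sup>2 - 4 * T\<^sup>2 * ((\<gamma> t - \<eta> t) \<bullet> (\<gamma> t - \<eta> t)))"
  define G1 where "G1 = (\<lambda>t. 2 * (M t * M1 t) - 8 * T\<^sup>2 * ((\<gamma> t - \<eta> t) \<bullet> (\<gamma>1 t - \<eta>1 t)))"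
  have dM: "(M has_real_derivative M1 t) (at t)" if "\<bar>t\<bar> < \<epsilon>" "\<bar>t\<bar> < \<epsilon>'" for t
    unfolding M_def M1_def
    by (rule derivative_eq_intros has_real_derivative_inner cD(5)[OF that(1)] cD'(5)[OF that(2)] refl)+
      (simp add: inner_commute)
  have dd: "((\<lambda>t. \<gamma> t - \<eta> t) has_vector_derivative \<gamma>1 t - \<eta>1 t) (at t)"
    "((\<lambda>t. \<gamma>1 t - \<eta>1 t) has_vector_derivative \<gamma>2 t - \<eta>2 t) (at t)" if "\<bar>t\<bar> < \<epsilon>" "\<bar>t\<bar> < \<epsilon>'" for t
    by (intro has_vector_derivative_diff cD(5,6) cD'(5,6) that)+
  have dG: "(G has_real_derivative G1 t) (at t)" if "\<bar>t\<bar> < \<epsilon>" "\<bar>t\<bar> < \<epsilon>'" for t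
    unfolding G_def
    by (rule derivative_eq_intros has_real_derivative_inner dM[OF that] dd(1)[OF that] refl)+
      (simp add: G1_def inner_commute)
  have M0: "M 0 = 2 * T * d" using xx_yy by (simp add: M_def c c')
  have "isCont M 0" using dM[of 0] cD(1) cD'(1) DERIV_isCont by simp
  then have "\<forall>\<^sub>F t in nhds 0. M t > 0"
    using M0 d_pos T_pos order_tendstoD(1)[of M "M 0" "at 0" 0]
    by (simp add: isCont_def eventually_nhds_conv_at)
  then obtain r where r: "r > 0" "\<And>t. \<bar>t\<bar> < r \<Longrightarrow> M t > 0"
    by (auto simp: eventually_nhds_metric dist_real_def)
  define \<delta> where "\<delta> = min r (min \<epsilon> \<epsilon>')"
  have \<delta>: "\<delta> > 0" "\<delta> \<le> r" "\<delta> \<le> \<epsilon>" "\<delta> \<le> \<epsilon>'" using r(1) cD(1) cD'(1) by (auto simp: \<delta>_def)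
  have xv: "w \<bullet> v = 0"
    using curve_inD(1,4)[OF C] c tangent_iff[OF x_S] by (subst w_normal) fastforce
  have x_v: "x \<bullet> v = T * (e \<bullet> v)" using xv by (simp add: w_def inner_diff_left)
  have "w' \<bullet> P v = 0" using xv by (simp add: w'_eq P_isometry)
  moreover have eP: "e \<bullet> P v = - (e \<bullet> v)" by (simp add: P_def inner_diff_right e_e inner_commute)
  ultimately have y_Pv: "y \<bullet> P v = - T * (e \<bullet> v)" by (simp add: w'_def inner_diff_left)
  have vPv: "v - P v = (2 * (e \<bullet> v)) *\<^sub>R e" by (simp add: P_def inner_commute)
  have M10: "M1 0 = 4 * T * (e \<bullet> v)" by (simp add: M1_def c c' x_v y_Pv)
  have dM1: "(M1 has_real_derivative 2 * (x \<bullet> \<gamma>2 0) - 2 * (y \<bullet> \<eta>2 0)) (at 0)"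
    unfolding M1_def
    by (rule derivative_eq_intros has_real_derivative_inner cD(5,6)[of 0] cD'(5,6)[of 0] refl | simp add: cD(1) cD'(1))+
      (simp add: c c' P_isometry)
  have "(G1 has_real_derivative 2 * (M 0 * (2 * (x \<bullet> \<gamma>2 0) - 2 * (y \<bullet> \<eta>2 0)) + M1 0 * M1 0)
      - 8 * T\<^sup>2 * ((x - y) \<bullet> (\<gamma>2 0 - \<eta>2 0) + (v - P v) \<bullet> (v - P v))) (at 0)"
    unfolding G1_def
    by (rule derivative_eq_intros has_real_derivative_inner dM1 dM[of 0] dd[of 0] refl | simp add: cD(1) cD'(1))+
      (simp add: c c' algebra_simps)
  \<comment> \<open>As \<open>v - P v\<close> is \<open>2 * (e \<bullet> v)\<close> times
    \<open>e\<close>, the square of \<open>M1 0\<close> is exactly offset by the squared velocity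
    difference.\<close>
  moreover have "2 * (M 0 * (2 * (x \<bullet> \<gamma>2 0) - 2 * (y \<bullet> \<eta>2 0)) + M1 0 * M1 0)
      - 8 * T\<^sup>2 * ((x - y) \<bullet> (\<gamma>2 0 - \<eta>2 0) + (v - P v) \<bullet> (v - P v))
      = 8 * T * d * (w \<bullet> \<gamma>2 0 - w' \<bullet> \<eta>2 0)"
    unfolding M0 M10 vPv x_y
    by (simp add: e_e w_def w'_def inner_diff_left inner_diff_right algebra_simps power2_eq_square)
  ultimately have dG1: "(G1 has_real_derivative 8 * T * d * (w \<bullet> \<gamma>2 0 - w' \<bullet> \<eta>2 0)) (at 0)" by simp
  have "G t \<le> G 0" if t: "\<bar>t\<bar> < \<delta>" for t
  proof -
    have "M t \<le> 2 * T * norm (\<gamma> t - \<eta> t)"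
      using bound[of "\<gamma> t" "\<eta> t"] cD(2)[of t] cD'(2)[of t] t \<delta> disjoint by (auto simp: M_def)
    then have "(M t)\<^sup>2 \<le> (2 * T * norm (\<gamma> t - \<eta> t))\<^sup>2"
      using r(2)[of t] t \<delta> by (intro power_mono) auto
    then have "G t \<le> 0" by (simp add: G_def dot_square_norm power_mult_distrib)
    moreover have "G 0 = 0"
      by (simp add: G_def M0 c c' dot_square_norm power_mult_distrib flip: d_def)
    ultimately show ?thesis by simp
  qed
  then have "8 * T * d * (w \<bullet> \<gamma>2 0 - w' \<bullet> \<eta>2 0) \<le> 0"
    using second_derivative_test(2)[OF \<delta>(1) dG dG1] \<delta> by auto
  then have "w \<bullet> \<gamma>2 0 \<le> w' \<bullet> \<eta>2 0" using T_pos d_pos by (simp add: mult_le_0_iff)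
  then have "\<rho> * (n x \<bullet> \<gamma>2 0) \<le> \<rho> * (n y \<bullet> \<eta>2 0)" using w_normal w'_normal by (metis inner_scaleR_left)
  then show ?thesis using \<rho>_pos by simp
qed

lemma contradiction: False
proof -
  obtain U N where U: "open U" "x \<in> U" "smooth_on N U" "\<And>q. q \<in> S \<Longrightarrow> q \<in> U \<Longrightarrow> N q = n q"
    using normal_extension[OF x_S] by blast
  obtain V K where V: "open V" "y \<in> V" "smooth_on K V" "\<And>q. q \<in> S \<Longrightarrow> q \<in> V \<Longrightarrow> K q = n q"
    using normal_extension[OF y_S] by blast
  interpret X: extended_normal S n U N using U by unfold_locales
  interpret Y: extended_normal S n V K using V by unfold_locales
  obtain B where B: "orthonormal_basis_of (tangent_space S x) B"
    using exists_orthonormal_basis_of_tangent_space[OF hypersurface x_S] by blast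
  have inj: "inj P" by (metis injI P_P)
  have "P ` {v. n x \<bullet> v = 0} = {v. n y \<bullet> v = 0}"
  proof
    show "P ` {v. n x \<bullet> v = 0} \<subseteq> {v. n y \<bullet> v = 0}" by (auto simp: n_y P_isometry)
    show "{v. n y \<bullet> v = 0} \<subseteq> P ` {v. n x \<bullet> v = 0}"
    proof
      fix v assume "v \<in> {v. n y \<bullet> v = 0}"
      then have "n x \<bullet> P v = 0" by (simp add: n_y P_inner)
      then show "v \<in> P ` {v. n x \<bullet> v = 0}" using P_P[of v] by (metis (mono_tags) image_eqI mem_Collect_eq)
    qed
  qed
  then have "span (P ` B) = tangent_space S y"
    using B linear_span_image[OF linear_P, of B] tangent_space_eq x_S y_S by (simp add: orthonormal_basis_of_def)
  then have PB: "orthonormal_basis_of (tangent_space S y) (P ` B)"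
    using B by (auto simp: orthonormal_basis_of_def pairwise_def orthogonal_def P_isometry norm_eq_sqrt_inner)
  have "D1 K y (P v) \<bullet> P v \<le> D1 N x v \<bullet> v" if v: "v \<in> B" for v
  proof -
    have vT: "v \<in> tangent_space S x" "P v \<in> tangent_space S y"
      using B PB v span_base unfolding orthonormal_basis_of_def by (metis image_eqI)+
    obtain \<epsilon> \<gamma> \<gamma>1 \<gamma>2 \<gamma>3 where C: "curve_in S U \<epsilon> \<gamma> \<gamma>1 \<gamma>2 \<gamma>3" and c: "\<gamma> 0 = x" "\<gamma>1 0 = v"
      using tangent_curve[OF vT(1) U(1,2)] by blast
    obtain \<epsilon>' \<eta> \<eta>1 \<eta>2 \<eta>3 where C': "curve_in S V \<epsilon>' \<eta> \<eta>1 \<eta>2 \<eta>3" and c': "\<eta> 0 = y" "\<eta>1 0 = P v"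
      using tangent_curve[OF vT(2) V(1,2)] by blast
    show ?thesis
      using second_variation[OF C c C' c'] X.shape_operator_curve[OF C] Y.shape_operator_curve[OF C'] c c'
      by simp
  qed
  then have "(\<Sum>v\<in>B. D1 K y (P v) \<bullet> P v) \<le> (\<Sum>v\<in>B. D1 N x v \<bullet> v)" by (rule sum_mono)
  then have "mean_curvature S n y \<le> mean_curvature S n x"
    using X.mean_curvature_basis[OF x_S U(2) B] Y.mean_curvature_basis[OF y_S V(2) PB]
    by (simp add: sum.reindex[OF inj_on_subset[OF inj subset_UNIV]])
  then have "x \<bullet> n x \<le> y \<bullet> n y" using expander[OF x_S] expander[OF y_S] by simp
  then have "\<rho> * (x \<bullet> n x) \<le> \<rho> * (y \<bullet> n y)" using \<rho>_pos by simp
  \<comment> \<open>But \<open>x \<bullet> w - y \<bullet> w' = 2 * T * d - T * d\<close>, which is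
    positive: this is the strict inequality supplied by the equation.\<close>
  then have "x \<bullet> w \<le> y \<bullet> w'" using w_normal w'_normal by (metis inner_scaleR_right)
  then have "x \<bullet> x - y \<bullet> y \<le> T * (e \<bullet> x - e \<bullet> y)"
    by (simp add: w_def w'_def inner_diff_right inner_commute algebra_simps)
  then show False using xx_yy e_x e_y T_pos d_pos by simp
qed

end

subsection \<open>The two sides of a closed hypersurface\<close>

lemma continuous_on_D1:
  fixes f :: "'a::euclidean_space \<Rightarrow> 'b::real_normed_vector"
  assumes "smooth_on f U" "continuous_on A g" "continuous_on A w" "g ` A \<subseteq> U"
  shows "continuous_on A (\<lambda>x. D1 f (g x) (w x))"
proof -
  have "continuous_on A (\<lambda>x. D1 f (g x) b)" for b
    using continuous_on_compose2[OF smooth_on_continuous_on[OF smooth_on_frechet_derivative[OF assms(1)]] assms(2,4)] .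
  then have "continuous_on A (\<lambda>x. \<Sum>b\<in>Basis. (w x \<bullet> b) *\<^sub>R D1 f (g x) b)"
    using assms(3) by (intro continuous_intros)
  then show ?thesis
    by (rule continuous_on_eq) (use D1_basis_expansion[OF assms(1)] assms(4) in \<open>simp add: image_subset_iff\<close>)
qed

text \<open>Points where the cosine is -1 are isolated: two of them at a distance \<open>h\<close>
  with \<open>0 < h \<le> 1\<close> would force \<open>cos h = 1\<close>. Used for the angle
  function on the connected \<open>S\<close>.\<close>

lemma cos_eq_minus_one_connected_constant:
  assumes "connected A" and cos: "\<And>t. t \<in> A \<Longrightarrow> cos t = (-1::real)" and "a \<in> A" "b \<in> A"
  shows "a = b"
proof -
  have False if ab: "a \<in> A" "b \<in> A" "a < b" for a b
  proof -
    define h where "h = min (b - a) 1"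
    have h: "0 < h" "h \<le> 1" "a + h \<le> b" using ab(3) by (auto simp: h_def)
    have "a + h \<in> A" using assms(1) ab(1,2) h connected_contains_Icc[of A a b] by auto
    then have "cos (a + h) = -1" "cos a = -1" using cos ab(1) by auto
    moreover from this(2) have "sin a = 0" using sin_cos_squared_add[of a] by simp
    ultimately have "cos h = 1" by (simp add: cos_add)
    moreover have "h \<le> pi" using h(2) pi_gt3 by linarith
    then have "cos h < cos 0" using cos_monotone_0_pi[of 0 h] h(1) by simp
    ultimately show False by simp
  qed
  then show ?thesis using assms(3,4) by (metis linorder_cases)
qed

section \<open>Local equations of the hypersurface\<close>

context oriented_hypersurface
begin

text \<open>A local equation whose gradient on \<open>S\<close> is a positive multiple of
  \<open>n\<close>, so that \<open>h > 0\<close> is locally the side into which \<open>n\<close>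
  points.\<close>

definition defining_function :: "'a \<Rightarrow> real \<Rightarrow> ('a \<Rightarrow> real) \<Rightarrow> bool" where
  "defining_function p r h \<longleftrightarrow> r > 0 \<and> smooth_on h (ball p r) \<and>
    (\<forall>x\<in>ball p r. h x = 0 \<longleftrightarrow> x \<in> S) \<and>
    (\<forall>x\<in>ball p r \<inter> S. D1 h x (n x) > 0 \<and> (\<forall>v. n x \<bullet> v = 0 \<longrightarrow> D1 h x v = 0))"

lemma defining_function_normal_derivative:
  assumes h: "defining_function p r h" and x: "x \<in> ball p r" "x \<in> S"
  shows "D1 h x v = (n x \<bullet> v) * D1 h x (n x)"
proof -
  have "smooth_on h (ball p r)" using h by (simp add: defining_function_def)
  note lin = smooth_on_linear_D1[OF this x(1)]
  have "D1 h x (v - (n x \<bullet> v) *\<^sub>R n x) = 0"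
    using h x normal_inner_self[OF x(2)] by (simp add: defining_function_def inner_diff_right)
  then show ?thesis by (simp add: linear_diff[OF lin] linear_cmul[OF lin])
qed

lemma exists_defining_function:
  assumes p: "p \<in> S" shows "\<exists>r h. defining_function p r h"
proof -
  obtain U V \<phi> \<psi> and e :: 'a where c: "open U" "p \<in> U" "open V" "homeomorphism U V \<phi> \<psi>"
      "smooth_on \<phi> U" "smooth_on \<psi> V" "\<phi> ` (U \<inter> S) = V \<inter> {y. e \<bullet> y = 0}" and e: "e \<noteq> 0"
    using bspec[OF hypersurface[unfolded smooth_hypersurface_def] p] by blast
  obtain W N where W: "open W" "p \<in> W" "smooth_on N W" "\<And>x. x \<in> S \<Longrightarrow> x \<in> W \<Longrightarrow> N x = n x"
    using normal_extension[OF p] by blast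
  have zero: "e \<bullet> \<phi> x = 0 \<longleftrightarrow> x \<in> S" if x: "x \<in> U" for x
  proof
    assume "e \<bullet> \<phi> x = 0"
    then have "\<phi> x \<in> \<phi> ` (U \<inter> S)" using c(4) x by (auto simp: c(7) homeomorphism_def)
    then obtain z where "z \<in> U" "z \<in> S" "\<phi> x = \<phi> z" by auto
    then show "x \<in> S" using c(4) x by (metis homeomorphism_apply1)
  next
    assume "x \<in> S"
    then have "\<phi> x \<in> \<phi> ` (U \<inter> S)" using x by blast
    then show "e \<bullet> \<phi> x = 0" by (simp add: c(7))
  qed
  have tang: "e \<bullet> D1 \<phi> x v = 0" if x: "x \<in> U" "x \<in> S" and v: "n x \<bullet> v = 0" for x v
  proof -
    obtain \<epsilon> \<gamma> \<gamma>1 \<gamma>2 \<gamma>3 where C: "curve_in S U \<epsilon> \<gamma> \<gamma>1 \<gamma>2 \<gamma>3" and g: "\<gamma> 0 = x" "\<gamma>1 0 = v"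
      using tangent_curve[OF _ c(1) x(1)] v tangent_iff[OF x(2)] by blast
    note cD = curve_inD[OF C]
    have "((\<lambda>t. \<phi> (\<gamma> t)) has_vector_derivative D1 \<phi> x v) (at 0)"
      by (rule has_vector_derivative_compose) (use smooth_on_derivatives(1)[OF c(5) x(1)] cD(1) cD(5)[of 0] g in auto)
    from has_real_derivative_inner[OF has_vector_derivative_const[of e] this]
    have "e \<bullet> D1 \<phi> x v + 0 \<bullet> \<phi> (\<gamma> 0) = 0"
      by (rule derivative_locally_const[OF _ cD(1)]) (use cD(2,3) zero in auto)
    then show ?thesis by simp
  qed
  \<comment> \<open>Otherwise \<open>e \<bullet> D1 \<phi> x\<close> would vanish on all vectors,
    although \<open>D1 \<phi> x\<close> is onto because \<open>\<psi>\<close> is a smooth right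
    inverse of \<open>\<phi>\<close>.\<close>
  have nonzero: "e \<bullet> D1 \<phi> x (n x) \<noteq> 0" if x: "x \<in> U" "x \<in> S" for x
  proof
    assume 0: "e \<bullet> D1 \<phi> x (n x) = 0"
    note lin = smooth_on_linear_D1[OF c(5) x(1)]
    have all: "e \<bullet> D1 \<phi> x v = 0" for v
    proof -
      have "e \<bullet> D1 \<phi> x (v - (n x \<bullet> v) *\<^sub>R n x) = 0"
        using tang[OF x] normal_inner_self[OF x(2)] by (simp add: inner_diff_right)
      then show ?thesis using 0 by (simp add: linear_diff[OF lin] linear_cmul[OF lin] inner_diff_right)
    qed
    have q: "\<phi> x \<in> V" "\<psi> (\<phi> x) = x" using c(4) x(1) by (auto simp: homeomorphism_def)
    have "((\<lambda>y. \<phi> (\<psi> y)) has_derivative (\<lambda>v. D1 \<phi> x (D1 \<psi> (\<phi> x) v))) (at (\<phi> x))"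
      using has_derivative_compose[OF smooth_on_derivatives(1)[OF c(6) q(1)]]
        smooth_on_derivatives(1)[OF c(5) x(1)] q(2) by simp
    moreover have "((\<lambda>y. \<phi> (\<psi> y)) has_derivative (\<lambda>v. v)) (at (\<phi> x))"
      using has_derivative_transform_within_open[OF has_derivative_ident c(3) q(1), of "\<lambda>y. \<phi> (\<psi> y)"] c(4)
      by (auto simp: homeomorphism_def)
    ultimately have "D1 \<phi> x (D1 \<psi> (\<phi> x) e) = e" using has_derivative_unique by (metis (no_types))
    then have "e \<bullet> e = 0" using all[of "D1 \<psi> (\<phi> x) e"] by simp
    then show False using e by simp
  qed
  \<comment> \<open>The extension \<open>N\<close> makes this normal derivative continuous, so its
    sign at \<open>p\<close> persists on a ball; \<open>\<sigma>\<close> corrects for a chart whose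
    coordinate decreases along \<open>n\<close>.\<close>
  define g where "g = (\<lambda>x. e \<bullet> D1 \<phi> x (N x))"
  have "continuous_on (U \<inter> W) g"
    unfolding g_def
    by (intro continuous_intros continuous_on_D1[OF c(5)])
      (use continuous_on_subset[OF smooth_on_continuous_on[OF W(3)]] in auto)
  moreover have "p \<in> U \<inter> W" "open (U \<inter> W)" using c(1,2) W(1,2) by auto
  ultimately have cont: "isCont g p" by (simp add: continuous_on_eq_continuous_at)
  have "g p \<noteq> 0" using nonzero[OF c(2) p] W(2,4) p by (simp add: g_def)
  define \<sigma> where "\<sigma> = sgn (g p)"
  have "\<sigma> * g p > 0" using \<open>g p \<noteq> 0\<close> by (simp add: \<sigma>_def sgn_if)
  moreover have "((\<lambda>x. \<sigma> * g x) \<longlongrightarrow> \<sigma> * g p) (at p)"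
    using cont by (intro tendsto_intros) (simp add: isCont_def)
  ultimately have "\<forall>\<^sub>F x in nhds p. \<sigma> * g x > 0"
    using order_tendstoD(1) by (fastforce simp: eventually_nhds_conv_at)
  moreover have "\<forall>\<^sub>F x in nhds p. x \<in> U \<inter> W"
    using \<open>p \<in> U \<inter> W\<close> \<open>open (U \<inter> W)\<close> by (rule eventually_nhds_in_open[rotated])
  ultimately have "\<forall>\<^sub>F x in nhds p. \<sigma> * g x > 0 \<and> x \<in> U \<inter> W" by (rule eventually_conj)
  then obtain r where r: "r > 0" "\<And>x. x \<in> ball p r \<Longrightarrow> \<sigma> * g x > 0" "ball p r \<subseteq> U \<inter> W"
    by (auto simp: eventually_nhds_metric dist_commute subset_eq)
  define h where "h = (\<lambda>x. (\<sigma> *\<^sub>R e) \<bullet> \<phi> x)"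
  have sm: "smooth_on h (ball p r)"
    unfolding h_def using r(3)
    by (intro smooth_on_bounded_linear[OF bounded_linear_inner_right open_ball] smooth_on_subset[OF c(5)]) blast
  have D: "D1 h x v = \<sigma> * (e \<bullet> D1 \<phi> x v)" if x: "x \<in> ball p r" for x v
  proof -
    have "(h has_derivative (\<lambda>v. (\<sigma> *\<^sub>R e) \<bullet> D1 \<phi> x v)) (at x)"
      unfolding h_def using r(3) x
      by (intro has_derivative_inner_right smooth_on_derivatives(1)[OF c(5)]) auto
    from has_derivative_unique[OF this smooth_on_derivatives(1)[OF sm x]]
    show ?thesis by (simp add: fun_eq_iff)
  qed
  have "\<sigma> \<noteq> 0" using \<open>g p \<noteq> 0\<close> by (simp add: \<sigma>_def sgn_zero_iff)
  have "defining_function p r h"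
    unfolding defining_function_def
  proof (intro conjI ballI allI impI)
    fix x assume x: "x \<in> ball p r"
    show "h x = 0 \<longleftrightarrow> x \<in> S" using zero[of x] r(3) x \<open>\<sigma> \<noteq> 0\<close> by (auto simp: h_def)
  next
    fix x assume x: "x \<in> ball p r \<inter> S"
    show "D1 h x (n x) > 0" using D[of x] r(2)[of x] W(4)[of x] r(3) x by (auto simp: g_def)
    show "D1 h x v = 0" if "n x \<bullet> v = 0" for v using D[of x] tang[OF _ _ that] r(3) x by auto
  qed (use sm r(1) in auto)
  then show ?thesis by blast
qed

text \<open>The squared distance to \<open>x\<close> along curves in \<open>S\<close> is minimal at
  \<open>y\<close>, so \<open>x - y\<close> is orthogonal to all tangent vectors, in particular to
  its own tangential part.\<close>

lemma position_normal_of_nearest: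
  assumes y: "y \<in> S" and min: "\<And>z. z \<in> S \<Longrightarrow> dist x y \<le> dist x z"
  shows "x - y = ((x - y) \<bullet> n y) *\<^sub>R n y"
proof -
  have perp: "(x - y) \<bullet> v = 0" if v: "n y \<bullet> v = 0" for v
  proof -
    obtain \<epsilon> \<gamma> \<gamma>1 \<gamma>2 \<gamma>3 where C: "curve_in S UNIV \<epsilon> \<gamma> \<gamma>1 \<gamma>2 \<gamma>3" and g: "\<gamma> 0 = y" "\<gamma>1 0 = v"
      using tangent_curve[OF _ open_UNIV UNIV_I] v tangent_iff[OF y] by blast
    note cD = curve_inD[OF C]
    have d: "((\<lambda>t. x - \<gamma> t) has_vector_derivative - v) (at 0)"
      using has_vector_derivative_diff[OF has_vector_derivative_const[of x] cD(5)[of 0]] cD(1) g by simp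
    have "((\<lambda>t. (x - \<gamma> t) \<bullet> (x - \<gamma> t)) has_real_derivative (x - \<gamma> 0) \<bullet> - v + - v \<bullet> (x - \<gamma> 0)) (at 0)"
      by (rule has_real_derivative_inner[OF d d])
    then have "(x - \<gamma> 0) \<bullet> - v + - v \<bullet> (x - \<gamma> 0) = 0"
    proof (rule DERIV_local_min[OF _ cD(1)], intro allI impI)
      fix t assume "\<bar>0 - t\<bar> < \<epsilon>"
      then have "norm (x - \<gamma> 0) \<le> norm (x - \<gamma> t)" using min cD(2) g by (simp add: dist_norm)
      then have "(norm (x - \<gamma> 0))\<^sup>2 \<le> (norm (x - \<gamma> t))\<^sup>2" by (rule power_mono) simp
      then show "(x - \<gamma> 0) \<bullet> (x - \<gamma> 0) \<le> (x - \<gamma> t) \<bullet> (x - \<gamma> t)" by (simp add: dot_square_norm)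
    qed
    then show ?thesis using g by (simp add: inner_commute)
  qed
  define z where "z = (x - y) - ((x - y) \<bullet> n y) *\<^sub>R n y"
  have nz: "n y \<bullet> z = 0" using normal_inner_self[OF y] by (simp add: z_def inner_diff_right inner_commute)
  have "z \<bullet> z = (x - y) \<bullet> z - ((x - y) \<bullet> n y) * (n y \<bullet> z)" by (simp add: z_def inner_diff_left)
  then have "z \<bullet> z = 0" using perp[OF nz] nz by simp
  then show ?thesis by (simp add: z_def)
qed

text \<open>\<open>h\<close> does not vanish on the segment after \<open>y\<close>, so its sign at
  \<open>x\<close> is the one it takes just after \<open>y\<close>, where its derivative is
  \<open>\<mu>\<close> times a positive number.\<close>

lemma transversal_crossing:
  assumes h: "defining_function p r h" and x: "x \<in> ball p r" "x \<notin> S" and y: "y \<in> ball p r" "y \<in> S"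
    and \<mu>: "x - y = \<mu> *\<^sub>R n y" and seg: "\<And>t. 0 < t \<Longrightarrow> t \<le> 1 \<Longrightarrow> y + t *\<^sub>R (x - y) \<notin> S"
  shows "sgn (h x) = sgn \<mu>"
proof -
  let ?l = "\<lambda>t::real. y + t *\<^sub>R (x - y)"
  have sm: "smooth_on h (ball p r)" using h by (simp add: defining_function_def)
  have l_in: "?l t \<in> ball p r" if "0 \<le> t" "t \<le> 1" for t
  proof -
    have "?l t = (1 - t) *\<^sub>R y + t *\<^sub>R x" by (simp add: algebra_simps)
    then show ?thesis using convexD[OF convex_ball y(1) x(1), of "1 - t" t] that by simp
  qed
  have l: "(?l has_vector_derivative x - y) (at t)" for t by (auto intro!: derivative_eq_intros)
  have hd: "((\<lambda>t. h (?l t)) has_real_derivative D1 h y (x - y)) (at 0)"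
  proof -
    have "(h has_derivative D1 h y) (at (?l 0))" using smooth_on_derivatives(1)[OF sm y(1)] by simp
    from has_vector_derivative_compose[OF this l] show ?thesis
      by (simp add: has_real_derivative_iff_has_vector_derivative)
  qed
  have y0: "h y = 0" "D1 h y (n y) > 0" using h y by (auto simp: defining_function_def)
  have D: "D1 h y (x - y) = \<mu> * D1 h y (n y)"
    using defining_function_normal_derivative[OF h y] normal_inner_self[OF y(2)]
    by (metis inner_scaleR_right mult.right_neutral \<mu>)
  have "x \<noteq> y" using x(2) y(2) by blast
  then have "\<mu> \<noteq> 0" using \<mu> by force
  have nz: "h (?l t) \<noteq> 0" if "0 < t" "t \<le> 1" for t
    using h l_in[of t] seg[OF that] that by (auto simp: defining_function_def)
  have cont: "continuous_on {s..1} (\<lambda>t. h (?l t))" if "s \<ge> 0" for s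
  proof (rule continuous_on_compose2[OF smooth_on_continuous_on[OF sm]])
    show "continuous_on {s..1} ?l" by (intro continuous_intros)
    show "?l ` {s..1} \<subseteq> ball p r" using l_in that by auto
  qed
  show ?thesis
  proof (cases "\<mu> > 0")
    case True
    then obtain \<delta> where \<delta>: "\<delta> > 0" "\<And>t. 0 < t \<Longrightarrow> t < \<delta> \<Longrightarrow> h (?l 0) < h (?l (0 + t))"
      using DERIV_pos_inc_right[OF hd] D y0(2) by auto
    define s where "s = min \<delta> 1 / 2"
    have s: "0 < s" "s < \<delta>" "s \<le> 1" using \<delta>(1) by (auto simp: s_def)
    have hs: "h (?l s) > 0" using \<delta>(2)[OF s(1,2)] y0(1) by simp
    have "h x > 0"
    proof (rule ccontr)
      assume "\<not> h x > 0"
      then obtain t where "s \<le> t" "t \<le> 1" "h (?l t) = 0"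
        using IVT2'[of "\<lambda>t. h (?l t)" 1 0 s] hs s cont[of s] by auto
      then show False using nz[of t] s(1) by simp
    qed
    then show ?thesis using True by simp
  next
    case False
    then have "\<mu> < 0" using \<open>\<mu> \<noteq> 0\<close> by simp
    then obtain \<delta> where \<delta>: "\<delta> > 0" "\<And>t. 0 < t \<Longrightarrow> t < \<delta> \<Longrightarrow> h (?l 0) > h (?l (0 + t))"
      using DERIV_neg_dec_right[OF hd] D y0(2) by (auto simp: mult_neg_pos)
    define s where "s = min \<delta> 1 / 2"
    have s: "0 < s" "s < \<delta>" "s \<le> 1" using \<delta>(1) by (auto simp: s_def)
    have hs: "h (?l s) < 0" using \<delta>(2)[OF s(1,2)] y0(1) by simp
    have "h x < 0"
    proof (rule ccontr)
      assume "\<not> h x < 0"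
      then obtain t where "s \<le> t" "t \<le> 1" "h (?l t) = 0"
        using IVT'[of "\<lambda>t. h (?l t)" s 0 1] hs s cont[of s] by auto
      then show False using nz[of t] s(1) by simp
    qed
    then show ?thesis using \<open>\<mu> < 0\<close> by simp
  qed
qed

end

section \<open>Signed distance and separation\<close>

locale closed_hypersurface = oriented_hypersurface +
  assumes compact_S: "compact S" and connected_S: "connected S" and nonempty_S: "S \<noteq> {}"
begin

definition foot :: "'a \<Rightarrow> 'a" where "foot x = (SOME y. y \<in> S \<and> infdist x S = dist x y)"

text \<open>The signed distance to \<open>S\<close>, with the sign read off at a chosen nearest
  point. Away from \<open>S\<close> nothing yet ensures continuity or independence of the
  choice.\<close>

definition side :: "'a \<Rightarrow> real" where "side x = (x - foot x) \<bullet> n (foot x)"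

lemma foot: "foot x \<in> S" "dist x (foot x) = infdist x S"
proof -
  have "\<exists>y. y \<in> S \<and> infdist x S = dist x y"
    using infdist_attains_inf[OF compact_imp_closed[OF compact_S] nonempty_S] by metis
  from someI_ex[OF this] show "foot x \<in> S" "dist x (foot x) = infdist x S" by (simp_all add: foot_def)
qed

lemma foot_le: "z \<in> S \<Longrightarrow> dist x (foot x) \<le> dist x z"
  by (simp add: foot(2) infdist_le)

lemma foot_side: "x - foot x = side x *\<^sub>R n (foot x)"
  unfolding side_def by (rule position_normal_of_nearest[OF foot(1) foot_le])

lemma abs_side: "\<bar>side x\<bar> = infdist x S"
  using foot_side[of x] norm_normal[OF foot(1)] by (metis dist_norm foot(2) mult.right_neutral norm_scaleR)

lemma infdist_eq_0: "infdist x S = 0 \<longleftrightarrow> x \<in> S"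
  using in_closed_iff_infdist_zero[OF compact_imp_closed[OF compact_S] nonempty_S] by simp

text \<open>The half radius keeps the nearest point inside the ball of \<open>h\<close>. The segment
  from it to \<open>x\<close> avoids \<open>S\<close>, since a point of \<open>S\<close> on it would
  be nearer to \<open>x\<close>.\<close>

lemma sgn_side:
  assumes h: "defining_function p r h" and p: "p \<in> S" and x: "x \<in> ball p (r / 2)"
  shows "sgn (side x) = sgn (h x)"
proof (cases "x \<in> S")
  case True
  then have "h x = 0" using h x by (auto simp: defining_function_def)
  then show ?thesis using abs_side[of x] infdist_eq_0[of x] True by simp
next
  case False
  have "dist x (foot x) \<le> dist x p" using foot_le[OF p] .
  then have y: "foot x \<in> ball p r"
    using x dist_triangle[of p "foot x" x] by (simp add: dist_commute)
  have "r > 0" using h by (simp add: defining_function_def)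
  then have xr: "x \<in> ball p r" using x by simp
  have "foot x + t *\<^sub>R (x - foot x) \<notin> S" if "0 < t" "t \<le> 1" for t
  proof
    assume "foot x + t *\<^sub>R (x - foot x) \<in> S"
    from foot_le[OF this, of x] have "norm (x - foot x) \<le> norm ((1 - t) *\<^sub>R (x - foot x))"
      by (simp add: dist_norm algebra_simps)
    then have "norm (x - foot x) \<le> (1 - t) * norm (x - foot x)" using that by simp
    then have "t * norm (x - foot x) \<le> 0" by (simp add: algebra_simps)
    then have "x = foot x" using that(1) by (simp add: mult_le_0_iff)
    then show False using foot(1)[of x] False by simp
  qed
  from transversal_crossing[OF h xr False y foot(1) foot_side this]
  show ?thesis by simp
qed

text \<open>Near \<open>p\<close> the function equals \<open>sgn (h z) * infdist z S\<close>: off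
  \<open>S\<close> the sign is locally constant, on \<open>S\<close> the distance squeezes it to
  0.\<close>

lemma isCont_side:
  assumes h: "defining_function p r h" and p: "p \<in> S" and x: "x \<in> ball p (r / 2)"
  shows "isCont side x"
proof -
  have side_eq: "side z = sgn (h z) * infdist z S" if "z \<in> ball p (r / 2)" for z
    using sgn_side[OF h p that] abs_side[of z] by (metis abs_sgn mult.commute sgn_mult_abs)
  have ev: "\<forall>\<^sub>F z in nhds x. z \<in> ball p (r / 2)"
    using x by (intro eventually_nhds_in_open) auto
  have ci: "isCont (\<lambda>z. infdist z S) x" by (intro continuous_intros)
  show ?thesis
  proof (cases "x \<in> S")
    case True
    have "side x = 0" using abs_side[of x] infdist_eq_0 True by simp
    moreover have "(side \<longlongrightarrow> 0) (at x)"
    proof (rule Lim_null_comparison)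
      show "\<forall>\<^sub>F z in at x. norm (side z) \<le> infdist z S" by (simp add: abs_side)
      show "((\<lambda>z. infdist z S) \<longlongrightarrow> 0) (at x)"
        using ci True by (simp add: isCont_def infdist_eq_0)
    qed
    ultimately show ?thesis by (simp add: isCont_def)
  next
    case False
    have "r > 0" using h by (simp add: defining_function_def)
    then have hx: "x \<in> ball p r" using x by simp
    then have "isCont h x"
      using smooth_on_derivatives(1)[of h "ball p r"] h has_derivative_continuous
      unfolding defining_function_def by blast
    moreover have "h x \<noteq> 0" using h hx False by (auto simp: defining_function_def)
    ultimately have "isCont (\<lambda>z. sgn (h z) * infdist z S) x"
      using ci by (intro continuous_intros) auto
    moreover have "\<forall>\<^sub>F z in nhds x. side z = sgn (h z) * infdist z S"
      using ev side_eq by (rule eventually_mono)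
    ultimately show ?thesis using isCont_cong[of side "\<lambda>z. sgn (h z) * infdist z S" x] by simp
  qed
qed

text \<open>A loop that crosses \<open>S\<close> once would wind around \<open>0\<close> under the map \<open>f\<close>, which is impossible
  because \<open>f\<close> has a continuous logarithm.\<close>

lemma separation:
  obtains A B where "open A" "open B" "A \<inter> B = {}" "A \<union> B = - S"
    "\<And>p. p \<in> S \<Longrightarrow> \<exists>r h. defining_function p r h \<and> (\<forall>x\<in>ball p r. (x \<in> A \<longleftrightarrow> h x > 0) \<and> (x \<in> B \<longleftrightarrow> h x < 0))"
proof -
  \<comment> \<open>\<open>side\<close> is continuous on \<open>W\<close>, and compactness of
    \<open>S\<close> provides a tube of uniform width \<open>2 * \<delta>\<close> inside
    \<open>W\<close>.\<close>
  define W where "W = \<Union>{ball p (r / 2) | p r h. p \<in> S \<and> defining_function p r h}"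
  have "open W" by (auto simp: W_def)
  moreover have "S \<subseteq> W"
  proof
    fix p assume p: "p \<in> S"
    then obtain r h where h: "defining_function p r h" using exists_defining_function by blast
    then have "p \<in> ball p (r / 2)" by (simp add: defining_function_def)
    then show "p \<in> W" using p h unfolding W_def by blast
  qed
  ultimately obtain \<delta>' where \<delta>': "\<delta>' > 0" "(\<Union>x\<in>S. ball x \<delta>') \<subseteq> W"
    using compact_subset_open_imp_ball_epsilon_subset[OF compact_S] by metis
  define \<delta> where "\<delta> = \<delta>' / 2"
  have \<delta>: "\<delta> > 0" using \<delta>'(1) by (simp add: \<delta>_def)
  have contW: "isCont side x" if "infdist x S < 2 * \<delta>" for x
  proof -
    have "x \<in> ball (foot x) \<delta>'" using that foot(2)[of x] by (simp add: \<delta>_def dist_commute)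
    then have "x \<in> W" using \<delta>'(2) foot(1) by blast
    then show ?thesis using isCont_side by (auto simp: W_def)
  qed
  \<comment> \<open>A cut-off that vanishes outside the tube, where continuity of
    \<open>side\<close> is not known; the product \<open>side x * k x\<close> is continuous
    everywhere.\<close>
  define k where "k = (\<lambda>x. max 0 (2 * \<delta> - infdist x S))"
  have ck: "isCont k x" for x unfolding k_def by (intro continuous_intros)
  have csk: "isCont (\<lambda>x. side x * k x) x" for x
  proof (cases "infdist x S < 2 * \<delta>")
    case True
    then show ?thesis using contW ck by (intro continuous_intros)
  next
    case False
    then have k0: "k x = 0" by (simp add: k_def)
    have "((\<lambda>z. side z * k z) \<longlongrightarrow> 0) (at x)"
    proof (rule Lim_null_comparison)
      show "\<forall>\<^sub>F z in at x. norm (side z * k z) \<le> infdist z S * k z"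
        by (simp add: abs_mult abs_side k_def)
      have "isCont (\<lambda>z. infdist z S * k z) x" using ck by (intro continuous_intros)
      then show "((\<lambda>z. infdist z S * k z) \<longlongrightarrow> 0) (at x)" using k0 by (simp add: isCont_def)
    qed
    then show ?thesis using k0 by (simp add: isCont_def)
  qed
  \<comment> \<open>\<open>f\<close> sends all of \<open>S\<close> to \<open>- \<delta>\<close>,
    never vanishes, and off \<open>S\<close> avoids the nonpositive real axis. Crossing
    \<open>S\<close> thus means crossing the negative real axis, in a direction determined by the
    normal.\<close>
  define f where "f = (\<lambda>x. Complex (infdist x S - \<delta>) (side x * k x))"
  have "continuous_on UNIV f"
  proof -
    have "isCont (\<lambda>x. complex_of_real (infdist x S - \<delta>) + \<i> * complex_of_real (side x * k x)) x" for x
      by (intro continuous_add continuous_mult continuous_of_real[OF csk] continuous_of_real) (intro continuous_intros)+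
    then show ?thesis by (simp add: f_def Complex_eq continuous_on_eq_continuous_at)
  qed
  moreover have zero_Im: "x \<in> S" if "Im (f x) = 0" "Re (f x) \<le> 0" for x
  proof -
    have "infdist x S < 2 * \<delta>" using that(2) \<delta> by (simp add: f_def)
    then have "side x = 0" using that(1) by (simp add: f_def k_def)
    then show ?thesis using abs_side[of x] infdist_eq_0 by simp
  qed
  have fS: "f x = - complex_of_real \<delta>" if "x \<in> S" for x
  proof -
    have "infdist x S = 0" using that infdist_eq_0 by simp
    then show ?thesis using abs_side[of x] by (simp add: f_def complex_eq_iff)
  qed
  have "f x \<noteq> 0" for x
    using zero_Im[of x] fS[of x] \<delta> by auto
  ultimately obtain g where g: "continuous_on UNIV g" "\<And>x. f x = exp (g x)"
    using continuous_logarithm_on_contractible[of UNIV f] contractible_UNIV by auto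
  define \<theta> where "\<theta> = (\<lambda>x. Im (g x))"
  have c\<theta>: "continuous_on X \<theta>" for X
    unfolding \<theta>_def using g(1) continuous_on_subset by (intro continuous_intros) blast
  have Re_f: "Re (f x) = cmod (f x) * cos (\<theta> x)" and Im_f: "Im (f x) = cmod (f x) * sin (\<theta> x)" for x
    by (simp_all add: g(2) \<theta>_def Re_exp Im_exp)
  have cosS: "cos (\<theta> x) = - 1" if "x \<in> S" for x
  proof -
    have "\<delta> * (cos (\<theta> x) + 1) = 0" using Re_f[of x] fS[OF that] \<delta> by (simp add: algebra_simps)
    then show ?thesis using \<delta> by simp
  qed
  obtain p0 where p0: "p0 \<in> S" using nonempty_S by blast
  \<comment> \<open>\<open>\<theta>\<close> takes odd multiples of pi on the connected
    \<open>S\<close>, hence a single value \<open>c\<close>, and by \<open>zero_Im\<close> it takes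
    this value nowhere else. So \<open>S\<close> is a level set of \<open>\<theta>\<close>.\<close>
  define c where "c = \<theta> p0"
  have S_c: "\<theta> x = c" if "x \<in> S" for x
    unfolding c_def
    by (rule cos_eq_minus_one_connected_constant[of "\<theta> ` S"])
      (use connected_continuous_image[OF c\<theta> connected_S] cosS p0 that in auto)
  have cos_c: "cos c = -1" using cosS[OF p0] by (simp add: c_def)
  then have sin_c: "sin c = 0" using sin_cos_squared_add[of c] by simp
  have c_S: "x \<in> S" if "\<theta> x = c" for x
    by (rule zero_Im) (use Re_f[of x] Im_f[of x] that cos_c sin_c in auto)
  \<comment> \<open>Near \<open>S\<close>, \<open>\<theta> < c\<close> means that \<open>f\<close>
    lies just short of the negative real axis, in the upper half-plane, where \<open>side\<close> is
    positive; so \<open>n\<close> points into \<open>A\<close>.\<close>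
  define A B where "A = {x. \<theta> x < c}" and "B = {x. c < \<theta> x}"
  show ?thesis
  proof (rule that)
    show "open A" "open B"
      unfolding A_def B_def by (intro open_Collect_less c\<theta> continuous_on_const)+
    show "A \<inter> B = {}" by (auto simp: A_def B_def)
    show "A \<union> B = - S" using S_c c_S by (force simp: A_def B_def)
    fix p assume p: "p \<in> S"
    then obtain r h where h: "defining_function p r h" using exists_defining_function by blast
    then have r: "r > 0" by (simp add: defining_function_def)
    have "(\<theta> \<longlongrightarrow> c) (at p)"
      using c\<theta>[of UNIV] S_c[OF p] by (metis UNIV_I continuous_on_def)
    then have "\<forall>\<^sub>F x in nhds p. dist (\<theta> x) c < pi"
      using S_c[OF p] tendstoD[of \<theta> c "at p" pi] by (simp add: eventually_nhds_conv_at)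
    moreover have "\<forall>\<^sub>F x in nhds p. x \<in> ball p \<delta>"
      using \<delta> by (intro eventually_nhds_in_open) auto
    ultimately have "\<forall>\<^sub>F x in nhds p. dist (\<theta> x) c < pi \<and> x \<in> ball p \<delta>" by (rule eventually_conj)
    \<comment> \<open>Within pi of \<open>c\<close> the sign of \<open>sin (\<theta> x - c)\<close>
      is that of \<open>\<theta> x - c\<close>, and within \<open>\<delta>\<close> of
      \<open>p\<close> the cut-off is positive.\<close>
    then obtain s where s: "s > 0" "\<And>x. x \<in> ball p s \<Longrightarrow> \<bar>\<theta> x - c\<bar> < pi \<and> x \<in> ball p \<delta>"
      by (auto simp: eventually_nhds_metric dist_commute dist_real_def abs_minus_commute)
    define q where "q = min s (r / 2)"
    have q: "q > 0" "q \<le> s" "q \<le> r / 2" using r s(1) by (auto simp: q_def)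
    have h': "defining_function p q h"
      using h q r smooth_on_subset[of h "ball p r" "ball p q"] subset_ball[of q r p]
      by (auto simp: defining_function_def)
    have "(x \<in> A \<longleftrightarrow> h x > 0) \<and> (x \<in> B \<longleftrightarrow> h x < 0)" if x: "x \<in> ball p q" for x
    proof -
      have xs: "x \<in> ball p s" "x \<in> ball p (r / 2)" using x q by auto
      have "infdist x S \<le> dist x p" using p by (rule infdist_le)
      then have "k x > 0" using s(2)[OF xs(1)] \<delta> by (simp add: k_def dist_commute)
      have "sgn (h x) = sgn (side x)" using sgn_side[OF h p xs(2)] by simp
      also have "\<dots> = sgn (Im (f x))" using \<open>k x > 0\<close> by (simp add: f_def sgn_mult)
      also have "\<dots> = sgn (sin (\<theta> x))" using \<open>f x \<noteq> 0\<close> by (simp add: Im_f sgn_mult)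
      also have "sin (\<theta> x) = - sin (\<theta> x - c)" using cos_c sin_c by (simp add: sin_diff)
      finally have sg: "sgn (h x) = - sgn (sin (\<theta> x - c))" by (simp add: sgn_minus)
      consider "\<theta> x < c" | "\<theta> x = c" | "\<theta> x > c" by linarith
      then show ?thesis
      proof cases
        case 1
        then have "sin (\<theta> x - c) < 0" using s(2)[OF xs(1)] sin_gt_zero[of "c - \<theta> x"] by (simp add: sin_diff abs_if mult.commute)
        then have "h x > 0" using sg by (simp add: sgn_if split: if_splits)
        then show ?thesis using 1 by (simp add: A_def B_def)
      next
        case 2
        then have "h x = 0" using sg by (simp add: sgn_if split: if_splits)
        then show ?thesis using 2 by (simp add: A_def B_def)
      next
        case 3
        then have "sin (\<theta> x - c) > 0" using s(2)[OF xs(1)] by (intro sin_gt_zero) auto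
        then have "h x < 0" using sg by (simp add: sgn_if split: if_splits)
        then show ?thesis using 3 by (simp add: A_def B_def)
      qed
    qed
    then show "\<exists>r h. defining_function p r h \<and> (\<forall>x\<in>ball p r. (x \<in> A \<longleftrightarrow> h x > 0) \<and> (x \<in> B \<longleftrightarrow> h x < 0))"
      using h' by blast
  qed
qed

text \<open>\<open>h\<close> increases along directions near \<open>v\<close> at points near
  \<open>p\<close>, so a start with \<open>h \<ge> 0\<close> ends with \<open>h > 0\<close>.
  Uniformity in start and direction is what a limit of shrinking chords requires.\<close>

lemma crossing_outward:
  assumes h: "defining_function p r h" and p: "p \<in> S"
    and AB: "\<forall>x\<in>ball p r. (x \<in> A \<longleftrightarrow> h x > 0) \<and> (x \<in> B \<longleftrightarrow> h x < 0)" and v: "n p \<bullet> v > 0"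
  shows "\<exists>\<epsilon>>0. \<forall>x v' s. dist p x < \<epsilon> \<and> dist v v' < \<epsilon> \<and> 0 < s \<and> s < \<epsilon> \<and> x \<notin> B \<longrightarrow> x + s *\<^sub>R v' \<in> A"
proof -
  have sm: "smooth_on h (ball p r)" and r: "r > 0" using h by (auto simp: defining_function_def)
  have "continuous_on (ball p r \<times> UNIV) (\<lambda>z. D1 h (fst z) (snd z))"
    by (rule continuous_on_D1[OF sm]) (auto intro: continuous_intros)
  then have "((\<lambda>z. D1 h (fst z) (snd z)) \<longlongrightarrow> D1 h p v) (at (p, v))"
    using r by (simp add: continuous_on_eq_continuous_at open_Times isCont_def)
  moreover have pos: "D1 h p v > 0"
    using defining_function_normal_derivative[OF h _ p, of v] h p r v by (simp add: defining_function_def)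
  ultimately have "\<forall>\<^sub>F z in at (p, v). D1 h (fst z) (snd z) > 0"
    using order_tendstoD(1) by blast
  then have "\<forall>\<^sub>F z in nhds (p, v). D1 h (fst z) (snd z) > 0"
    using pos by (simp add: eventually_nhds_conv_at)
  then obtain d where d: "d > 0" "\<And>x w. dist (x, w) (p, v) < d \<Longrightarrow> D1 h x w > 0"
    by (auto simp: eventually_nhds_metric)
  \<comment> \<open>The path stays within \<open>\<epsilon> * (norm v + 2)\<close> of
    \<open>p\<close>, as \<open>norm v'\<close> is at most \<open>norm v + 1\<close>; the 3 leaves a
    margin.\<close>
  define K where "K = norm v + 3"
  have K: "K > 0" by (simp add: K_def add_nonneg_pos)
  define \<epsilon> where "\<epsilon> = min 1 (min (d / 2) (r / 2) / K)"
  have \<epsilon>: "\<epsilon> > 0" "\<epsilon> \<le> 1" using d(1) r K by (auto simp: \<epsilon>_def)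
  have "\<epsilon> * K \<le> min (d / 2) (r / 2)" using K by (simp add: \<epsilon>_def min_def pos_le_divide_eq[symmetric])
  then have \<epsilon>K: "\<epsilon> * K \<le> d / 2" "\<epsilon> * K \<le> r / 2" by auto
  have "x + s *\<^sub>R v' \<in> A" if *: "dist p x < \<epsilon>" "dist v v' < \<epsilon>" "0 < s" "s < \<epsilon>" "x \<notin> B" for x v' s
  proof -
    have nv': "norm v' \<le> norm v + 1"
      using *(2) \<epsilon>(2) norm_triangle_ineq[of v "v' - v"] by (simp add: dist_norm norm_minus_commute)
    have near: "dist (x + t *\<^sub>R v') p < \<epsilon> * K" if t: "0 \<le> t" "t \<le> s" for t
    proof -
      have "dist (x + t *\<^sub>R v') p \<le> dist x p + t * norm v'"
        using norm_triangle_ineq[of "x - p" "t *\<^sub>R v'"] t by (simp add: dist_norm algebra_simps)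
      also have "t * norm v' \<le> \<epsilon> * (norm v + 1)" using t *(4) nv' by (intro mult_mono) auto
      finally have "dist (x + t *\<^sub>R v') p \<le> dist x p + \<epsilon> * (norm v + 1)" by simp
      also have "\<dots> < \<epsilon> + \<epsilon> * (norm v + 1)" using *(1) by (simp add: dist_commute)
      also have "\<dots> \<le> \<epsilon> * K" using \<epsilon>(1) by (simp add: K_def algebra_simps)
      finally show ?thesis .
    qed
    have in_ball: "x + t *\<^sub>R v' \<in> ball p r" if "0 \<le> t" "t \<le> s" for t
      using near[OF that] \<epsilon>K(2) r by (simp add: dist_commute)
    have pos': "D1 h (x + t *\<^sub>R v') v' > 0" if t: "0 \<le> t" "t \<le> s" for t
    proof (rule d(2))
      have "\<epsilon> \<le> \<epsilon> * K" using \<epsilon>(1) by (simp add: K_def)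
      then have "dist v' v < d / 2" using *(2) \<epsilon>K(1) by (simp add: dist_commute)
      moreover have "dist (x + t *\<^sub>R v') p < d / 2" using near[OF t] \<epsilon>K(1) by simp
      moreover have "dist (x + t *\<^sub>R v', v') (p, v) \<le> dist (x + t *\<^sub>R v') p + dist v' v"
        by (simp add: dist_Pair_Pair sqrt_sum_squares_le_sum)
      ultimately show "dist (x + t *\<^sub>R v', v') (p, v) < d" by linarith
    qed
    have "\<exists>z>0. z < s \<and> h (x + s *\<^sub>R v') - h (x + 0 *\<^sub>R v') = (s - 0) * D1 h (x + z *\<^sub>R v') v'"
    proof (rule MVT2[OF *(3)])
      fix t assume t: "0 \<le> t" "t \<le> s"
      have "((\<lambda>t. x + t *\<^sub>R v') has_vector_derivative v') (at t)" by (auto intro!: derivative_eq_intros)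
      from has_vector_derivative_compose[OF smooth_on_derivatives(1)[OF sm in_ball[OF t]] this]
      show "((\<lambda>t. h (x + t *\<^sub>R v')) has_real_derivative D1 h (x + t *\<^sub>R v') v') (at t)"
        by (simp add: has_real_derivative_iff_has_vector_derivative)
    qed
    then obtain z where z: "0 < z" "z < s" "h (x + s *\<^sub>R v') - h x = s * D1 h (x + z *\<^sub>R v') v'" by auto
    have "h x \<ge> 0" using AB in_ball[of 0] *(3,5) by auto
    moreover have "s * D1 h (x + z *\<^sub>R v') v' > 0" using pos'[of z] z *(3) by simp
    ultimately have "h (x + s *\<^sub>R v') > 0" using z(3) by linarith
    then show ?thesis using AB in_ball[of s] *(3) by auto
  qed
  then show ?thesis using \<epsilon>(1) by blast
qed

end

subsection \<open>Compact expanders\<close>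

lemma compact_expander_is_sphere:
  fixes S \<Omega> E :: "'a::euclidean_space set"
  assumes "oriented_hypersurface S n" and "S \<noteq> {}"
    and \<Omega>E: "open \<Omega>" "open E" "\<Omega> \<inter> E = {}" "\<Omega> \<union> E = - S" and "bounded (\<Omega> \<union> S)"
    and out: "\<And>p v. \<lbrakk>p \<in> S; n p \<bullet> v > 0\<rbrakk> \<Longrightarrow>
      \<exists>\<epsilon>>0. \<forall>x v' s. dist p x < \<epsilon> \<and> dist v v' < \<epsilon> \<and> 0 < s \<and> s < \<epsilon> \<and> x \<notin> \<Omega> \<longrightarrow> x + s *\<^sub>R v' \<in> E"
    and inw: "\<And>p v. \<lbrakk>p \<in> S; n p \<bullet> v < 0\<rbrakk> \<Longrightarrow>
      \<exists>\<epsilon>>0. \<forall>x v' s. dist p x < \<epsilon> \<and> dist v v' < \<epsilon> \<and> 0 < s \<and> s < \<epsilon> \<and> x \<notin> E \<longrightarrow> x + s *\<^sub>R v' \<in> \<Omega>"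
    and expander: "\<And>x. x \<in> S \<Longrightarrow> mean_curvature S n x + 1 / 2 * (x \<bullet> n x) = lam"
  shows "\<exists>R>0. S = sphere 0 R"
proof -
  interpret oriented_hypersurface S n by fact
  have C_E: "\<Omega> \<union> S = - E" using \<Omega>E(3,4) by blast
  have S_out: "x \<notin> \<Omega>" "x \<notin> E" if "x \<in> S" for x using that \<Omega>E(4) by blast+
  have inward: "\<exists>\<epsilon>>0. \<forall>s. 0 < s \<and> s < \<epsilon> \<longrightarrow> p + s *\<^sub>R v \<in> \<Omega>" if pv: "p \<in> S" "n p \<bullet> v < 0" for p v
  proof -
    obtain \<epsilon> where \<epsilon>: "\<epsilon> > 0"
      "\<forall>x v' s. dist p x < \<epsilon> \<and> dist v v' < \<epsilon> \<and> 0 < s \<and> s < \<epsilon> \<and> x \<notin> E \<longrightarrow> x + s *\<^sub>R v' \<in> \<Omega>"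
      using inw[OF pv] by blast
    then show ?thesis using S_out(2)[OF pv(1)] by (intro exI[of _ \<epsilon>]) simp
  qed
  have outward: "\<exists>\<epsilon>>0. \<forall>s. 0 < s \<and> s < \<epsilon> \<longrightarrow> p + s *\<^sub>R v \<notin> \<Omega>" if pv: "p \<in> S" "n p \<bullet> v > 0" for p v
  proof -
    obtain \<epsilon> where \<epsilon>: "\<epsilon> > 0"
      "\<forall>x v' s. dist p x < \<epsilon> \<and> dist v v' < \<epsilon> \<and> 0 < s \<and> s < \<epsilon> \<and> x \<notin> \<Omega> \<longrightarrow> x + s *\<^sub>R v' \<in> E"
      using out[OF pv] by blast
    then have "p + s *\<^sub>R v \<in> E" if "0 < s" "s < \<epsilon>" for s using S_out(1)[OF pv(1)] that by simp
    then show ?thesis using \<epsilon>(1) \<Omega>E(3) by (intro exI[of _ \<epsilon>]) blast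
  qed
  \<comment> \<open>This is the case of a nonpositive supremum. A violating pair makes the supremum
    positive, which both kinds of contact refute.\<close>
  have le: "norm x \<le> norm y" if xy: "x \<in> \<Omega> \<union> S" "y \<notin> \<Omega>" for x y
  proof (rule ccontr)
    assume "\<not> norm x \<le> norm y"
    then have nxy: "norm y < norm x" by simp
    obtain R0 where R0: "\<And>z. z \<in> \<Omega> \<union> S \<Longrightarrow> norm z \<le> R0"
      using \<open>bounded (\<Omega> \<union> S)\<close> by (auto simp: bounded_iff)
    \<comment> \<open>The third coordinate keeps the chord direction when \<open>x\<close> and
      \<open>y\<close> merge. On \<open>Q\<close>, \<open>F\<close> is the two-point quotient, yet
      it is continuous on the closure, which is compact because \<open>norm y\<close> is
      restricted.\<close>
    define Q where "Q = {(x, y, e) | x y e. x \<in> \<Omega> \<union> S \<and> y \<notin> \<Omega> \<and> norm y \<le> R0 \<and> x \<noteq> y \<and>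
      norm e = 1 \<and> x - y = norm (x - y) *\<^sub>R e}"
    define F where "F = (\<lambda>(x, y, e :: 'a). (e \<bullet> (x + y)) / 2)"
    have QI: "(x, y, (1 / norm (x - y)) *\<^sub>R (x - y)) \<in> Q"
      if "x \<in> \<Omega> \<union> S" "y \<notin> \<Omega>" "norm y \<le> R0" "x \<noteq> y" for x y
      using that by (auto simp: Q_def)
    have FQ: "x \<bullet> x - y \<bullet> y = 2 * norm (x - y) * F (x, y, e)" if "x - y = norm (x - y) *\<^sub>R e" for x y e
    proof -
      have "x \<bullet> x - y \<bullet> y = (x - y) \<bullet> (x + y)"
        by (simp only: inner_diff_left inner_add_right) (simp add: inner_commute)
      also have "\<dots> = norm (x - y) * (e \<bullet> (x + y))" by (subst that) simp
      finally show ?thesis by (simp add: F_def)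
    qed
    have "bounded Q"
    proof (rule bounded_subset)
      show "Q \<subseteq> cball 0 R0 \<times> cball 0 R0 \<times> cball 0 1" using R0 by (auto simp: Q_def)
      show "bounded (cball (0::'a) R0 \<times> cball (0::'a) R0 \<times> cball (0::'a) 1)"
        by (intro bounded_Times bounded_cball)
    qed
    then have "compact (closure Q)" by simp
    moreover have "closure Q \<noteq> {}" using QI[OF xy] nxy R0[OF xy(1)] by fastforce
    moreover have "continuous_on (closure Q) F"
      unfolding F_def case_prod_unfold by (intro continuous_intros) auto
    ultimately obtain m where m: "m \<in> closure Q" "\<And>q. q \<in> closure Q \<Longrightarrow> F q \<le> F m"
      using continuous_attains_sup by metis
    obtain x0 y0 e0 where m_eq: "m = (x0, y0, e0)" by (cases m)
    define T where "T = F m"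
    have FT: "F q \<le> T" if "q \<in> Q" for q
      using m(2)[OF subsetD[OF closure_subset that]] by (simp add: T_def)
    have bound: "x \<bullet> x - y \<bullet> y \<le> 2 * T * norm (x - y)" if T0: "T > 0" and "x \<in> \<Omega> \<union> S" "y \<notin> \<Omega>" for x y
    proof (cases "norm y \<le> R0 \<and> x \<noteq> y")
      case True
      let ?e = "(1 / norm (x - y)) *\<^sub>R (x - y)"
      have "x \<bullet> x - y \<bullet> y = 2 * norm (x - y) * F (x, y, ?e)" using True by (intro FQ) simp
      also have "\<dots> \<le> 2 * norm (x - y) * T" using FT[OF QI] True that by (intro mult_left_mono) auto
      finally show ?thesis by (simp add: mult_ac)
    next
      case False
      \<comment> \<open>Pairs left out of \<open>Q\<close> coincide or have
        \<open>norm x \<le> R0 < norm y\<close>; for them the left side of the bound is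
        nonpositive.\<close>
      then have "norm x \<le> norm y" using R0[OF that(2)] by auto
      then have "(norm x)\<^sup>2 \<le> (norm y)\<^sup>2" by (intro power_mono) auto
      then have "x \<bullet> x - y \<bullet> y \<le> 0" by (simp add: dot_square_norm)
      also have "0 \<le> 2 * T * norm (x - y)" using T0 by simp
      finally show ?thesis .
    qed
    have T_pos: "T > 0"
    proof -
      let ?e = "(1 / norm (x - y)) *\<^sub>R (x - y)"
      have ne: "x \<noteq> y" using nxy by auto
      have "norm y * norm y < norm x * norm x" using nxy by (intro mult_strict_mono') auto
      then have "0 < x \<bullet> x - y \<bullet> y" by (simp add: dot_square_norm power2_eq_square)
      also have "\<dots> = 2 * norm (x - y) * F (x, y, ?e)" using ne by (intro FQ) simp
      finally have "F (x, y, ?e) > 0" using ne by (simp add: zero_less_mult_iff)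
      moreover have "F (x, y, ?e) \<le> T" using nxy R0[OF xy(1)] ne by (intro FT QI xy) auto
      ultimately show ?thesis by linarith
    qed
    interpret B: two_point_bound S n \<Omega> T lam
    proof
      show "closed (\<Omega> \<union> S)" using \<Omega>E(2) by (simp add: C_E closed_Compl)
    qed (use \<Omega>E S_out inward outward T_pos bound expander in \<open>blast+\<close>)
    \<comment> \<open>The conditions on a chord that survive limits; \<open>x \<noteq> y\<close> may
      be lost, which is the diagonal case.\<close>
    have "closed {(x, y, e). x \<in> \<Omega> \<union> S \<and> y \<notin> \<Omega> \<and> norm (e::'a) = 1 \<and> x - y = norm (x - y) *\<^sub>R e}"
    proof -
      have "closed ((- E) \<times> (- \<Omega>) \<times> (UNIV :: 'a set) \<inter> {z. norm (snd (snd z)) = 1}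
          \<inter> {z. fst z - fst (snd z) = norm (fst z - fst (snd z)) *\<^sub>R snd (snd z)})"
        using \<Omega>E(1,2) by (intro closed_Int closed_Times closed_Collect_eq continuous_intros) auto
      moreover have "((- E) \<times> (- \<Omega>) \<times> (UNIV :: 'a set) \<inter> {z. norm (snd (snd z)) = 1}
          \<inter> {z. fst z - fst (snd z) = norm (fst z - fst (snd z)) *\<^sub>R snd (snd z)})
        = {(x, y, e). x \<in> \<Omega> \<union> S \<and> y \<notin> \<Omega> \<and> norm (e::'a) = 1 \<and> x - y = norm (x - y) *\<^sub>R e}"
        unfolding C_E by auto
      ultimately show ?thesis by simp
    qed
    moreover have "Q \<subseteq> {(x, y, e). x \<in> \<Omega> \<union> S \<and> y \<notin> \<Omega> \<and> norm (e::'a) = 1 \<and> x - y = norm (x - y) *\<^sub>R e}"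
      by (auto simp: Q_def)
    ultimately have "m \<in> {(x, y, e). x \<in> \<Omega> \<union> S \<and> y \<notin> \<Omega> \<and> norm (e::'a) = 1 \<and> x - y = norm (x - y) *\<^sub>R e}"
      using closure_minimal m(1) by blast
    then have m0: "x0 \<in> \<Omega> \<union> S" "y0 \<notin> \<Omega>" "norm e0 = 1" "x0 - y0 = norm (x0 - y0) *\<^sub>R e0"
      by (simp_all add: m_eq)
    show False
    proof (cases "x0 = y0")
      case False
      have "x0 \<bullet> x0 - y0 \<bullet> y0 = 2 * T * norm (x0 - y0)"
        using FQ[OF m0(4)] by (simp add: T_def m_eq)
      then interpret chord_contact S n \<Omega> T lam x0 y0
        using m0 False by unfold_locales auto
      show False by (rule contradiction)
    next
      case True
      have p: "x0 \<in> S" using True m0(1,2) by blast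
      have pe: "x0 \<bullet> e0 = T" using True by (simp add: T_def m_eq F_def inner_add_right inner_commute)
      \<comment> \<open>If the limit direction pointed outward, nearby chords that start outside
        \<open>\<Omega>\<close> would end in \<open>E\<close> instead of
        \<open>\<Omega> \<union> S\<close>.\<close>
      have "\<not> n x0 \<bullet> e0 > 0"
      proof
        assume "n x0 \<bullet> e0 > 0"
        from out[OF p this] obtain \<epsilon> where \<epsilon>: "\<epsilon> > 0"
          "\<forall>x v' s. dist x0 x < \<epsilon> \<and> dist e0 v' < \<epsilon> \<and> 0 < s \<and> s < \<epsilon> \<and> x \<notin> \<Omega> \<longrightarrow> x + s *\<^sub>R v' \<in> E"
          by blast
        obtain q where q: "q \<in> Q" "dist q m < \<epsilon> / 2"
          using m(1) \<epsilon>(1) unfolding closure_approachable by (metis half_gt_zero)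
        obtain a c e where ace: "q = (a, c, e)" by (cases q)
        then have a: "a \<in> \<Omega> \<union> S" "c \<notin> \<Omega>" "a \<noteq> c" "a - c = norm (a - c) *\<^sub>R e"
          using q(1) by (auto simp: Q_def)
        have "dist (a, c, e) (x0, x0, e0) < \<epsilon> / 2" using q(2) True by (simp add: ace m_eq)
        then have d: "dist a x0 < \<epsilon> / 2" "dist c x0 < \<epsilon> / 2" "dist e e0 < \<epsilon> / 2"
          using dist_fst_le[of "(a, c, e)" "(x0, x0, e0)"] dist_snd_le[of "(a, c, e)" "(x0, x0, e0)"]
            dist_fst_le[of "(c, e)" "(x0, e0)"] dist_snd_le[of "(c, e)" "(x0, e0)"] by auto
        have "norm (a - c) < \<epsilon>"
          using d(1,2) dist_triangle2[of a c x0] by (simp add: dist_norm)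
        then have "c + norm (a - c) *\<^sub>R e \<in> E"
          using \<epsilon> d a(2,3) by (simp add: dist_commute)
        moreover have "c + norm (a - c) *\<^sub>R e = a" using a(4) by (metis add.commute diff_add_cancel)
        ultimately show False using a(1) C_E by auto
      qed
      \<comment> \<open>If it pointed inward, the genuine pair \<open>x0 + s *\<^sub>R e0\<close>,
        \<open>x0\<close> would exceed the bound by \<open>s^2\<close>.\<close>
      moreover have "\<not> n x0 \<bullet> e0 < 0"
      proof
        assume "n x0 \<bullet> e0 < 0"
        then obtain \<epsilon> where \<epsilon>: "\<epsilon> > 0" "\<forall>s. 0 < s \<and> s < \<epsilon> \<longrightarrow> x0 + s *\<^sub>R e0 \<in> \<Omega>"
          using inward[OF p] by blast
        define s where "s = \<epsilon> / 2"
        have s: "s > 0" "x0 + s *\<^sub>R e0 \<in> \<Omega>" using \<epsilon> by (auto simp: s_def)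
        have "(x0 + s *\<^sub>R e0) \<bullet> (x0 + s *\<^sub>R e0) - x0 \<bullet> x0 \<le> 2 * T * norm (x0 + s *\<^sub>R e0 - x0)"
          using s(2) S_out(1)[OF p] by (intro B.bound) auto
        moreover have "(x0 + s *\<^sub>R e0) \<bullet> (x0 + s *\<^sub>R e0) - x0 \<bullet> x0 = 2 * T * s + s * s"
        proof -
          have "e0 \<bullet> e0 = 1" using m0(3) by (simp add: dot_square_norm)
          then show ?thesis using pe by (simp add: inner_add_left inner_add_right inner_commute algebra_simps)
        qed
        moreover have "norm (x0 + s *\<^sub>R e0 - x0) = s" using s(1) m0(3) by simp
        ultimately have "s * s \<le> 0" by simp
        then show False using mult_pos_pos[OF s(1) s(1)] by simp
      qed
      ultimately have tangent: "n x0 \<bullet> e0 = 0" by simp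
      obtain U N where U: "open U" "x0 \<in> U" "smooth_on N U" "\<And>x. x \<in> S \<Longrightarrow> x \<in> U \<Longrightarrow> N x = n x"
        using normal_extension[OF p] by blast
      interpret diagonal_contact S n \<Omega> T lam U N x0 e0
        using U p m0(3) tangent pe by unfold_locales auto
      show False by (rule contradiction)
    qed
  qed
  obtain p0 where p0: "p0 \<in> S" using \<open>S \<noteq> {}\<close> by blast
  \<comment> \<open>Points of \<open>S\<close> lie in \<open>\<Omega> \<union> S\<close> and outside
    \<open>\<Omega>\<close>, so \<open>le\<close> applies to \<open>p0\<close> in both roles and
    compares every norm with \<open>R\<close>.\<close>
  define R where "R = norm p0"
  have R_up: "norm x \<le> R" if "x \<in> \<Omega> \<union> S" for x
    using le[OF that S_out(1)[OF p0]] by (simp add: R_def)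
  have R_lo: "R \<le> norm y" if "y \<notin> \<Omega>" for y
    using le[OF _ that, of p0] p0 by (simp add: R_def)
  have R_pos: "R > 0"
  proof (rule ccontr)
    assume "\<not> R > 0"
    then have "p0 = 0" by (simp add: R_def)
    have "n p0 \<bullet> - n p0 < 0" using normal_inner_self[OF p0] by simp
    then obtain \<epsilon> where \<epsilon>: "\<epsilon> > 0" "\<forall>s. 0 < s \<and> s < \<epsilon> \<longrightarrow> p0 + s *\<^sub>R - n p0 \<in> \<Omega>"
      using inward[OF p0] by blast
    then have "norm (p0 + (\<epsilon> / 2) *\<^sub>R - n p0) \<le> R" by (intro R_up) simp
    then show False using \<open>p0 = 0\<close> \<epsilon>(1) norm_normal[OF p0] by (simp add: R_def)
  qed
  moreover have "S = sphere 0 R"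
  proof
    show "S \<subseteq> sphere 0 R" using R_up R_lo S_out(1) by (force simp: order_antisym)
    show "sphere 0 R \<subseteq> S"
    proof
      fix z :: 'a assume "z \<in> sphere 0 R"
      then have z: "norm z = R" by simp
      \<comment> \<open>A point of \<open>\<Omega>\<close> of norm \<open>R\<close> could be pushed
        radially outward within \<open>\<Omega>\<close>, against \<open>R_up\<close>; one of
        \<open>E\<close> could be pushed inward, against \<open>R_lo\<close>.\<close>
      have "z \<notin> \<Omega>"
      proof
        assume "z \<in> \<Omega>"
        then obtain \<epsilon> where \<epsilon>: "\<epsilon> > 0" "\<forall>s. 0 < s \<and> s < \<epsilon> \<longrightarrow> z + s *\<^sub>R z \<in> \<Omega>"
          using segment_in_open[OF \<Omega>E(1)] by blast
        then have "norm (z + (\<epsilon> / 2) *\<^sub>R z) \<le> R" by (intro R_up) simp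
        moreover have "z + (\<epsilon> / 2) *\<^sub>R z = (1 + \<epsilon> / 2) *\<^sub>R z" by (simp add: scaleR_add_left)
        ultimately have "(1 + \<epsilon> / 2) * R \<le> R" using \<epsilon>(1) z by simp
        then show False using mult_pos_pos[OF R_pos \<epsilon>(1)] by (simp add: algebra_simps)
      qed
      moreover have "z \<notin> E"
      proof
        assume "z \<in> E"
        then obtain \<epsilon> where \<epsilon>: "\<epsilon> > 0" "\<forall>s. 0 < s \<and> s < \<epsilon> \<longrightarrow> z + s *\<^sub>R - z \<in> E"
          using segment_in_open[OF \<Omega>E(2)] by blast
        define s where "s = min \<epsilon> 1 / 2"
        have s: "0 < s" "s < \<epsilon>" "s < 1" using \<epsilon>(1) by (auto simp: s_def)
        have "R \<le> norm (z + s *\<^sub>R - z)" using \<epsilon>(2) s \<Omega>E(3) by (intro R_lo) blast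
        moreover have "z + s *\<^sub>R - z = (1 - s) *\<^sub>R z" by (simp add: scaleR_diff_left)
        ultimately have "R \<le> (1 - s) * R" using s z by simp
        then show False using mult_pos_pos[OF R_pos s(1)] by (simp add: algebra_simps)
      qed
      ultimately show "z \<in> S" using \<Omega>E(4) by blast
    qed
  qed
  ultimately show ?thesis by blast
qed

text \<open>The contrapositive, read backwards along the step: if \<open>x + s *\<^sub>R v'\<close>
  were outside \<open>B\<close>, stepping back along \<open>- v'\<close> would land in
  \<open>A\<close>, but it lands at \<open>x\<close>.\<close>

lemma crossing_inward:
  fixes p v :: "'a::real_normed_vector"
  assumes "\<exists>\<epsilon>>0. \<forall>x v' s. dist p x < \<epsilon> \<and> dist (- v) v' < \<epsilon> \<and> 0 < s \<and> s < \<epsilon> \<and> x \<notin> B \<longrightarrow> x + s *\<^sub>R v' \<in> A"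
  shows "\<exists>\<epsilon>>0. \<forall>x v' s. dist p x < \<epsilon> \<and> dist v v' < \<epsilon> \<and> 0 < s \<and> s < \<epsilon> \<and> x \<notin> A \<longrightarrow> x + s *\<^sub>R v' \<in> B"
proof -
  obtain \<epsilon> where \<epsilon>: "\<epsilon> > 0"
    "\<forall>x v' s. dist p x < \<epsilon> \<and> dist (- v) v' < \<epsilon> \<and> 0 < s \<and> s < \<epsilon> \<and> x \<notin> B \<longrightarrow> x + s *\<^sub>R v' \<in> A"
    using assms by blast
  define K where "K = norm v + 2"
  have K: "K \<ge> 2" by (simp add: K_def)
  define \<delta> where "\<delta> = min 1 (\<epsilon> / K)"
  have \<delta>: "\<delta> > 0" "\<delta> \<le> 1" "\<delta> * K \<le> \<epsilon>" using \<epsilon>(1) K by (auto simp: \<delta>_def min_def field_simps)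
  have "\<delta> * 2 \<le> \<delta> * K" using \<delta>(1) K by simp
  then have "\<delta> < \<epsilon>" using \<delta>(1,3) by linarith
  have "x + s *\<^sub>R v' \<in> B" if *: "dist p x < \<delta>" "dist v v' < \<delta>" "0 < s" "s < \<delta>" "x \<notin> A" for x v' s
  proof (rule ccontr)
    assume nB: "x + s *\<^sub>R v' \<notin> B"
    have "norm v' \<le> norm v + 1"
      using *(2) \<delta>(2) norm_triangle_ineq[of v "v' - v"] by (simp add: dist_norm norm_minus_commute)
    then have "s * norm v' \<le> \<delta> * (norm v + 1)" using *(3,4) by (intro mult_mono) auto
    moreover have "dist p (x + s *\<^sub>R v') \<le> dist p x + s * norm v'"
      using dist_triangle[of p "x + s *\<^sub>R v'" x] *(3) by (simp add: dist_norm)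
    ultimately have "dist p (x + s *\<^sub>R v') < \<delta> * K" using *(1) by (simp add: K_def algebra_simps)
    then have "dist p (x + s *\<^sub>R v') < \<epsilon>" using \<delta>(3) by simp
    moreover have "dist (- v) (- v') < \<epsilon>" using *(2) \<open>\<delta> < \<epsilon>\<close> by (simp add: dist_norm norm_minus_commute)
    ultimately have "x + s *\<^sub>R v' + s *\<^sub>R (- v') \<in> A" using \<epsilon>(2) nB *(3,4) \<open>\<delta> < \<epsilon>\<close> by (metis order.strict_trans)
    then show False using *(5) by simp
  qed
  then show ?thesis using \<delta>(1) by blast
qed

text \<open>Reversal negates the mean curvature together with the position term, so the equation
  persists with the opposite constant.\<close>

lemma (in oriented_hypersurface) reverse_orientation:
  shows "oriented_hypersurface S (\<lambda>x. - n x)"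
    and "x \<in> S \<Longrightarrow> mean_curvature S (\<lambda>x. - n x) x = - mean_curvature S n x"
proof -
  have ext: "\<exists>U g. open U \<and> p \<in> U \<and> smooth_on g U \<and> (\<forall>x\<in>U \<inter> S. g x = - n x)" if p: "p \<in> S" for p
  proof -
    obtain U N where U: "open U" "p \<in> U" "smooth_on N U" "\<And>x. x \<in> S \<Longrightarrow> x \<in> U \<Longrightarrow> N x = n x"
      using normal_extension[OF p] by blast
    then show ?thesis
      using smooth_on_bounded_linear[OF bounded_linear_minus[OF bounded_linear_ident] U(1,3)]
      by (intro exI[of _ U] exI[of _ "\<lambda>x. - N x"]) auto
  qed
  then show rev: "oriented_hypersurface S (\<lambda>x. - n x)"
    using hypersurface norm_normal tangent_iff
    by unfold_locales (auto simp: smooth_unit_normal_field_def smooth_along_def)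
  assume x: "x \<in> S"
  obtain B where B: "orthonormal_basis_of (tangent_space S x) B"
    using exists_orthonormal_basis_of_tangent_space[OF hypersurface x] by blast
  have along: "smooth_along S n" "smooth_along S (\<lambda>x. - n x)"
    using unit_normal oriented_hypersurface.unit_normal[OF rev] by (auto simp: smooth_unit_normal_field_def)
  obtain L where L: "(n has_derivative L) (at x within S)"
    using smooth_along_has_derivative[OF along(1) x] by blast
  have "tangential_derivative S (\<lambda>x. - n x) x v = - tangential_derivative S n x v" if "v \<in> B" for v
  proof -
    have v: "v \<in> tangent_space S x" using B that span_base unfolding orthonormal_basis_of_def by metis
    show ?thesis
      using tangential_derivative_eq[OF L v] tangential_derivative_eq[OF has_derivative_minus[OF L] v] by simp
  qed
  then show "mean_curvature S (\<lambda>x. - n x) x = - mean_curvature S n x"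
    using mean_curvature_eq[OF B along(1) x] mean_curvature_eq[OF B along(2) x]
    by (simp add: sum_negf)
qed

theorem theorem1p1:
  fixes m :: nat and lambda :: real
    and S :: "'a::euclidean_space set" and \<nu> :: "'a \<Rightarrow> 'a"
  assumes "m \<ge> 1" and "DIM('a) = m + 1"
    and "smooth_hypersurface S" and "compact S" and "connected S" and "S \<noteq> {}"
    and "smooth_unit_normal_field S \<nu>"
    and "\<And>x. x \<in> S \<Longrightarrow> mean_curvature S \<nu> x + 1 / 2 * (x \<bullet> \<nu> x) = lambda"
  shows "\<exists>R>0. S = sphere 0 R"
proof -
  interpret closed_hypersurface S \<nu> using assms by unfold_locales
  obtain A B where AB: "open A" "open B" "A \<inter> B = {}" "A \<union> B = - S"
    "\<And>p. p \<in> S \<Longrightarrow> \<exists>r h. defining_function p r h \<and> (\<forall>x\<in>ball p r. (x \<in> A \<longleftrightarrow> h x > 0) \<and> (x \<in> B \<longleftrightarrow> h x < 0))"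
    using separation by metis
  have plus: "\<exists>\<epsilon>>0. \<forall>x v' s. dist p x < \<epsilon> \<and> dist v v' < \<epsilon> \<and> 0 < s \<and> s < \<epsilon> \<and> x \<notin> B \<longrightarrow> x + s *\<^sub>R v' \<in> A"
    if "p \<in> S" "\<nu> p \<bullet> v > 0" for p v
    using AB(5)[OF that(1)] crossing_outward[OF _ that(1) _ that(2)] by metis
  have minus: "\<exists>\<epsilon>>0. \<forall>x v' s. dist p x < \<epsilon> \<and> dist v v' < \<epsilon> \<and> 0 < s \<and> s < \<epsilon> \<and> x \<notin> A \<longrightarrow> x + s *\<^sub>R v' \<in> B"
    if "p \<in> S" "\<nu> p \<bullet> v < 0" for p v
    by (rule crossing_inward[OF plus]) (use that in auto)
  obtain R0 where R0: "S \<subseteq> cball 0 R0"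
    using compact_imp_bounded[OF \<open>compact S\<close>] by (auto simp: bounded_iff subset_eq)
  have far: "- cball 0 R0 \<subseteq> A \<union> B" using R0 AB(4) by blast
  \<comment> \<open>The ambient dimension is at least 2, so the complement of a ball is connected
    and lies on one side of \<open>S\<close>; the other side is bounded.\<close>
  have "connected (- cball (0::'a) R0)"
    using assms(1,2) by (intro connected_complement_bounded_convex) auto
  then have "A \<inter> - cball 0 R0 = {} \<or> B \<inter> - cball 0 R0 = {}"
    using AB(1-3) far unfolding connected_def by blast
  then show ?thesis
  proof
    assume "B \<inter> - cball 0 R0 = {}"
    then have "B \<union> S \<subseteq> cball 0 R0" using R0 by blast
    then have "bounded (B \<union> S)" using bounded_subset bounded_cball by blast
    then show ?thesis
      using AB(1-4) plus minus assms(6,8)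
      by (intro compact_expander_is_sphere[of S \<nu> B A lambda]) (auto intro: oriented_hypersurface_axioms)
  next
    \<comment> \<open>Here \<open>\<nu>\<close> points into the bounded side \<open>A\<close>, so it
      is reversed and the constant changes sign.\<close>
    assume "A \<inter> - cball 0 R0 = {}"
    then have "A \<union> S \<subseteq> cball 0 R0" using R0 by blast
    then have "bounded (A \<union> S)" using bounded_subset bounded_cball by blast
    moreover have "mean_curvature S (\<lambda>x. - \<nu> x) x + 1 / 2 * (x \<bullet> - \<nu> x) = - lambda" if "x \<in> S" for x
      using reverse_orientation(2)[OF that] assms(8)[OF that] by simp
    ultimately show ?thesis
      using AB(1-4) plus minus assms(6) reverse_orientation(1)
      by (intro compact_expander_is_sphere[of S "\<lambda>x. - \<nu> x" A B "- lambda"]) auto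
  qed
qed

end
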